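(* Let $m\ge1$, $d\ge2$, $k_1,\dots,k_m\geq 2$ be integers, and let $$X=\{xy_1^{k_1}\cdots y_m^{k_m}=P(y_1,\dots,y_m,z)\}\subset\mathbb{K}^{m+2},$$ $$P=z^d+s_{d-1}(y_1,\dots,y_m)z^{d-1}+\dots+s_0(y_1,\dots,y_m),$$ where $s_j\in\mathbb{K}[y_1,\dots,y_m]$ and $s_{d-1}=0$, be a Danielewski variety. The group $\mathrm{Aut}(X)$ is commutative if and only if the canonical group $\mathbb{G}$ of $X$ is trivial.
   Context: $\mathbb{K}$ is an algebraically closed field of characteristic zero. $\mathrm{Aut}(X)$ is the group of automorphisms of the affine variety $X$. Canonical group: there is an embedding $\phi\colon\mathbb{K}[X]\hookrightarrow\mathbb{K}(y_1,\dots,y_m,z)$ with $\phi(y_i)=y_i$, $\phi(z)=z$, $\phi(x)=P/(y_1^{k_1}\cdots y_m^{k_m})$. Let $S(X)\subset\mathrm{S}_m$ be the stabilizer of the monomial $y_1^{k_1}\cdots y_m^{k_m}$ under permutations of variables. The semidirect product $G=S(X)\ltimes(\mathbb{K}^\times)^{m+1}$ (with $(\mathbb{K}^\times)^{m+1}$ normal) acts on $\mathbb{K}(y_1,\dots,y_m,z)$ by $(\sigma,t_1,\dots,t_{m+1})\cdot(y_1,\dots,y_m,z)=(t_1y_{\sigma(1)},\dots,t_my_{\sigma(m)},t_{m+1}z)$. The canonical group $\mathbb{G}\subset G$ is the stabilizer of the subalgebra $\phi(\mathbb{K}[X])$. *)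

theory Defs
  imports
    "HOL-Library.Poly_Mapping"
    "HOL-Computational_Algebra.Polynomial_Factorial"
    "HOL-Algebra.Bij"
    "HOL-Algebra.Elementary_Groups"
begin

section \<open>Polynomial rings\<close>

text \<open>
  The variables \<open>y\<^sub>1, \<dots>, y\<^sub>m\<close> are indexed by a finite type \<open>'n\<close> with \<open>m = CARD('n)\<close>.  A linear order
  on \<open>'n\<close> plays no mathematical role; the library needs it to make the polynomials an instance of
  \<^class>\<open>idom\<close>, so that their field of fractions is available.
  \<open>\<bbbK>[y\<^sub>1, \<dots>, y\<^sub>m, z]\<close> is rendered as \<open>\<bbbK>[y\<^sub>1, \<dots>, y\<^sub>m][z]\<close>, and \<open>\<bbbK>[x, y\<^sub>1, \<dots>, y\<^sub>m, z]\<close> as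
  \<open>\<bbbK>[y\<^sub>1, \<dots>, y\<^sub>m][z][x]\<close>.
\<close>

type_synonym ('n, 'k) ypoly = "('n \<Rightarrow>\<^sub>0 nat) \<Rightarrow>\<^sub>0 'k"
type_synonym ('n, 'k) yzpoly = "('n, 'k) ypoly poly"
type_synonym ('n, 'k) xyzpoly = "('n, 'k) yzpoly poly"
type_synonym ('n, 'k) yzfrac = "('n, 'k) yzpoly fract"

definition yconst :: "'k \<Rightarrow> ('n, 'k :: zero) ypoly" where
  "yconst a = Poly_Mapping.single 0 a"

definition yvar :: "'n \<Rightarrow> ('n, 'k :: comm_ring_1) ypoly" where
  "yvar i = Poly_Mapping.single (Poly_Mapping.single i 1) 1"

text \<open>
  Evaluation in a commutative ring \<open>'r\<close>, where \<open>c\<close> is the structure map \<open>\<bbbK> \<rightarrow> 'r\<close>: \<open>y\<^sub>i \<mapsto> b i\<close>,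
  \<open>z \<mapsto> w\<close>, \<open>x \<mapsto> a\<close>.
\<close>

definition eval_y ::
  "('k :: comm_ring_1 \<Rightarrow> 'r :: comm_ring_1) \<Rightarrow> ('n :: finite \<Rightarrow> 'r) \<Rightarrow> ('n, 'k) ypoly \<Rightarrow> 'r" where
  "eval_y c b p = (\<Sum>e \<in> Poly_Mapping.keys p.
     c (Poly_Mapping.lookup p e) * (\<Prod>i\<in>UNIV. b i ^ Poly_Mapping.lookup e i))"

definition eval_yz ::
  "('k :: comm_ring_1 \<Rightarrow> 'r :: comm_ring_1) \<Rightarrow> ('n :: finite \<Rightarrow> 'r) \<Rightarrow> 'r \<Rightarrow> ('n, 'k) yzpoly \<Rightarrow> 'r" where
  "eval_yz c b w p = poly (map_poly (eval_y c b) p) w"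

definition eval_xyz ::
  "('k :: comm_ring_1 \<Rightarrow> 'r :: comm_ring_1) \<Rightarrow> 'r \<Rightarrow> ('n :: finite \<Rightarrow> 'r) \<Rightarrow> 'r \<Rightarrow>
     ('n, 'k) xyzpoly \<Rightarrow> 'r" where
  "eval_xyz c a b w F = poly (map_poly (eval_yz c b w) F) a"


section \<open>Automorphism groups of affine varieties\<close>

text \<open>A point \<open>(x, y, z)\<close> of the affine space \<open>\<bbbK>\<^bsup>m+2\<^esup>\<close>.\<close>

type_synonym ('n, 'k) point = "'k \<times> ('n \<Rightarrow> 'k) \<times> 'k"

definition eval_point :: "('n :: finite, 'k :: comm_ring_1) xyzpoly \<Rightarrow> ('n, 'k) point \<Rightarrow> 'k" where
  "eval_point F p = (case p of (a, b, w) \<Rightarrow> eval_xyz id a b w F)"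

definition regular_map ::
  "('n :: finite, 'k :: comm_ring_1) point set \<Rightarrow> (('n, 'k) point \<Rightarrow> ('n, 'k) point) \<Rightarrow> bool" where
  "regular_map V f \<longleftrightarrow>
     (\<exists>A B C. \<forall>p\<in>V. f p = (eval_point A p, (\<lambda>i. eval_point (B i) p), eval_point C p))"

definition Aut_variety ::
  "('n :: finite, 'k :: comm_ring_1) point set \<Rightarrow> (('n, 'k) point \<Rightarrow> ('n, 'k) point) monoid" where
  "Aut_variety V = (BijGroup V)
     \<lparr>carrier := {f \<in> Bij V. regular_map V f \<and> regular_map V (inv_into V f)}\<rparr>"


section \<open>Danielewski varieties\<close>

definition ymonomial :: "('n :: finite \<Rightarrow> nat) \<Rightarrow> ('n, 'k :: comm_ring_1) ypoly" where
  "ymonomial k = (\<Prod>i\<in>UNIV. yvar i ^ k i)"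

definition danielewski ::
  "('n :: finite \<Rightarrow> nat) \<Rightarrow> ('n, 'k :: comm_ring_1) yzpoly \<Rightarrow> ('n, 'k) point set" where
  "danielewski k P = {(a, b, w). a * (\<Prod>i\<in>UNIV. b i ^ k i) = eval_yz id b w P}"


section \<open>The canonical group\<close>

text \<open>
  \<open>\<phi>(\<bbbK>[X]) \<subseteq> \<bbbK>(y\<^sub>1, \<dots>, y\<^sub>m, z)\<close>: as \<open>\<bbbK>[X]\<close> is a quotient of \<open>\<bbbK>[x, y\<^sub>1, \<dots>, y\<^sub>m, z]\<close>, the image of
  \<open>\<phi>\<close> is the image of the polynomial ring under \<open>x \<mapsto> P / (y\<^sub>1\<^bsup>k\<^sub>1\<^esup> \<cdots> y\<^sub>m\<^bsup>k\<^sub>m\<^esup>)\<close>, \<open>y\<^sub>i \<mapsto> y\<^sub>i\<close>, \<open>z \<mapsto> z\<close>.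
\<close>

definition phi_image ::
  "('n :: {finite, linorder} \<Rightarrow> nat) \<Rightarrow> ('n, 'k :: field) yzpoly \<Rightarrow> ('n, 'k) yzfrac set" where
  "phi_image k P = range (eval_xyz (\<lambda>a. to_fract [:yconst a:])
     (to_fract P / to_fract [:ymonomial k:]) (\<lambda>i. to_fract [:yvar i:]) (to_fract [:0, 1:]))"

text \<open>The stabilizer \<open>S(X)\<close> of the monomial \<open>y\<^sub>1\<^bsup>k\<^sub>1\<^esup> \<cdots> y\<^sub>m\<^bsup>k\<^sub>m\<^esup> \<in> \<bbbK>[y\<^sub>1, \<dots>, y\<^sub>m]\<close> under \<open>y\<^sub>i \<mapsto> y\<^bsub>\<sigma>(i)\<^esub>\<close>.\<close>

definition monomial_stabilizer ::
  "'k :: comm_ring_1 itself \<Rightarrow> ('n :: finite \<Rightarrow> nat) \<Rightarrow> ('n \<Rightarrow> 'n) set" where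
  "monomial_stabilizer _ k =
     {\<sigma>. bij \<sigma> \<and> (\<Prod>i\<in>UNIV. yvar (\<sigma> i) ^ k i) = (ymonomial k :: ('n, 'k) ypoly)}"

text \<open>
  \<open>(\<sigma>, t, u)\<close> stands for \<open>(\<sigma>, t\<^sub>1, \<dots>, t\<^sub>m, t\<^bsub>m+1\<^esub>)\<close> with \<open>u = t\<^bsub>m+1\<^esub>\<close>.  It acts on \<open>\<bbbK>[y\<^sub>1, \<dots>, y\<^sub>m, z]\<close> as the
  \<open>\<bbbK>\<close>-algebra homomorphism with \<open>y\<^sub>i \<mapsto> t\<^sub>i y\<^bsub>\<sigma>(i)\<^esub>\<close> and \<open>z \<mapsto> u z\<close>.
\<close>

type_synonym ('n, 'k) gelem = "('n \<Rightarrow> 'n) \<times> ('n \<Rightarrow> 'k) \<times> 'k"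

definition act_poly ::
  "('n :: finite, 'k :: comm_ring_1) gelem \<Rightarrow> ('n, 'k) yzpoly \<Rightarrow> ('n, 'k) yzpoly" where
  "act_poly g = (case g of (\<sigma>, t, u) \<Rightarrow>
     eval_yz (\<lambda>a. [:yconst a:]) (\<lambda>i. [:yconst (t i) * yvar (\<sigma> i):]) [:0, yconst u:])"

text \<open>
  The extension to the field of fractions, \<open>g \<cdot> (p / q) = (g \<cdot> p) / (g \<cdot> q)\<close>; see lemma
  \<open>act_Fract\<close> below.
\<close>

definition act ::
  "('n :: {finite, linorder}, 'k :: field) gelem \<Rightarrow> ('n, 'k) yzfrac \<Rightarrow> ('n, 'k) yzfrac" where
  "act g r = (THE s. \<forall>p q. q \<noteq> 0 \<longrightarrow> r = Fract p q \<longrightarrow> s = Fract (act_poly g p) (act_poly g q))"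

text \<open>
  The multiplication of \<open>G = S(X) \<ltimes> (\<bbbK>\<^sup>\<times>)\<^bsup>m+1\<^esup>\<close> is the one for which the above is a left action; see
  lemma \<open>act_poly_mult_group\<close> below.
\<close>

definition big_group :: "('n :: finite \<Rightarrow> nat) \<Rightarrow> ('n, 'k :: field) gelem monoid" where
  "big_group k =
     \<lparr>carrier = {(\<sigma>, t, u). \<sigma> \<in> monomial_stabilizer TYPE('k) k \<and> (\<forall>i. t i \<noteq> 0) \<and> u \<noteq> 0},
      mult = (\<lambda>(\<sigma>, t, u) (\<sigma>', t', u'). (\<sigma> \<circ> \<sigma>', (\<lambda>i. t' i * t (\<sigma>' i)), u * u')),
      one = (id, (\<lambda>_. 1), 1)\<rparr>"

definition canonical_group ::
  "('n :: {finite, linorder} \<Rightarrow> nat) \<Rightarrow> ('n, 'k :: field) yzpoly \<Rightarrow> ('n, 'k) gelem monoid" where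
  "canonical_group k P = (big_group k)
     \<lparr>carrier := {g \<in> carrier (big_group k). act g ` phi_image k P = phi_image k P}\<rparr>"


section \<open>The action is well defined\<close>

locale structure_map =
  fixes c :: "'k :: comm_ring_1 \<Rightarrow> 'r :: comm_ring_1"
  assumes c_add: "c (a + b) = c a + c b"
    and c_mult: "c (a * b) = c a * c b"
    and c_one: "c 1 = 1"
begin

lemma c_zero: "c 0 = 0"
  using c_add[of 0 0] by simp

lemma eval_y_superset:
  assumes "finite S" "Poly_Mapping.keys p \<subseteq> S"
  shows "eval_y c b p = (\<Sum>e\<in>S. c (Poly_Mapping.lookup p e) *
    (\<Prod>i\<in>UNIV. b i ^ Poly_Mapping.lookup e i))"
  unfolding eval_y_def using assms
  by (intro sum.mono_neutral_left) (auto simp: in_keys_iff c_zero)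

lemma eval_y_add: "eval_y c b (p + q) = eval_y c b p + eval_y c b q"
proof -
  let ?S = "Poly_Mapping.keys p \<union> Poly_Mapping.keys q"
  have "Poly_Mapping.keys (p + q) \<subseteq> ?S"
    by (rule Poly_Mapping.keys_add)
  then show ?thesis
    by (subst (1 2 3) eval_y_superset[of ?S])
       (auto simp: lookup_add c_add algebra_simps sum.distrib)
qed

lemma eval_y_single:
  "eval_y c b (Poly_Mapping.single e a) = c a * (\<Prod>i\<in>UNIV. b i ^ Poly_Mapping.lookup e i)"
  by (subst eval_y_superset[of "{e}"]) auto

lemma eval_y_zero [simp]: "eval_y c b 0 = 0"
  by (simp add: eval_y_def)

lemma ypoly_induct [case_names single add]:
  assumes "\<And>e a. Q (Poly_Mapping.single e a)"
    and "\<And>p q. Q p \<Longrightarrow> Q q \<Longrightarrow> Q (p + q)"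
  shows "Q (p :: 'a \<Rightarrow>\<^sub>0 'k)"
proof (induction p rule: Poly_Mapping.update_induct)
  case const
  show ?case using assms(1)[of undefined 0] by simp
next
  case (update f a b)
  have "Poly_Mapping.update a b f = Poly_Mapping.single a b + f"
    using update by (intro poly_mapping_eqI)
      (auto simp: lookup_update lookup_add lookup_single in_keys_iff when_def)
  then show ?case using assms update by metis
qed

lemma eval_y_mult: "eval_y c b (p * q) = eval_y c b p * eval_y c b q"
proof (induction p rule: ypoly_induct)
  case (single e a)
  show ?case
    by (induction q rule: ypoly_induct)
       (simp_all add: mult_single eval_y_single c_mult lookup_add power_add prod.distrib
          distrib_left eval_y_add algebra_simps)
qed (simp add: distrib_right eval_y_add)

lemma eval_y_yconst: "eval_y c b (yconst a) = c a"
  by (simp add: yconst_def eval_y_single)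

lemma eval_y_one: "eval_y c b 1 = 1"
  using eval_y_yconst[of b 1] by (simp add: yconst_def c_one)

lemma eval_y_yvar: "eval_y c b (yvar i) = b i"
proof -
  have "(\<Prod>j\<in>UNIV. b j ^ Poly_Mapping.lookup (Poly_Mapping.single i 1) j)
      = (\<Prod>j\<in>UNIV. if j = i then b j else 1)"
    by (intro prod.cong) (auto simp: lookup_single when_def)
  then show ?thesis by (simp add: yvar_def eval_y_single c_one)
qed

lemma eval_yz_pCons: "eval_yz c b w (pCons p q) = eval_y c b p + w * eval_yz c b w q"
  by (simp add: eval_yz_def map_poly_pCons)

lemma eval_yz_zero [simp]: "eval_yz c b w 0 = 0"
  by (simp add: eval_yz_def)

lemma eval_yz_add: "eval_yz c b w (p + q) = eval_yz c b w p + eval_yz c b w q"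
  by (induction p q rule: poly_induct2) (simp_all add: eval_yz_pCons eval_y_add algebra_simps)

lemma eval_yz_smult: "eval_yz c b w (smult a p) = eval_y c b a * eval_yz c b w p"
  by (induction p) (simp_all add: eval_yz_pCons eval_y_mult algebra_simps)

lemma eval_yz_mult: "eval_yz c b w (p * q) = eval_yz c b w p * eval_yz c b w q"
  by (induction p)
     (simp_all add: eval_yz_pCons eval_yz_add eval_yz_smult algebra_simps)

end

lemma yconst_add: "yconst (a + b) = yconst a + yconst b"
  by (simp add: yconst_def single_add)

lemma yconst_mult: "yconst (a * b) = yconst a * yconst (b :: 'k :: comm_ring_1)"
  by (simp add: yconst_def mult_single)

lemma yconst_one: "yconst 1 = 1"
  by (simp add: yconst_def)

global_interpretation const_yz: structure_map "\<lambda>a :: 'k :: comm_ring_1. [:yconst a:]"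
  by standard (simp_all add: yconst_add yconst_mult yconst_one one_pCons)

lemma act_poly_add: "act_poly g (p + q) = act_poly g p + act_poly g q"
  by (cases g) (simp add: act_poly_def const_yz.eval_yz_add)

lemma act_poly_mult: "act_poly g (p * q) = act_poly g p * act_poly g q"
  by (cases g) (simp add: act_poly_def const_yz.eval_yz_mult)

lemma act_poly_zero [simp]: "act_poly g 0 = 0"
  by (cases g) (simp add: act_poly_def)

lemma act_poly_const: "act_poly g [:yconst a:] = [:yconst a:]"
  by (cases g) (simp add: act_poly_def const_yz.eval_yz_pCons const_yz.eval_y_yconst)

lemma act_poly_y: "act_poly (\<sigma>, t, u) [:yvar i:] = [:yconst (t i) * yvar (\<sigma> i):]"
  by (simp add: act_poly_def const_yz.eval_yz_pCons const_yz.eval_y_yvar)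

lemma act_poly_z: "act_poly (\<sigma>, t, u) [:0, 1:] = [:0, yconst u:]"
  by (simp add: act_poly_def const_yz.eval_yz_pCons const_yz.eval_y_one)

lemma single_eq_prod:
  "Poly_Mapping.single e a =
     yconst a * (\<Prod>i\<in>(UNIV :: 'n :: finite set). yvar i ^ Poly_Mapping.lookup e i)"
  for a :: "'k :: comm_ring_1"
proof -
  have pow: "yvar i ^ n = (Poly_Mapping.single (Poly_Mapping.single i n) 1 :: ('n, 'k) ypoly)" for i n
    by (induction n) (simp_all add: yvar_def mult_single single_add[symmetric])
  have "(\<Prod>i\<in>S. yvar i ^ Poly_Mapping.lookup e i) =
      (Poly_Mapping.single (\<Sum>i\<in>S. Poly_Mapping.single i (Poly_Mapping.lookup e i)) 1 :: ('n, 'k) ypoly)"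
    if "finite S" for S :: "'n set"
    using that by (induction S) (simp_all add: pow mult_single)
  moreover have "(\<Sum>i\<in>(UNIV :: 'n set). Poly_Mapping.single i (Poly_Mapping.lookup e i)) = e"
    by (intro poly_mapping_eqI) (simp add: lookup_sum lookup_single when_def)
  ultimately show ?thesis by (simp add: yconst_def mult_single)
qed

text \<open>Multiplicative and additive maps on \<open>\<bbbK>[y\<^sub>1, \<dots>, y\<^sub>m, z]\<close> agree if they agree on generators.\<close>

lemma yzpoly_hom_eqI:
  fixes f h :: "('n :: finite, 'k :: comm_ring_1) yzpoly \<Rightarrow> 'r :: comm_ring_1"
  assumes add: "\<And>p q. f (p + q) = f p + f q" "\<And>p q. h (p + q) = h p + h q"
    and mult: "\<And>p q. f (p * q) = f p * f q" "\<And>p q. h (p * q) = h p * h q"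
    and const: "\<And>a. f [:yconst a:] = h [:yconst a:]"
    and y: "\<And>i. f [:yvar i:] = h [:yvar i:]"
    and z: "f [:0, 1:] = h [:0, 1:]"
  shows "f p = h p"
proof -
  have one: "f 1 = h 1"
    using const[of 1] by (simp add: yconst_one one_pCons)
  have pow: "f (x ^ n) = h (x ^ n)" if "f x = h x" for x n
    by (induction n) (simp_all add: mult one that)
  have "f (\<Prod>i\<in>S. [:yvar i:] ^ e i) = h (\<Prod>i\<in>S. [:yvar i:] ^ e i)"
    if "finite S" for S :: "'n set" and e
    using that by (induction S) (simp_all add: mult one pow y)
  note prods = this
  have pw: "[:q ^ n:] = [:q:] ^ n" for q :: "('n, 'k) ypoly" and n
    by (simp add: poly_const_pow)
  have pr: "[:(\<Prod>i\<in>S. q i):] = (\<Prod>i\<in>S. [:q i:])" if "finite S"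
    for q :: "'n \<Rightarrow> ('n, 'k) ypoly" and S
    using that
  proof (induction S)
    case (insert i S)
    have "[:q i * prod q S:] = [:q i:] * [:prod q S:]" by simp
    then show ?case
      using insert by (simp del: mult_pCons_left mult_pCons_right)
  qed (simp add: one_pCons)
  have mon: "f [:Poly_Mapping.single e a:] = h [:Poly_Mapping.single e a:]" for e a
  proof -
    have "[:Poly_Mapping.single e a:] =
        [:yconst a:] * [:\<Prod>i\<in>UNIV. yvar i ^ Poly_Mapping.lookup e i :: ('n, 'k) ypoly:]"
      by (simp add: single_eq_prod)
    also have "[:\<Prod>i\<in>UNIV. yvar i ^ Poly_Mapping.lookup e i :: ('n, 'k) ypoly:] =
        (\<Prod>i\<in>UNIV. [:yvar i:] ^ Poly_Mapping.lookup e i)"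
      by (simp add: pr pw)
    finally show ?thesis
      by (simp only: mult const prods finite)
  qed
  have coef: "f [:q:] = h [:q:]" for q
  proof (induction q rule: const_yz.ypoly_induct)
    case (add p q)
    have "[:p + q:] = [:p:] + [:q:]" by simp
    then show ?case using add by (simp add: assms(1,2) del: add_pCons)
  qed (rule mon)
  show ?thesis
  proof (induction p)
    case 0
    show ?case using coef[of 0] by simp
  next
    case (pCons a p)
    have "pCons a p = [:a:] + [:0, 1:] * p" by simp
    then show ?case using pCons coef[of a] z
      by (simp add: add mult del: add_pCons mult_pCons_left mult_pCons_right)
  qed
qed

lemma act_poly_mult_group:
  fixes k :: "'n :: finite \<Rightarrow> nat" and g h :: "('n, 'k :: field) gelem"
  shows "act_poly (mult (big_group k) g h) p = act_poly g (act_poly h p)"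
proof -
  obtain \<sigma> t u \<sigma>' t' u' where gh: "g = (\<sigma>, t, u)" "h = (\<sigma>', t', u')"
    by (metis prod_cases3)
  have y: "act_poly g [:yconst a * yvar i:] = [:yconst a * yconst (t i) * yvar (\<sigma> i):]" for a i
  proof -
    have *: "[:yconst a * yvar i:] = [:yconst a:] * ([:yvar i:] :: ('n, 'k) yzpoly)" by simp
    show ?thesis
      unfolding * act_poly_mult act_poly_const gh act_poly_y by (simp add: mult.assoc)
  qed
  have z: "act_poly g [:0, yconst a:] = [:0, yconst a * yconst u:]" for a
  proof -
    have *: "[:0, yconst a:] = [:yconst a:] * ([:0, 1:] :: ('n, 'k) yzpoly)" by simp
    show ?thesis
      unfolding * act_poly_mult act_poly_const gh act_poly_z by simp
  qed
  show ?thesis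
    by (rule yzpoly_hom_eqI[of "act_poly (mult (big_group k) g h)" "\<lambda>p. act_poly g (act_poly h p)"])
       (simp_all add: act_poly_add act_poly_mult act_poly_const y z gh(2) act_poly_y act_poly_z,
        simp_all add: gh big_group_def act_poly_y act_poly_z yconst_mult mult.commute)
qed

lemma act_poly_eq_0_iff:
  fixes t :: "'n :: finite \<Rightarrow> 'k :: field"
  assumes "bij \<sigma>" "\<And>i. t i \<noteq> 0" "u \<noteq> 0"
  shows "act_poly (\<sigma>, t, u) p = 0 \<longleftrightarrow> p = 0"
proof
  let ?g' = "(inv_into UNIV \<sigma>, (\<lambda>i. inverse (t (inv_into UNIV \<sigma> i))), inverse u)"
  have *: "mult (big_group (\<lambda>_. 0)) ?g' (\<sigma>, t, u) = (id, (\<lambda>_. 1), 1)"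
    using assms by (simp add: big_group_def bij_is_inj)
  have "act_poly (id, (\<lambda>_. 1 :: 'k), 1) p = p"
    by (rule yzpoly_hom_eqI)
       (simp_all add: act_poly_add act_poly_mult act_poly_const act_poly_y act_poly_z yconst_one)
  then have "act_poly ?g' (act_poly (\<sigma>, t, u) p) = p"
    by (simp add: * flip: act_poly_mult_group[where k = "\<lambda>_. 0"])
  then show "p = 0" if "act_poly (\<sigma>, t, u) p = 0"
    using that by simp
qed simp

lemma act_Fract:
  fixes k :: "'n :: {finite, linorder} \<Rightarrow> nat" and g :: "('n, 'k :: field) gelem"
  assumes "g \<in> carrier (big_group k)" "q \<noteq> 0"
  shows "act g (Fract p q) = Fract (act_poly g p) (act_poly g q)"
proof -
  have nz: "act_poly g r = 0 \<longleftrightarrow> r = 0" for r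
    using assms(1) by (cases g) (auto simp: big_group_def monomial_stabilizer_def act_poly_eq_0_iff)
  show ?thesis
    unfolding act_def
  proof (rule the_equality)
    show "\<forall>p' q'. q' \<noteq> 0 \<longrightarrow> Fract p q = Fract p' q' \<longrightarrow>
        Fract (act_poly g p) (act_poly g q) = Fract (act_poly g p') (act_poly g q')"
      using assms(2) by (auto simp: eq_fract nz simp flip: act_poly_mult)
  qed (use assms(2) in blast)
qed

end

theory Submission
  imports Defs "HOL-Library.Option_ord"
begin

text \<open>
  Write \<open>y\<^bsup>k\<^esup>\<close> for the product of the \<open>y\<^sub>i\<^bsup>k i\<^esup>\<close>, \<open>X\<close> for the variety and \<open>A\<close> for its coordinate ring, seen
  inside the Laurent polynomials \<open>\<bbbK>[y\<^sup>\<plusminus>\<^sup>1, z]\<close> by \<open>x = P / y\<^bsup>k\<^esup>\<close>. For every polynomial \<open>q\<close> in the \<open>y\<^sub>i\<close> there is a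
  shear of \<open>X\<close>, which fixes the \<open>y\<^sub>i\<close> and sends \<open>z\<close> to \<open>z + y\<^bsup>k\<^esup> q\<close>; shears commute with each other. The
  proof shows that every automorphism is a shear up to an element of the canonical group
  (\<open>automorphism_form\<close>). So if the canonical group is trivial, then there are only shears. Conversely an
  element \<open>(\<sigma>, t, u)\<close> of the canonical group acts on \<open>X\<close>, and commuting with the shears for \<open>q = 1\<close> and
  \<open>q = y\<^sub>i\<close> forces it to be the identity (\<open>canonical_group_trivial\<close>).

  The core is that an automorphism \<open>\<phi>\<close> of \<open>A\<close> maps \<open>\<bbbK>[y]\<close> to itself. The derivation \<open>y\<^bsup>k\<^esup> \<partial>\<^sub>z\<close> is locally
  nilpotent on \<open>A\<close> with kernel \<open>\<bbbK>[y]\<close>, so its conjugate by \<open>\<phi>\<close> is locally nilpotent with kernel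
  \<open>\<phi>(\<bbbK>[y])\<close>, and it suffices that every nonzero locally nilpotent derivation of \<open>A\<close> has its kernel in
  \<open>\<bbbK>[y]\<close>. Order the Laurent monomials lexicographically, the exponent of \<open>z\<close> first. On leading terms the
  derivation becomes \<open>\<chi>\<^bsup>g\<^esup> \<mapsto> \<ell>(g) \<chi>\<^bsup>g + \<mu>\<^esup>\<close> with an additive \<open>\<ell>\<close>, and nilpotency makes \<open>\<ell>\<close>, up to a scalar,
  a function with values in \<open>\<nat>\<close> on the semigroup of leading exponents of \<open>A\<close>, with value \<open>-1\<close> at \<open>\<mu>\<close>.
  Because \<open>d\<close> and all \<open>k i\<close> are at least \<open>2\<close>, the only such functions are multiples of the exponent of
  \<open>z\<close> (\<open>lead_exps_root\<close>); hence elements of the kernel have degree \<open>0\<close> in \<open>z\<close> (\<open>kernel_lead_exp\<close>).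

  Once \<open>\<bbbK>[y]\<close> is preserved, \<open>\<phi>\<close> multiplies degrees in \<open>z\<close> by a constant, which must be \<open>1\<close>. So
  \<open>\<phi>(z) = u z + \<beta>\<close> and \<open>\<phi>(x) = \<gamma> x + r\<close> with \<open>r\<close> of degree less than \<open>d\<close> in \<open>z\<close>. In the image of the equation
  \<open>x y\<^bsup>k\<^esup> = P\<close>, the coefficients of \<open>z\<^bsup>d\<^esup>\<close> show that each \<open>\<phi>(y\<^sub>i)\<close> divides a monomial, so \<open>\<phi>\<close> permutes the \<open>y\<^sub>i\<close>
  up to scalars; those of \<open>z\<^bsup>d - 1\<^esup>\<close>, which is absent from \<open>P\<close>, show that \<open>y\<^bsup>k\<^esup>\<close> divides \<open>\<beta>\<close>.
\<close>

section \<open>Leading exponents in monoid algebras\<close>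

definition lexp :: "('g :: linorder \<Rightarrow>\<^sub>0 'k :: zero) \<Rightarrow> 'g" where
  "lexp f = Max (Poly_Mapping.keys f)"

lemma lexp_in_keys: "f \<noteq> 0 \<Longrightarrow> lexp f \<in> Poly_Mapping.keys f"
  unfolding lexp_def by (intro Max_in) auto

lemma lookup_lexp_nonzero: "f \<noteq> 0 \<Longrightarrow> Poly_Mapping.lookup f (lexp f) \<noteq> 0"
  using lexp_in_keys[of f] by (simp add: in_keys_iff)

lemma le_lexp: "e \<in> Poly_Mapping.keys f \<Longrightarrow> e \<le> lexp f"
  unfolding lexp_def by (intro Max_ge) auto

lemma lexp_eqI:
  assumes "Poly_Mapping.lookup f a \<noteq> 0" "\<And>e. e \<in> Poly_Mapping.keys f \<Longrightarrow> e \<le> a"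
  shows "lexp f = a"
  unfolding lexp_def using assms by (intro Max_eqI) (auto simp: in_keys_iff)

lemma lexp_single [simp]: "c \<noteq> 0 \<Longrightarrow> lexp (Poly_Mapping.single a c) = a"
  by (rule lexp_eqI) (auto simp: lookup_single)

lemma lookup_single_mult:
  fixes f :: "'g :: {comm_monoid_add, cancel_ab_semigroup_add} \<Rightarrow>\<^sub>0 'k :: comm_ring_1"
  shows "Poly_Mapping.lookup (Poly_Mapping.single a c * f) (a + b) = c * Poly_Mapping.lookup f b"
  by (induction f rule: const_yz.ypoly_induct)
     (auto simp: mult_single lookup_single when_def distrib_left lookup_add)

lemma keys_mult_le:
  fixes f g :: "'g :: {linorder, ordered_cancel_comm_monoid_add} \<Rightarrow>\<^sub>0 'k :: comm_ring_1"
  assumes "\<And>e. e \<in> Poly_Mapping.keys f \<Longrightarrow> e \<le> a" "\<And>e. e \<in> Poly_Mapping.keys g \<Longrightarrow> e \<le> b"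
    and "e \<in> Poly_Mapping.keys (f * g)"
  shows "e \<le> a + b"
proof -
  obtain p q where "p \<in> Poly_Mapping.keys f" "q \<in> Poly_Mapping.keys g" "e = p + q"
    using keys_mult[of f g] assms(3) by auto
  then show ?thesis using assms(1,2) by (simp add: add_mono)
qed

lemma lookup_mult_top:
  fixes f g :: "'g :: {linorder, ordered_cancel_comm_monoid_add} \<Rightarrow>\<^sub>0 'k :: comm_ring_1"
  assumes f: "\<And>e. e \<in> Poly_Mapping.keys f \<Longrightarrow> e \<le> a" and g: "\<And>e. e \<in> Poly_Mapping.keys g \<Longrightarrow> e \<le> b"
  shows "Poly_Mapping.lookup (f * g) (a + b) = Poly_Mapping.lookup f a * Poly_Mapping.lookup g b"
proof -
  define f' where "f' = f - Poly_Mapping.single a (Poly_Mapping.lookup f a)"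
  have f': "e < a" if "e \<in> Poly_Mapping.keys f'" for e
  proof -
    have "e \<noteq> a" "e \<in> Poly_Mapping.keys f"
      using that by (auto simp: f'_def in_keys_iff lookup_minus lookup_single when_def split: if_splits)
    then show ?thesis using f[of e] by simp
  qed
  have "a + b \<notin> Poly_Mapping.keys (f' * g)"
  proof
    assume "a + b \<in> Poly_Mapping.keys (f' * g)"
    then obtain p q where pq: "p \<in> Poly_Mapping.keys f'" "q \<in> Poly_Mapping.keys g" "a + b = p + q"
      using keys_mult[of f' g] by auto
    have "p + q < a + b"
      using f'[OF pq(1)] g[OF pq(2)] by (rule add_less_le_mono)
    then show False using pq(3) by simp
  qed
  moreover have "f * g = Poly_Mapping.single a (Poly_Mapping.lookup f a) * g + f' * g"
    by (simp add: f'_def algebra_simps)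
  ultimately show ?thesis
    by (simp add: lookup_add lookup_single_mult in_keys_iff)
qed

lemma lexp_mult:
  fixes f g :: "'g :: {linorder, ordered_cancel_comm_monoid_add} \<Rightarrow>\<^sub>0 'k :: idom"
  assumes "f \<noteq> 0" "g \<noteq> 0"
  shows "lexp (f * g) = lexp f + lexp g"
proof (rule lexp_eqI)
  show "Poly_Mapping.lookup (f * g) (lexp f + lexp g) \<noteq> 0"
    using assms lookup_lexp_nonzero by (subst lookup_mult_top) (auto intro: le_lexp)
qed (rule keys_mult_le[of f _ g], auto intro: le_lexp)

text \<open>The largest and the smallest exponents are both additive under multiplication, so a factor with
  two distinct exponents would give the product two distinct exponents.\<close>

lemma mult_eq_single_imp_single:
  fixes f g :: "'g :: {linorder, ordered_cancel_comm_monoid_add} \<Rightarrow>\<^sub>0 'k :: idom"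
  assumes fg: "f * g = Poly_Mapping.single e c" and "c \<noteq> 0"
  shows "\<exists>a r. f = Poly_Mapping.single a r \<and> r \<noteq> 0"
proof -
  have "Poly_Mapping.lookup (f * g) e \<noteq> 0" using assms by simp
  then have nz: "f \<noteq> 0" "g \<noteq> 0" by auto
  have "lexp f \<le> a" if a: "a \<in> Poly_Mapping.keys f" for a
  proof (rule ccontr)
    define m where "m = Min (Poly_Mapping.keys f)"
    define m' where "m' = Min (Poly_Mapping.keys g)"
    have m: "m \<in> Poly_Mapping.keys f" "\<And>a. a \<in> Poly_Mapping.keys f \<Longrightarrow> m \<le> a"
      unfolding m_def using nz by (auto intro!: Min_in)
    have m': "m' \<in> Poly_Mapping.keys g" "\<And>a. a \<in> Poly_Mapping.keys g \<Longrightarrow> m' \<le> a"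
      unfolding m'_def using nz by (auto intro!: Min_in)
    assume "\<not> lexp f \<le> a"
    then have "m < lexp f" using m(2)[OF a] by simp
    moreover have "m' \<le> lexp g" using m'(1) by (rule le_lexp)
    moreover have "lexp f + lexp g = e"
      using lexp_mult[OF nz] fg \<open>c \<noteq> 0\<close> by simp
    ultimately have less: "m + m' < e" by (metis add_less_le_mono)
    define f' where "f' = f - Poly_Mapping.single m (Poly_Mapping.lookup f m)"
    have "m + m' \<notin> Poly_Mapping.keys (f' * g)"
    proof
      assume "m + m' \<in> Poly_Mapping.keys (f' * g)"
      then obtain p q where pq: "p \<in> Poly_Mapping.keys f'" "q \<in> Poly_Mapping.keys g" "m + m' = p + q"
        using keys_mult[of f' g] by auto
      have "p \<noteq> m" "p \<in> Poly_Mapping.keys f"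
        using pq(1) by (auto simp: f'_def in_keys_iff lookup_minus lookup_single when_def split: if_splits)
      then have "m < p" using m(2)[of p] by simp
      then have "m + m' < p + q" using m'(2)[OF pq(2)] by (rule add_less_le_mono)
      then show False using pq(3) by simp
    qed
    moreover have "f * g = Poly_Mapping.single m (Poly_Mapping.lookup f m) * g + f' * g"
      by (simp add: f'_def algebra_simps)
    ultimately have "Poly_Mapping.lookup (f * g) (m + m') \<noteq> 0"
      using m(1) m'(1) by (simp add: lookup_add lookup_single_mult in_keys_iff)
    then show False using less by (simp add: fg lookup_single when_def split: if_splits)
  qed
  then have "Poly_Mapping.keys f \<subseteq> {lexp f}"
    using le_lexp[of _ f] by force
  then have "f = Poly_Mapping.single (lexp f) (Poly_Mapping.lookup f (lexp f))"
    by (intro poly_mapping_eqI) (auto simp: lookup_single when_def in_keys_iff)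
  then show ?thesis using lookup_lexp_nonzero[OF nz(1)] by blast
qed

section \<open>Derivations of group algebras\<close>

text \<open>For additive \<open>L\<close> this is the \<open>\<bbbK>\<close>-derivation with logarithmic derivative \<open>L(g)\<close> at \<open>\<chi>\<^sup>g\<close>.\<close>

definition log_deriv ::
  "('g :: comm_monoid_add \<Rightarrow> 'g \<Rightarrow>\<^sub>0 'k :: comm_ring_1) \<Rightarrow> ('g \<Rightarrow>\<^sub>0 'k) \<Rightarrow> ('g \<Rightarrow>\<^sub>0 'k)" where
  "log_deriv L p = (\<Sum>g\<in>Poly_Mapping.keys p. Poly_Mapping.single g (Poly_Mapping.lookup p g) * L g)"

lemma log_deriv_superset:
  assumes "finite S" "Poly_Mapping.keys p \<subseteq> S"
  shows "log_deriv L p = (\<Sum>g\<in>S. Poly_Mapping.single g (Poly_Mapping.lookup p g) * L g)"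
  unfolding log_deriv_def using assms
  by (intro sum.mono_neutral_left) (auto simp: in_keys_iff)

lemma log_deriv_single: "log_deriv L (Poly_Mapping.single g c) = Poly_Mapping.single g c * L g"
  by (subst log_deriv_superset[of "{g}"]) auto

lemma log_deriv_add: "log_deriv L (p + q) = log_deriv L p + log_deriv L q"
proof -
  let ?S = "Poly_Mapping.keys p \<union> Poly_Mapping.keys q"
  have "Poly_Mapping.keys (p + q) \<subseteq> ?S" by (rule Poly_Mapping.keys_add)
  then show ?thesis
    by (subst (1 2 3) log_deriv_superset[of ?S])
       (auto simp: lookup_add single_add algebra_simps sum.distrib)
qed

lemma log_deriv_mult:
  assumes "\<And>g h. L (g + h) = L g + L h"
  shows "log_deriv L (p * q) = p * log_deriv L q + q * log_deriv L p"
proof (induction p rule: const_yz.ypoly_induct)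
  case (single e a)
  show ?case
  proof (induction q rule: const_yz.ypoly_induct)
    case (single e' a')
    have "log_deriv L (Poly_Mapping.single e a * Poly_Mapping.single e' a') =
        (Poly_Mapping.single e a * Poly_Mapping.single e' a') * (L e + L e')"
      by (simp only: mult_single log_deriv_single assms)
    then show ?case by (simp only: log_deriv_single algebra_simps)
  qed (simp add: log_deriv_add algebra_simps)
qed (simp add: log_deriv_add algebra_simps)

text \<open>This replaces the passage to the associated graded ring: only the leading term of \<open>f\<close> can contribute
  to the exponent \<open>\<nu> + \<mu>\<close>, so on leading terms the derivation is \<open>\<chi>\<^sup>\<nu> \<mapsto> \<ell>(\<nu>) \<chi>\<^bsup>\<nu> + \<mu>\<^esup>\<close>, where \<open>\<ell>(\<nu>)\<close> is the
  coefficient of \<open>\<chi>\<^sup>\<mu>\<close> in \<open>L(\<nu>)\<close>.\<close>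

lemma log_deriv_top:
  fixes L :: "'g :: {linorder, ordered_cancel_comm_monoid_add} \<Rightarrow> 'g \<Rightarrow>\<^sub>0 'k :: comm_ring_1"
  assumes L: "\<And>g e. e \<in> Poly_Mapping.keys (L g) \<Longrightarrow> e \<le> \<mu>"
    and f: "\<And>e. e \<in> Poly_Mapping.keys f \<Longrightarrow> e \<le> \<nu>"
  shows "Poly_Mapping.lookup (log_deriv L f) (\<nu> + \<mu>) =
      Poly_Mapping.lookup f \<nu> * Poly_Mapping.lookup (L \<nu>) \<mu>"
    and "e \<in> Poly_Mapping.keys (log_deriv L f) \<Longrightarrow> e \<le> \<nu> + \<mu>"
proof -
  let ?t = "\<lambda>g. Poly_Mapping.single g (Poly_Mapping.lookup f g) * L g"
  have zero: "Poly_Mapping.lookup (?t g) (\<nu> + \<mu>) = 0" if "g < \<nu>" for g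
  proof (rule ccontr)
    assume "Poly_Mapping.lookup (?t g) (\<nu> + \<mu>) \<noteq> 0"
    then have "\<nu> + \<mu> \<le> g + \<mu>"
      by (intro keys_mult_le[of "Poly_Mapping.single g (Poly_Mapping.lookup f g)" g "L g" \<mu>])
         (auto simp: L in_keys_iff lookup_single when_def split: if_splits)
    then show False using add_strict_right_mono[OF that, of \<mu>] by simp
  qed
  have "log_deriv L f = (\<Sum>g\<in>insert \<nu> (Poly_Mapping.keys f). ?t g)"
    by (rule log_deriv_superset) auto
  also have "\<dots> = ?t \<nu> + (\<Sum>g\<in>Poly_Mapping.keys f - {\<nu>}. ?t g)"
    by (simp add: sum.insert_remove)
  finally have eq: "log_deriv L f = ?t \<nu> + (\<Sum>g\<in>Poly_Mapping.keys f - {\<nu>}. ?t g)" .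
  have "(\<Sum>g\<in>Poly_Mapping.keys f - {\<nu>}. Poly_Mapping.lookup (?t g) (\<nu> + \<mu>)) = 0"
    using f by (intro sum.neutral ballI zero) force
  then show "Poly_Mapping.lookup (log_deriv L f) (\<nu> + \<mu>) =
      Poly_Mapping.lookup f \<nu> * Poly_Mapping.lookup (L \<nu>) \<mu>"
    unfolding eq by (simp add: lookup_add lookup_sum lookup_single_mult)
  show "e \<le> \<nu> + \<mu>" if "e \<in> Poly_Mapping.keys (log_deriv L f)"
  proof -
    have "e \<in> (\<Union>g\<in>Poly_Mapping.keys f. Poly_Mapping.keys (?t g))"
      using subsetD[OF keys_sum that[unfolded log_deriv_def]] .
    then obtain g where g: "g \<in> Poly_Mapping.keys f" "e \<in> Poly_Mapping.keys (?t g)" by blast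
    have "e \<le> g + \<mu>"
      by (rule keys_mult_le[of "Poly_Mapping.single g (Poly_Mapping.lookup f g)" g "L g" \<mu>])
         (use g L in \<open>auto split: if_splits\<close>)
    also have "\<dots> \<le> \<nu> + \<mu>" using f[OF g(1)] by (rule add_right_mono)
    finally show ?thesis .
  qed
qed

section \<open>Locally nilpotent derivations\<close>

text \<open>The exponent of \<open>z\<close> is indexed by \<^term>\<open>None\<close> and that of \<open>y\<^sub>i\<close> by \<^term>\<open>Some i\<close>. Since \<^term>\<open>None\<close> is the
  least index, the lexicographic order on exponents compares the degrees in \<open>z\<close> first.\<close>

type_synonym ('n, 'k) laurent = "('n option \<Rightarrow>\<^sub>0 int) \<Rightarrow>\<^sub>0 'k"

text \<open>These turn out to be the leading exponents of the nonzero elements of the coordinate ring (lemma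
  \<open>lexp_range_lau\<close>): that of \<open>x\<close> has \<open>d\<close> at \<open>z\<close> and \<open>- k i\<close> at \<open>y\<^sub>i\<close>, so every full \<open>d\<close> in the degree in \<open>z\<close> allows one
  more factor \<open>x\<close>.\<close>

definition lead_exps :: "nat \<Rightarrow> ('n \<Rightarrow> nat) \<Rightarrow> ('n option \<Rightarrow>\<^sub>0 int) set" where
  "lead_exps d k = {g. 0 \<le> Poly_Mapping.lookup g None \<and>
     (\<forall>i. - int (k i) * (Poly_Mapping.lookup g None div int d) \<le> Poly_Mapping.lookup g (Some i))}"

text \<open>
  The cone spanned by the leading exponents is simplicial: its rays are those of \<open>x\<close> and the \<open>y\<^sub>i\<close>, and
  its facets are given by the exponent of \<open>z\<close> and by \<open>\<beta>\<^sub>j(g) = d g\<^sub>j + k\<^sub>j g\<^sub>z\<close>. A function \<open>n\<close> as below moves every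
  ray on which it is positive to the face where it vanishes, in the direction \<open>\<mu>\<close>. Two such rays would
  contradict each other, so \<open>n\<close> is proportional to one facet function. It cannot be proportional to \<open>\<beta>\<^sub>i\<close>: the
  values of \<open>\<beta>\<^sub>i\<close> are the numbers \<open>d \<alpha> + k\<^sub>i \<rho>\<close> with \<open>\<alpha> \<ge> 0\<close> and \<open>0 \<le> \<rho> < d\<close>, and together with the divisibility
  of the degree in \<open>z\<close> by \<open>d\<close> on the face this would make \<open>d = 1\<close> or \<open>k\<^sub>i = 1\<close>.
\<close>

lemma lead_exps_root:
  fixes k :: "'n :: finite \<Rightarrow> nat" and n :: "('n option \<Rightarrow>\<^sub>0 int) \<Rightarrow> int"
  assumes "d \<ge> 2" and k: "\<And>i. k i \<ge> 2"
    and n: "\<And>g. n g = nz * Poly_Mapping.lookup g None + (\<Sum>i\<in>UNIV. ni i * Poly_Mapping.lookup g (Some i))"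
    and nonneg: "\<And>g. g \<in> lead_exps d k \<Longrightarrow> n g \<ge> 0"
    and root: "n \<mu> = -1"
    and step: "\<And>g. g \<in> lead_exps d k \<Longrightarrow> n g > 0 \<Longrightarrow> g + \<mu> \<in> lead_exps d k"
  shows "ni i = 0"
proof (rule ccontr)
  let ?lu = Poly_Mapping.lookup
  assume "ni i \<noteq> 0"
  define Ey :: "'n \<Rightarrow> ('n option \<Rightarrow>\<^sub>0 int)" where "Ey j = Poly_Mapping.single (Some j) 1" for j
  define Ez :: "'n option \<Rightarrow>\<^sub>0 int" where "Ez = Poly_Mapping.single None 1"
  define X :: "'n option \<Rightarrow>\<^sub>0 int" where
    "X = Poly_Mapping.single None (int d) - (\<Sum>j\<in>UNIV. Poly_Mapping.single (Some j) (int (k j)))"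
  have Ey: "?lu (Ey j) None = 0" "?lu (Ey j) (Some l) = (if l = j then 1 else 0)" for j l
    by (auto simp: Ey_def lookup_single when_def)
  have Ez: "?lu Ez None = 1" "?lu Ez (Some l) = 0" for l
    by (auto simp: Ez_def lookup_single when_def)
  have X: "?lu X None = int d" "?lu X (Some l) = - int (k l)" for l
    by (auto simp: X_def lookup_minus lookup_sum lookup_single when_def)
  have mem: "Ey j \<in> lead_exps d k" "Ez \<in> lead_exps d k" "X \<in> lead_exps d k" for j
    using \<open>d \<ge> 2\<close> by (auto simp: lead_exps_def Ey Ez X)
  have nE: "n (Ey j) = ni j" "n Ez = nz" "n X = int d * nz - (\<Sum>j\<in>UNIV. ni j * int (k j))" for j
    by (auto simp: n Ey Ez X sum_negf if_distrib cong: if_cong)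
  have n_add: "n (g + frag_cmul c \<mu>) = n g - c" for g c
  proof -
    have "n (g + frag_cmul c \<mu>) = n g + c * n \<mu>"
      by (simp add: n lookup_add algebra_simps sum.distrib sum_distrib_left)
    then show ?thesis by (simp add: root)
  qed
  have iter: "g + frag_cmul (int m) \<mu> \<in> lead_exps d k" if "g \<in> lead_exps d k" "int m \<le> n g" for g m
    using that(2)
  proof (induction m)
    case (Suc m)
    have "g + frag_cmul (int m) \<mu> + \<mu> \<in> lead_exps d k"
      using Suc by (intro step) (auto simp: n_add)
    then show ?case by (simp add: frag_cmul_distrib add_ac)
  qed (use that in simp)
  have iter': "g + frag_cmul c \<mu> \<in> lead_exps d k" if "g \<in> lead_exps d k" "0 \<le> c" "c \<le> n g" for g c
    using iter[of g "nat c"] that by simp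
  define nx where "nx = n X"
  define \<beta> where "\<beta> j g = int d * ?lu g (Some j) + int (k j) * ?lu g None"
    for j and g :: "'n option \<Rightarrow>\<^sub>0 int"
  have \<beta>_nonneg: "\<beta> j g \<ge> 0" if "g \<in> lead_exps d k" for j g
  proof -
    define q where "q = ?lu g None div int d"
    have "?lu g None = int d * q + ?lu g None mod int d" by (simp add: q_def)
    moreover have "0 \<le> ?lu g None mod int d" using \<open>d \<ge> 2\<close> by simp
    ultimately have "int d * q \<le> ?lu g None" by linarith
    then have "int (k j) * (int d * q) \<le> int (k j) * ?lu g None" by (intro mult_left_mono) auto
    moreover have "int d * (- int (k j) * q) \<le> int d * ?lu g (Some j)"
      using that by (intro mult_left_mono) (auto simp: lead_exps_def q_def)
    ultimately show ?thesis by (simp add: \<beta>_def algebra_simps)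
  qed
  have n_facets: "int d * n g = (\<Sum>j\<in>UNIV. ni j * \<beta> j g) + nx * ?lu g None" for g
    by (simp add: nx_def n X \<beta>_def algebra_simps sum.distrib sum_distrib_left sum_negf)
  have ni_nonneg: "ni j \<ge> 0" for j using nonneg[OF mem(1)[of j]] nE by simp
  have nx_nonneg: "nx \<ge> 0" using nonneg[OF mem(3)] nx_def by simp
  \<comment> \<open>On the zero set of \<open>n\<close> every summand of \<open>n_facets\<close> vanishes, as none is negative.\<close>
  have face: "ni j * \<beta> j g = 0" "nx * ?lu g None = 0" if "g \<in> lead_exps d k" "n g = 0" for g j
  proof -
    have 1: "0 \<le> ni j * \<beta> j g" for j using ni_nonneg \<beta>_nonneg[OF that(1)] by simp
    have 2: "0 \<le> nx * ?lu g None" using nx_nonneg that(1) by (simp add: lead_exps_def)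
    have 3: "(\<Sum>j\<in>UNIV. ni j * \<beta> j g) + nx * ?lu g None = 0"
      using n_facets[of g] that(2) by simp
    have "(\<Sum>j\<in>UNIV. ni j * \<beta> j g) \<ge> 0" using 1 by (intro sum_nonneg) auto
    then have "nx * ?lu g None = 0" "(\<Sum>j\<in>UNIV. ni j * \<beta> j g) = 0" using 2 3 by linarith+
    then show "ni j * \<beta> j g = 0" "nx * ?lu g None = 0" using 1 by (simp_all add: sum_nonneg_eq_0_iff)
  qed
  have ni_pos: "ni i > 0" using ni_nonneg[of i] \<open>ni i \<noteq> 0\<close> by simp
  define v where "v j = Ey j + frag_cmul (ni j) \<mu>" for j
  have v: "v j \<in> lead_exps d k" "n (v j) = 0" for j
    using iter'[OF mem(1)[of j], of "ni j"] ni_nonneg[of j] by (auto simp: v_def nE n_add)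
  \<comment> \<open>\<open>y\<^sub>i\<close> and \<open>x\<close> cannot both be moved: the first requires \<open>\<mu>\<close> to have no \<open>z\<close>, the second then keeps \<open>z\<^sup>d\<close>.\<close>
  have "nx = 0"
  proof (rule ccontr)
    assume "nx \<noteq> 0"
    then have "?lu (v i) None = 0" using face(2)[OF v, of i] by simp
    then have "?lu \<mu> None = 0" using ni_pos by (simp add: v_def lookup_add Ey)
    moreover have "X + frag_cmul nx \<mu> \<in> lead_exps d k" "n (X + frag_cmul nx \<mu>) = 0"
      using iter'[OF mem(3), of nx] nx_nonneg by (auto simp: n_add nx_def)
    from face(2)[OF this] have "?lu (X + frag_cmul nx \<mu>) None = 0" using \<open>nx \<noteq> 0\<close> by simp
    ultimately show False using \<open>d \<ge> 2\<close> by (simp add: lookup_add X)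
  qed
  \<comment> \<open>\<open>y\<^sub>i\<close> and \<open>y\<^sub>j\<close> cannot both be moved: the first requires \<open>\<beta>\<^sub>j(\<mu>) = 0\<close>, the second \<open>\<beta>\<^sub>j(\<mu>) < 0\<close>.\<close>
  have others: "ni j = 0" if "j \<noteq> i" for j
  proof (rule ccontr)
    assume "ni j \<noteq> 0"
    then have "\<beta> j (v j) = 0" "\<beta> j (v i) = 0" using face(1)[OF v, of j] by auto
    moreover have "\<beta> j (v j) = int d + ni j * \<beta> j \<mu>" "\<beta> j (v i) = ni i * \<beta> j \<mu>"
      using that by (simp_all add: \<beta>_def v_def lookup_add Ey algebra_simps)
    ultimately show False using ni_pos \<open>d \<ge> 2\<close> by auto
  qed
  have sum_i: "(\<Sum>j\<in>UNIV. ni j * f j) = ni i * f i" for f :: "'n \<Rightarrow> int"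
    using others by (subst sum.remove[of _ i]) (auto intro!: sum.neutral)
  have n_i: "n g = nz * ?lu g None + ni i * ?lu g (Some i)" for g
    by (simp add: n sum_i)
  have dk: "int d * nz = int (k i) * ni i"
    using \<open>nx = 0\<close> unfolding nx_def nE by (simp add: sum_i)
  have nz_pos: "nz > 0"
  proof -
    have "int d * nz > 0" unfolding dk using ni_pos k[of i] by simp
    then show ?thesis by (simp add: zero_less_mult_iff)
  qed
  define \<alpha> where "\<alpha> g = ?lu g (Some i) + int (k i) * (?lu g None div int d)" for g
  define \<rho> where "\<rho> g = ?lu g None mod int d" for g :: "'n option \<Rightarrow>\<^sub>0 int"
  have n_\<alpha>: "n g = nz * \<rho> g + ni i * \<alpha> g" for g
  proof -
    have "nz * ?lu g None = nz * (int d * (?lu g None div int d) + \<rho> g)"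
      by (simp add: \<rho>_def)
    also have "\<dots> = int d * nz * (?lu g None div int d) + nz * \<rho> g" by (simp add: algebra_simps)
    finally show ?thesis unfolding n_i dk \<alpha>_def by (simp add: algebra_simps)
  qed
  have \<alpha>_nonneg: "\<alpha> g \<ge> 0" if "g \<in> lead_exps d k" for g
    using that by (auto simp: lead_exps_def \<alpha>_def dest!: spec[of _ i])
  have \<rho>_nonneg: "\<rho> g \<ge> 0" for g using \<open>d \<ge> 2\<close> by (simp add: \<rho>_def)
  have dvd: "int d dvd ?lu g None" if "g \<in> lead_exps d k" "n g = 0" for g
  proof -
    have "nz * \<rho> g \<ge> 0" "ni i * \<alpha> g \<ge> 0"
      using \<rho>_nonneg[of g] \<alpha>_nonneg[OF that(1)] nz_pos ni_pos by auto
    then have "nz * \<rho> g = 0" using n_\<alpha>[of g] that(2) by linarith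
    then show ?thesis using nz_pos by (auto simp: \<rho>_def dvd_eq_mod_eq_0)
  qed
  have dvd1: "int d dvd ni i * ?lu \<mu> None"
    using dvd[OF v, of i] by (simp add: v_def lookup_add Ey)
  have dvd2: "int d dvd 1 + nz * ?lu \<mu> None"
    using dvd[of "Ez + frag_cmul nz \<mu>"] iter'[OF mem(2), of nz] nz_pos
    by (simp add: nE n_add lookup_add Ez)
  \<comment> \<open>One step before the face the value of \<open>n\<close> is \<open>1\<close>, which leaves two cases for its coefficients.\<close>
  define w where "w = Ey i + frag_cmul (ni i - 1) \<mu>"
  have w: "w \<in> lead_exps d k" "n w = 1"
    using iter'[OF mem(1)[of i], of "ni i - 1"] ni_pos by (auto simp: w_def nE n_add)
  have 1: "nz * \<rho> w + ni i * \<alpha> w = 1" using n_\<alpha>[of w] w(2) by simp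
  have "ni i = 1 \<or> nz = 1"
  proof (cases "\<alpha> w = 0")
    case True
    then show ?thesis using 1 nz_pos by (simp add: zmult_eq_1_iff)
  next
    case False
    then have "ni i * 1 \<le> ni i * \<alpha> w"
      using \<alpha>_nonneg[OF w(1)] ni_pos by (intro mult_left_mono) auto
    moreover have "nz * \<rho> w \<ge> 0" using nz_pos \<rho>_nonneg[of w] by simp
    ultimately show ?thesis using 1 ni_pos by linarith
  qed
  then show False
  proof
    assume "ni i = 1"
    then have "int d dvd nz * ?lu \<mu> None" using dvd1 by simp
    then have "int d dvd 1" using dvd2 by (simp add: dvd_add_left_iff)
    then show False using \<open>d \<ge> 2\<close> by simp
  next
    assume nz: "nz = 1"
    have "int d dvd ni i * (1 + ?lu \<mu> None)" using dvd2 nz by (simp add: dvd_mult)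
    then have "int d dvd ni i * (1 + ?lu \<mu> None) - ni i * ?lu \<mu> None" using dvd1 by (rule dvd_diff)
    then have "int d dvd ni i" by (simp add: algebra_simps)
    then have "int d \<le> ni i" using ni_pos by (rule zdvd_imp_le)
    moreover have "2 * ni i \<le> int (k i) * ni i" using k[of i] ni_pos by (intro mult_right_mono) auto
    ultimately show False using dk nz ni_pos by simp
  qed
qed

text \<open>
  On leading terms \<open>D\<close> acts as \<open>\<chi>\<^bsup>g\<^esup> \<mapsto> l(g) \<chi>\<^bsup>g + \<mu>\<^esup>\<close>. Nilpotency means that \<open>l\<close> vanishes at some \<open>g + j \<mu>\<close>, so
  \<open>l(g)\<close> is a natural multiple of \<open>- l(\<mu>)\<close> for each leading exponent \<open>g\<close>; as long as \<open>l(g) \<noteq> 0\<close> the shifted exponent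
  \<open>g + \<mu>\<close> is again a leading exponent, namely of \<open>D f\<close>. By \<open>lead_exps_root\<close> the multiplier is a
  multiple of the exponent of \<open>z\<close>, and it vanishes on the leading exponent of an element of the kernel.
\<close>

lemma kernel_lead_exp:
  fixes k :: "'n :: {finite, linorder} \<Rightarrow> nat" and L :: "'n option \<Rightarrow> ('n, 'k :: field_char_0) laurent"
    and A :: "('n, 'k) laurent set"
  defines "D \<equiv> log_deriv (\<lambda>g. \<Sum>\<kappa>\<in>UNIV. of_int (Poly_Mapping.lookup g \<kappa>) * L \<kappa>)"
  assumes "d \<ge> 2" and k: "\<And>i. k i \<ge> 2"
    and D_closed: "\<And>f. f \<in> A \<Longrightarrow> D f \<in> A"
    and nilpotent: "\<And>f. f \<in> A \<Longrightarrow> \<exists>j. (D ^^ j) f = 0"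
    and lexp_A: "lexp ` (A - {0}) = lead_exps d k"
    and L_nz: "L \<kappa>0 \<noteq> 0"
    and f: "f \<in> A" "f \<noteq> 0" "D f = 0"
  shows "Poly_Mapping.lookup (lexp f) None = 0"
proof -
  let ?lu = Poly_Mapping.lookup
  define LL where "LL g = (\<Sum>\<kappa>\<in>UNIV. of_int (?lu g \<kappa>) * L \<kappa>)" for g
  define \<mu> where "\<mu> = Max (\<Union>\<kappa>. Poly_Mapping.keys (L \<kappa>))"
  have ne: "(\<Union>\<kappa>. Poly_Mapping.keys (L \<kappa>)) \<noteq> {}"
    using L_nz by auto
  have "\<mu> \<in> (\<Union>\<kappa>. Poly_Mapping.keys (L \<kappa>))"
    unfolding \<mu>_def using ne by (intro Max_in) auto
  then obtain \<kappa>1 where \<kappa>1: "?lu (L \<kappa>1) \<mu> \<noteq> 0" by (auto simp: in_keys_iff)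
  have le_\<mu>: "e \<le> \<mu>" if "e \<in> Poly_Mapping.keys (L \<kappa>)" for e \<kappa>
    unfolding \<mu>_def using that by (intro Max_ge) auto
  define l where "l g = ?lu (LL g) \<mu>" for g
  have lookup_of_int_mult: "?lu (of_int c * p) e = of_int c * ?lu p e" for c e and p :: "('n, 'k) laurent"
    using lookup_single_mult[of 0 "of_int c" p e] by (simp only: single_of_int add_0)
  have LL_keys: "e \<le> \<mu>" if "e \<in> Poly_Mapping.keys (LL g)" for e g
  proof -
    have "?lu (LL g) e \<noteq> 0" using that by (simp add: in_keys_iff)
    then have "\<exists>\<kappa>. ?lu (L \<kappa>) e \<noteq> 0"
      unfolding LL_def by (auto simp: lookup_sum lookup_of_int_mult dest: sum.not_neutral_contains_not_neutral)
    then show ?thesis using le_\<mu> by (auto simp: in_keys_iff)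
  qed
  have l: "l g = (\<Sum>\<kappa>\<in>UNIV. of_int (?lu g \<kappa>) * ?lu (L \<kappa>) \<mu>)" for g
    by (simp add: l_def LL_def lookup_sum lookup_of_int_mult)
  have l_add: "l (g + h) = l g + l h" for g h
    by (simp add: l lookup_add algebra_simps sum.distrib)
  have l_cmul: "l (frag_cmul c g) = of_int c * l g" for c g
    by (simp add: l sum_distrib_left mult.assoc)
  have l_single: "l (Poly_Mapping.single \<kappa> 1) = ?lu (L \<kappa>) \<mu>" for \<kappa>
  proof -
    have "l (Poly_Mapping.single \<kappa> 1) = (\<Sum>\<kappa>'\<in>UNIV. if \<kappa>' = \<kappa> then ?lu (L \<kappa>') \<mu> else 0)"
      unfolding l by (intro sum.cong) (auto simp: lookup_single when_def)
    then show ?thesis by simp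
  qed
  have D_eq: "D = log_deriv LL" unfolding D_def LL_def ..
  have top: "?lu (D h) (lexp h + \<mu>) = ?lu h (lexp h) * l (lexp h)" for h
    unfolding D_eq l_def using LL_keys by (intro log_deriv_top) (auto intro: le_lexp)
  have bound: "e \<le> lexp h + \<mu>" if "e \<in> Poly_Mapping.keys (D h)" for e h
    using that unfolding D_eq by (intro log_deriv_top[of LL \<mu> h]) (auto intro: le_lexp LL_keys)
  have lexp_D: "D h \<noteq> 0" "lexp (D h) = lexp h + \<mu>" if "h \<noteq> 0" "l (lexp h) \<noteq> 0" for h
  proof -
    have "?lu (D h) (lexp h + \<mu>) \<noteq> 0" using top[of h] that lookup_lexp_nonzero by simp
    then show "D h \<noteq> 0" "lexp (D h) = lexp h + \<mu>" using bound by (auto intro!: lexp_eqI)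
  qed
  have realize: "\<exists>h. h \<in> A \<and> h \<noteq> 0 \<and> lexp h = g" if "g \<in> lead_exps d k" for g
    using that unfolding lexp_A[symmetric] by auto
  have l_step: "g + \<mu> \<in> lead_exps d k" if g: "g \<in> lead_exps d k" "l g \<noteq> 0" for g
  proof -
    obtain h where h: "h \<in> A" "h \<noteq> 0" "lexp h = g"
      using realize[OF g(1)] by blast
    then have "lexp (D h) = g + \<mu>" "D h \<noteq> 0" using lexp_D[of h] g by auto
    then have "g + \<mu> \<in> lexp ` (A - {0})" using D_closed[OF h(1)] by (intro rev_image_eqI[of "D h"]) auto
    then show ?thesis unfolding lexp_A .
  qed
  have l_zero: "\<exists>j. l (g + frag_cmul (int j) \<mu>) = 0" if g: "g \<in> lead_exps d k" for g
  proof (rule ccontr)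
    assume "\<not> ?thesis"
    then have nz: "l (g + frag_cmul (int j) \<mu>) \<noteq> 0" for j by blast
    obtain h where h: "h \<in> A" "h \<noteq> 0" "lexp h = g"
      using realize[OF g] by blast
    have "(D ^^ j) h \<noteq> 0 \<and> lexp ((D ^^ j) h) = g + frag_cmul (int j) \<mu>" for j
    proof (induction j)
      case (Suc j)
      then show ?case
        using lexp_D[of "(D ^^ j) h"] nz[of j] by (simp add: frag_cmul_distrib add_ac)
    qed (simp add: h)
    then show False using nilpotent[OF h(1)] by blast
  qed
  have Ey: "Poly_Mapping.single \<kappa> 1 \<in> lead_exps d k" for \<kappa> :: "'n option"
    using \<open>d \<ge> 2\<close> by (auto simp: lead_exps_def lookup_single when_def)
  define h where "h = - l \<mu>"
  have l_nat: "\<exists>m::nat. l g = of_nat m * h" if g: "g \<in> lead_exps d k" for g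
    using l_zero[OF g] by (auto simp: l_add l_cmul h_def eq_neg_iff_add_eq_0)
  have "h \<noteq> 0"
    using l_nat[OF Ey[of \<kappa>1]] \<kappa>1 by (auto simp: l_single)
  obtain m where m: "\<And>\<kappa>. l (Poly_Mapping.single \<kappa> 1) = of_nat (m \<kappa>) * h"
    using l_nat[OF Ey] by metis
  define n where "n g = (\<Sum>\<kappa>\<in>UNIV. int (m \<kappa>) * ?lu g \<kappa>)" for g
  have l_n: "l g = of_int (n g) * h" for g
    by (simp add: l n_def m[unfolded l_single] sum_distrib_left sum_distrib_right mult_ac)
  have n_split: "n g = int (m None) * ?lu g None + (\<Sum>i\<in>UNIV. int (m (Some i)) * ?lu g (Some i))" for g
    unfolding n_def by (simp add: UNIV_option_conv sum.insert sum.reindex o_def)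
  have mi: "int (m (Some i)) = 0" for i
  proof (rule lead_exps_root[OF \<open>d \<ge> 2\<close> k n_split])
    show "n g \<ge> 0" if g: "g \<in> lead_exps d k" for g
    proof -
      obtain j :: nat where "l g = of_nat j * h" using l_nat[OF g] by blast
      then have "(of_int (n g) :: 'k) = of_int (int j)" using l_n[of g] \<open>h \<noteq> 0\<close> by simp
      then show ?thesis unfolding of_int_eq_iff by simp
    qed
    have "of_int (n \<mu>) * h = of_int (-1) * h" using l_n[of \<mu>] h_def by simp
    then have "(of_int (n \<mu>) :: 'k) = of_int (-1)" using \<open>h \<noteq> 0\<close> mult_right_cancel by blast
    then show "n \<mu> = -1" unfolding of_int_eq_iff .
    show "g + \<mu> \<in> lead_exps d k" if "g \<in> lead_exps d k" "n g > 0" for g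
      using l_step[OF that(1)] that(2) \<open>h \<noteq> 0\<close> by (simp add: l_n)
  qed
  then have n_z: "n g = int (m None) * ?lu g None" for g by (simp add: n_split)
  have "m None \<noteq> 0"
  proof
    assume "m None = 0"
    then have "l (Poly_Mapping.single \<kappa>1 1) = 0" by (simp add: l_n n_z)
    then show False using \<kappa>1 by (simp add: l_single)
  qed
  moreover have "l (lexp f) = 0" using lexp_D(1)[of f] f by blast
  then have "n (lexp f) = 0" using l_n[of "lexp f"] \<open>h \<noteq> 0\<close> by simp
  ultimately show ?thesis by (simp add: n_z)
qed

section \<open>Polynomials modulo the equation of the variety\<close>

context structure_map
begin

lemma eval_y_pow: "eval_y c b (p ^ n) = eval_y c b p ^ n"
  by (induction n) (simp_all add: eval_y_one eval_y_mult)

lemma eval_y_prod: "finite S \<Longrightarrow> eval_y c b (\<Prod>i\<in>S. f i) = (\<Prod>i\<in>S. eval_y c b (f i))"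
  by (induction S rule: finite_induct) (simp_all add: eval_y_one eval_y_mult)

lemma eval_y_ymonomial: "eval_y c b (ymonomial k) = (\<Prod>i\<in>UNIV. b i ^ k i)"
  by (simp add: ymonomial_def eval_y_prod eval_y_pow eval_y_yvar)

lemma eval_yz_const: "eval_yz c b w [:q:] = eval_y c b q"
  by (simp add: eval_yz_pCons)

lemma eval_yz_z: "eval_yz c b w [:0, 1:] = w"
  by (simp add: eval_yz_pCons eval_y_one)

lemma eval_yz_one: "eval_yz c b w 1 = 1"
  by (simp add: one_pCons eval_yz_const eval_y_one)

lemma eval_yz_uminus: "eval_yz c b w (- p) = - eval_yz c b w p"
  using eval_yz_add[of b w p "- p"] by (simp add: eq_neg_iff_add_eq_0 add.commute)

lemma eval_yz_diff: "eval_yz c b w (p - q) = eval_yz c b w p - eval_yz c b w q"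
  using eval_yz_add[of b w p "- q"] by (simp add: eval_yz_uminus)

lemma eval_yz_pow: "eval_yz c b w (p ^ n) = eval_yz c b w p ^ n"
  by (induction n) (simp_all add: eval_yz_one eval_yz_mult)

lemma eval_xyz_pCons: "eval_xyz c a b w (pCons p q) = eval_yz c b w p + a * eval_xyz c a b w q"
  by (simp add: eval_xyz_def map_poly_pCons)

lemma eval_xyz_zero [simp]: "eval_xyz c a b w 0 = 0"
  by (simp add: eval_xyz_def)

lemma eval_xyz_const: "eval_xyz c a b w [:q:] = eval_yz c b w q"
  by (simp add: eval_xyz_pCons)

lemma eval_xyz_x: "eval_xyz c a b w [:0, 1:] = a"
  by (simp add: eval_xyz_pCons eval_yz_one)

lemma eval_xyz_one: "eval_xyz c a b w 1 = 1"
  by (simp add: one_pCons eval_xyz_const eval_yz_const eval_y_one)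

lemma eval_xyz_add: "eval_xyz c a b w (F + G) = eval_xyz c a b w F + eval_xyz c a b w G"
  by (induction F G rule: poly_induct2) (simp_all add: eval_xyz_pCons eval_yz_add algebra_simps)

lemma eval_xyz_smult: "eval_xyz c a b w (smult p F) = eval_yz c b w p * eval_xyz c a b w F"
  by (induction F) (simp_all add: eval_xyz_pCons eval_yz_mult algebra_simps)

lemma eval_xyz_mult: "eval_xyz c a b w (F * G) = eval_xyz c a b w F * eval_xyz c a b w G"
  by (induction F) (simp_all add: eval_xyz_pCons eval_xyz_add eval_xyz_smult algebra_simps)

lemma eval_xyz_pow: "eval_xyz c a b w (F ^ n) = eval_xyz c a b w F ^ n"
  by (induction n) (simp_all add: eval_xyz_one eval_xyz_mult)

lemma eval_xyz_diff: "eval_xyz c a b w (F - G) = eval_xyz c a b w F - eval_xyz c a b w G"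
  using eval_xyz_add[of a b w "F - G" G] by simp

end

lemma yzpoly_const_prod: "[:p:] * [:q:] = [:p * q:]" for p q :: "'a :: comm_semiring_0"
  by (simp add: mult.commute)

lemma const_poly_sum: "[:\<Sum>i\<in>I. f i:] = (\<Sum>i\<in>I. [:f i:])"
proof (induction I rule: infinite_finite_induct)
  case (insert i I)
  have "[:f i + sum f I:] = [:f i:] + [:sum f I:]" by simp
  then show ?case using insert by (simp del: add_pCons)
qed simp_all

lemma xyzpoly_hom_eqI:
  fixes f h :: "('n :: finite, 'k :: comm_ring_1) xyzpoly \<Rightarrow> 'r :: comm_ring_1"
  assumes add: "\<And>p q. f (p + q) = f p + f q" "\<And>p q. h (p + q) = h p + h q"
    and mult: "\<And>p q. f (p * q) = f p * f q" "\<And>p q. h (p * q) = h p * h q"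
    and const: "\<And>a. f [:[:yconst a:]:] = h [:[:yconst a:]:]"
    and y: "\<And>i. f [:[:yvar i:]:] = h [:[:yvar i:]:]"
    and z: "f [:[:0, 1:]:] = h [:[:0, 1:]:]"
    and x: "f [:0, 1:] = h [:0, 1:]"
  shows "f F = h F"
proof -
  have yz: "f [:p:] = h [:p:]" for p
  proof (rule yzpoly_hom_eqI[of "\<lambda>p. f [:p:]" "\<lambda>p. h [:p:]"])
    show "f [:p + q:] = f [:p:] + f [:q:]" "h [:p + q:] = h [:p:] + h [:q:]" for p q
      using add(1)[of "[:p:]" "[:q:]"] add(2)[of "[:p:]" "[:q:]"] by simp_all
    show "f [:p * q:] = f [:p:] * f [:q:]" "h [:p * q:] = h [:p:] * h [:q:]" for p q
      using mult(1)[of "[:p:]" "[:q:]"] mult(2)[of "[:p:]" "[:q:]"]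
      unfolding yzpoly_const_prod .
  qed (use const y z in auto)
  show ?thesis
  proof (induction F)
    case 0
    show ?case using yz[of 0] by simp
  next
    case (pCons p F)
    have "pCons p F = [:p:] + [:0, 1:] * F" by simp
    then show ?case using pCons yz[of p] x
      by (simp add: add mult del: add_pCons mult_pCons_left mult_pCons_right)
  qed
qed

global_interpretation const_xyz: structure_map "\<lambda>a :: 'k :: comm_ring_1. [:[:yconst a:]:]"
  by standard (simp_all add: yconst_add yconst_mult yconst_one one_pCons)

global_interpretation point: structure_map "id :: 'k :: comm_ring_1 \<Rightarrow> 'k"
  by standard simp_all

context structure_map
begin

lemma eval_xyz_compose:
  "eval_xyz c a b w (eval_xyz (\<lambda>a. [:[:yconst a:]:]) A B C F) =
     eval_xyz c (eval_xyz c a b w A) (\<lambda>i. eval_xyz c a b w (B i)) (eval_xyz c a b w C) F"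
  by (rule xyzpoly_hom_eqI)
     (simp_all add: eval_xyz_add eval_xyz_mult const_xyz.eval_xyz_add const_xyz.eval_xyz_mult
        const_xyz.eval_xyz_const const_xyz.eval_yz_const const_xyz.eval_y_yconst
        const_xyz.eval_y_yvar const_xyz.eval_yz_z const_xyz.eval_xyz_x
        eval_xyz_const eval_yz_const eval_y_yconst eval_y_yvar eval_yz_z eval_xyz_x)

lemma eval_yz_compose:
  "eval_yz c b w (eval_yz (\<lambda>a. [:yconst a:]) B C p) =
     eval_yz c (\<lambda>i. eval_yz c b w (B i)) (eval_yz c b w C) p"
  by (rule yzpoly_hom_eqI)
     (simp_all add: eval_yz_add eval_yz_mult const_yz.eval_yz_add const_yz.eval_yz_mult
        const_yz.eval_yz_const const_yz.eval_y_yconst const_yz.eval_y_yvar const_yz.eval_yz_z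
        eval_yz_const eval_y_yconst eval_y_yvar eval_yz_z)

end

definition danielewski_eq ::
  "('n :: finite \<Rightarrow> nat) \<Rightarrow> ('n, 'k :: comm_ring_1) yzpoly \<Rightarrow> ('n, 'k) xyzpoly" where
  "danielewski_eq k P = [:- P, [:ymonomial k:]:]"

lemma danielewski_eq_alt: "danielewski_eq k P = [:[:ymonomial k:]:] * [:0, 1:] - [:P:]"
  by (simp add: danielewski_eq_def)

lemma (in structure_map) eval_danielewski_eq:
  "eval_xyz c a b w (danielewski_eq k P) = a * (\<Prod>i\<in>UNIV. b i ^ k i) - eval_yz c b w P"
  by (simp add: danielewski_eq_def eval_xyz_pCons eval_yz_uminus eval_yz_const eval_y_ymonomial)

text \<open>The number \<open>n\<close> is the degree in \<open>z\<close> that \<open>x\<^bsup>n div d\<^esup> z\<^bsup>n mod d\<^esup>\<close> acquires on the variety, where \<open>x\<close> becomes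
  \<open>P\<close> divided by a monomial in the \<open>y\<^sub>i\<close>.\<close>

definition basis_monom :: "nat \<Rightarrow> nat \<Rightarrow> ('n, 'k :: comm_ring_1) xyzpoly" where
  "basis_monom d n = [:0, 1:] ^ (n div d) * [:[:0, 1:]:] ^ (n mod d)"

text \<open>One polynomial in \<open>y\<close> and \<open>z\<close> serves as the list of coefficients, in \<open>\<bbbK>[y]\<close>, with respect to the
  basis of the coordinate ring formed by the \<^const>\<open>basis_monom\<close>.\<close>

definition normal_form :: "nat \<Rightarrow> ('n, 'k :: comm_ring_1) yzpoly \<Rightarrow> ('n, 'k) xyzpoly" where
  "normal_form d q = (\<Sum>n\<le>degree q. [:[:coeff q n:]:] * basis_monom d n)"

lemma normal_form_bound:
  assumes "degree q \<le> N"
  shows "normal_form d q = (\<Sum>n\<le>N. [:[:coeff q n:]:] * basis_monom d n)"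
  unfolding normal_form_def using assms
  by (intro sum.mono_neutral_left) (auto simp: coeff_eq_0)

lemma normal_form_0: "normal_form d 0 = 0"
  by (simp add: normal_form_def)

lemma normal_form_add: "normal_form d (p + q) = normal_form d p + normal_form d q"
proof -
  let ?N = "max (degree p) (degree q)"
  have "[:[:coeff p n + coeff q n:]:] = [:[:coeff p n:]:] + [:[:coeff q n:]:]" for n by simp
  then show ?thesis
    using degree_add_le_max[of p q]
    by (subst (1 2 3) normal_form_bound[of _ ?N]) (simp_all only: max.cobounded1 max.cobounded2
          coeff_add distrib_right sum.distrib)
qed

lemma normal_form_monom: "normal_form d (Polynomial.monom b n) = [:[:b:]:] * basis_monom d n"
proof -
  have "[:[:coeff (Polynomial.monom b n) i:]:] * basis_monom d i =
      (if i = n then [:[:b:]:] * basis_monom d n else 0)" for i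
    by auto
  then show ?thesis
    by (subst normal_form_bound[of _ n]) (simp_all add: degree_monom_le)
qed

locale danielewski_data =
  fixes k :: "'n :: {finite, linorder} \<Rightarrow> nat" and d :: nat and P :: "('n, 'k :: field_char_0) yzpoly"
  assumes d: "d \<ge> 2" and k: "\<And>i. k i \<ge> 2"
    and deg_P: "degree P = d" and lead_P: "coeff P d = 1" and sub_P: "coeff P (d - 1) = 0"
begin

abbreviation "E \<equiv> danielewski_eq k P"

lemma P_nz: "P \<noteq> 0" using deg_P d by auto

lemma degree_P_monom: "degree (P ^ j * [:0, 1:] ^ c) = d * j + c"
  and lead_P_monom: "lead_coeff (P ^ j * [:0, 1:] ^ c) = 1"
proof -
  show "degree (P ^ j * [:0, 1:] ^ c) = d * j + c"
    using P_nz deg_P by (simp add: degree_mult_eq degree_power_eq)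
  show "lead_coeff (P ^ j * [:0, 1:] ^ c) = 1"
    unfolding lead_coeff_mult lead_coeff_power using lead_P deg_P by simp
qed

lemma P_expand: "[:P:] = [:[:0, 1:]:] ^ d + (\<Sum>i<d. [:[:coeff P i:]:] * [:[:0, 1:]:] ^ i)"
proof -
  have "P = (\<Sum>i\<le>d. Polynomial.monom (coeff P i) i)"
    using poly_as_sum_of_monoms[of P] deg_P by simp
  also have "\<dots> = Polynomial.monom 1 d + (\<Sum>i<d. Polynomial.monom (coeff P i) i)"
    using lead_P by (simp flip: lessThan_Suc_atMost add: add.commute)
  also have "\<dots> = [:0, 1:] ^ d + (\<Sum>i<d. [:coeff P i:] * [:0, 1:] ^ i)"
    by (simp add: monom_altdef)
  finally have "[:P:] = [:[:0, 1:] ^ d + (\<Sum>i<d. [:coeff P i:] * [:0, 1:] ^ i):]" by simp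
  also have "\<dots> = [:[:0, 1:] ^ d:] + [:\<Sum>i<d. [:coeff P i:] * [:0, 1:] ^ i:]" by simp
  finally show ?thesis
    unfolding const_poly_sum by (simp only: poly_const_pow flip: yzpoly_const_prod)
qed

text \<open>The set of polynomials with a normal form is closed under multiplication by the variables. Only
  \<open>z\<close> is interesting: when \<open>z\<^sup>d\<close> appears it is replaced by \<open>x y\<^bsup>k\<^esup>\<close> minus the lower terms of \<open>P\<close>.\<close>

lemma normal_form_exists: "\<exists>q. E dvd F - normal_form d q"
proof -
  define S where "S = {F. \<exists>q. E dvd F - normal_form d q}"
  have add: "F + G \<in> S" if FG: "F \<in> S" "G \<in> S" for F G
  proof -
    obtain p q where "E dvd F - normal_form d p" "E dvd G - normal_form d q"
      using FG unfolding S_def by blast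
    then have "E dvd (F - normal_form d p) + (G - normal_form d q)" by (rule dvd_add)
    then have "E dvd F + G - normal_form d (p + q)" by (simp add: normal_form_add algebra_simps)
    then show ?thesis unfolding S_def by blast
  qed
  have zero: "0 \<in> S" unfolding S_def by (auto intro!: exI[of _ 0] simp: normal_form_0)
  have sum: "(\<Sum>i\<in>I. f i) \<in> S" if "\<And>i. i \<in> I \<Longrightarrow> f i \<in> S" for f and I :: "nat set"
    using that by (induction I rule: infinite_finite_induct) (auto simp: zero add)
  have basis: "[:[:b:]:] * basis_monom d n \<in> S" for b n
    unfolding S_def by (auto intro!: exI[of _ "Polynomial.monom b n"] simp: normal_form_monom)
  have cong: "F \<in> S" if G: "G \<in> S" "E dvd F - G" for F G
  proof -
    obtain q where "E dvd G - normal_form d q" using G(1) unfolding S_def by blast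
    with G(2) have "E dvd (F - G) + (G - normal_form d q)" by (rule dvd_add)
    then show ?thesis unfolding S_def by auto
  qed
  have mult: "m * F \<in> S" if F: "F \<in> S" and m: "\<And>b n. m * ([:[:b:]:] * basis_monom d n) \<in> S" for m F
  proof -
    obtain q where "E dvd F - normal_form d q" using F unfolding S_def by blast
    then have "E dvd m * F - m * normal_form d q"
      unfolding right_diff_distrib[symmetric] by (rule dvd_mult)
    moreover have "m * normal_form d q \<in> S"
      unfolding normal_form_def sum_distrib_left by (intro sum m)
    ultimately show ?thesis by (rule cong[rotated])
  qed
  define X Z :: "('n, 'k) xyzpoly" where "X = [:0, 1:]" and "Z = [:[:0, 1:]:]"
  define C :: "('n, 'k) ypoly \<Rightarrow> ('n, 'k) xyzpoly" where "C b = [:[:b:]:]" for b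
  note basis = basis[folded C_def] and mult = mult[folded C_def]
  have basis_monom: "basis_monom d n = X ^ (n div d) * Z ^ (n mod d)" for n
    unfolding basis_monom_def X_def Z_def ..
  have C_1: "C 1 = 1" and C_mult: "C b * C b' = C (b * b')" and C_minus: "C (- b) = - C b" for b b'
    unfolding C_def by (simp_all add: one_pCons mult.commute)
  have E_eq: "E = C (ymonomial k) * X - (Z ^ d + (\<Sum>i<d. C (coeff P i) * Z ^ i))"
    unfolding danielewski_eq_alt P_expand C_def X_def Z_def ..
  have mult_y: "C b * F \<in> S" if "F \<in> S" for b F
  proof (rule mult[OF that])
    show "C b * (C b' * basis_monom d n) \<in> S" for b' n
      unfolding mult.assoc[symmetric] C_mult by (rule basis)
  qed
  have mult_x: "X * F \<in> S" if "F \<in> S" for F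
  proof (rule mult[OF that])
    show "X * (C b * basis_monom d n) \<in> S" for b n
    proof -
      have "X * basis_monom d n = basis_monom d (n + d)"
        using d by (simp add: basis_monom mult.assoc)
      then have "X * (C b * basis_monom d n) = C b * basis_monom d (n + d)"
        by (subst mult.left_commute) simp
      then show ?thesis using basis[of b "n + d"] by (simp only:)
    qed
  qed
  have mult_z: "Z * F \<in> S" if "F \<in> S" for F
  proof (rule mult[OF that])
    fix b n
    let ?j = "n div d"
    have "Z * basis_monom d n \<in> S"
    proof (cases "Suc n mod d = 0")
      case False
      then have "Z * basis_monom d n = basis_monom d (Suc n)"
        by (simp add: basis_monom div_Suc mod_Suc mult.left_commute split: if_splits)
      then show ?thesis using basis[of 1 "Suc n"] by (simp add: C_1)
    next
      case True
      then have md: "Suc (n mod d) = d" and dv: "Suc n div d = Suc ?j"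
        by (auto simp: mod_Suc div_Suc split: if_splits)
      have "Z * basis_monom d n = X ^ ?j * Z ^ Suc (n mod d)"
        by (simp add: basis_monom mult.left_commute)
      then have 1: "Z * basis_monom d n = X ^ ?j * Z ^ d" unfolding md .
      let ?G = "C (ymonomial k) * basis_monom d (Suc n) +
        (\<Sum>i<d. C (- coeff P i) * basis_monom d (d * ?j + i))"
      have "basis_monom d (d * ?j + i) = X ^ ?j * Z ^ i" if "i < d" for i
        using that by (simp add: basis_monom)
      then have "(\<Sum>i<d. C (- coeff P i) * basis_monom d (d * ?j + i)) =
          (\<Sum>i<d. - (X ^ ?j * (C (coeff P i) * Z ^ i)))"
        by (intro sum.cong) (simp_all add: C_minus mult.left_commute)
      then have 2: "(\<Sum>i<d. C (- coeff P i) * basis_monom d (d * ?j + i)) =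
          - (X ^ ?j * (\<Sum>i<d. C (coeff P i) * Z ^ i))"
        by (simp add: sum_negf sum_distrib_left)
      have 3: "basis_monom d (Suc n) = X ^ ?j * X"
        unfolding basis_monom dv True by simp
      have "Z * basis_monom d n - ?G = - (X ^ ?j) * E"
        unfolding 1 2 3 E_eq by (simp add: algebra_simps)
      then have "E dvd Z * basis_monom d n - ?G" by simp
      moreover have "?G \<in> S" by (intro add sum basis)
      ultimately show ?thesis by (rule cong[rotated])
    qed
    then show "Z * (C b * basis_monom d n) \<in> S"
      by (subst mult.left_commute) (rule mult_y)
  qed
  have one: "1 \<in> S" using basis[of 1 0] by (simp add: basis_monom C_1)
  have yz: "[:q:] \<in> S" for q
  proof (induction q)
    case (pCons b q)
    have "[:pCons b q:] = C b * 1 + Z * [:q:]" by (simp add: C_def Z_def)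
    then show ?case using add[OF mult_y[OF one, of b] mult_z[OF pCons.IH]] by (simp only:)
  qed (use zero in simp)
  have "F \<in> S"
  proof (induction F)
    case (pCons p F)
    have "pCons p F = [:p:] + X * F" by (simp add: X_def)
    then show ?case using add[OF yz[of p] mult_x[OF pCons.IH]] by (simp only:)
  qed (rule zero)
  then show ?thesis by (simp add: S_def)
qed

text \<open>Multiplying by a power of \<open>y\<^bsup>k\<^esup>\<close> turns each \<open>x\<close> into \<open>P\<close>. As \<open>P\<close> is monic of degree \<open>d\<close>, the basis element of
  index \<open>n\<close> becomes a polynomial of degree \<open>n\<close> in \<open>z\<close>, so nothing cancels at the top.\<close>

lemma normal_form_clear:
  assumes "q \<noteq> 0"
  obtains M p where "degree p = degree q" "p \<noteq> 0" "E dvd [:[:ymonomial k:]:] ^ M * normal_form d q - [:p:]"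
proof -
  let ?N = "degree q" and ?Y = "[:ymonomial k:] :: ('n, 'k) yzpoly"
  define M where "M = ?N div d"
  define t where "t n = [:coeff q n:] * ?Y ^ (M - n div d) * (P ^ (n div d) * [:0, 1:] ^ (n mod d))" for n
  define p where "p = (\<Sum>n\<le>?N. t n)"
  have deg_t: "degree (t n) \<le> n" for n
  proof -
    have "degree (t n) \<le> degree ([:coeff q n:] * ?Y ^ (M - n div d)) + n"
      unfolding t_def by (rule order.trans[OF degree_mult_le]) (simp add: degree_P_monom)
    also have "[:coeff q n:] * ?Y ^ (M - n div d) = [:coeff q n * ymonomial k ^ (M - n div d):]"
      by (simp only: poly_const_pow yzpoly_const_prod)
    finally show ?thesis by simp
  qed
  have "coeff p ?N = (\<Sum>n\<le>?N. coeff (t n) ?N)" by (simp add: p_def coeff_sum)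
  also have "\<dots> = coeff (t ?N) ?N"
  proof -
    have "coeff (t n) ?N = 0" if "n \<in> {..?N} - {?N}" for n
      using deg_t[of n] that by (intro coeff_eq_0) auto
    then show ?thesis by (subst sum.remove[of _ ?N]) auto
  qed
  also have "\<dots> = lead_coeff q * lead_coeff (P ^ (?N div d) * [:0, 1:] ^ (?N mod d))"
    by (simp add: t_def M_def degree_P_monom)
  also have "\<dots> = lead_coeff q" by (simp add: lead_P_monom)
  finally have "coeff p ?N \<noteq> 0" using \<open>q \<noteq> 0\<close> by simp
  moreover have "degree p \<le> ?N"
    unfolding p_def using deg_t by (intro degree_sum_le) (auto intro: order.trans)
  ultimately have deg_p: "degree p = ?N" and "p \<noteq> 0" by (auto intro: antisym le_degree)
  have "E dvd [:[:ymonomial k:]:] ^ M * ([:[:coeff q n:]:] * basis_monom d n) - [:t n:]" if "n \<le> ?N" for n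
  proof -
    let ?j = "n div d"
    have M: "M = (M - ?j) + ?j" using that by (simp add: M_def div_le_mono)
    have "[:[:ymonomial k:]:] ^ M * ([:[:coeff q n:]:] * basis_monom d n) =
        [:[:coeff q n:] * ?Y ^ (M - ?j) * [:0, 1:] ^ (n mod d):] * ([:?Y:] * [:0, 1:]) ^ ?j"
      unfolding basis_monom_def power_mult_distrib
      by (subst M) (simp only: power_add poly_const_pow flip: yzpoly_const_prod, simp only: ac_simps)
    moreover have "[:t n:] = [:[:coeff q n:] * ?Y ^ (M - ?j) * [:0, 1:] ^ (n mod d):] * [:P:] ^ ?j"
      unfolding t_def by (simp only: poly_const_pow flip: yzpoly_const_prod) (simp only: ac_simps)
    ultimately have "[:[:ymonomial k:]:] ^ M * ([:[:coeff q n:]:] * basis_monom d n) - [:t n:] =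
        [:[:coeff q n:] * ?Y ^ (M - ?j) * [:0, 1:] ^ (n mod d):] * (([:?Y:] * [:0, 1:]) ^ ?j - [:P:] ^ ?j)"
      by (simp only: right_diff_distrib)
    moreover have "E dvd ([:?Y:] * [:0, 1:]) ^ ?j - [:P:] ^ ?j"
      unfolding danielewski_eq_alt by (simp only: power_diff_sumr2 dvd_triv_left)
    ultimately show ?thesis by (simp only: dvd_mult)
  qed
  then have "E dvd (\<Sum>n\<le>?N. [:[:ymonomial k:]:] ^ M * ([:[:coeff q n:]:] * basis_monom d n) - [:t n:])"
    by (intro dvd_sum) auto
  also have "(\<Sum>n\<le>?N. [:[:ymonomial k:]:] ^ M * ([:[:coeff q n:]:] * basis_monom d n) - [:t n:]) =
      [:[:ymonomial k:]:] ^ M * normal_form d q - [:p:]"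
    unfolding normal_form_def p_def sum_subtractf sum_distrib_left const_poly_sum ..
  finally show thesis using that deg_p \<open>p \<noteq> 0\<close> by blast
qed

text \<open>Hence a polynomial outside the ideal of the variety stays nonzero under every evaluation that satisfies
  the equation and is injective on \<open>\<bbbK>[y, z]\<close>. Evaluation in Laurent polynomials is of this kind, and so is
  evaluation at the points whose coordinates \<open>y\<^sub>i\<close> are nonzero.\<close>

lemma clear_denominator:
  assumes "\<not> E dvd F"
  obtains M p where "p \<noteq> 0" "E dvd [:[:ymonomial k:]:] ^ M * F - [:p:]"
proof -
  obtain q where q: "E dvd F - normal_form d q" using normal_form_exists by blast
  have "q \<noteq> 0" using q assms by (auto simp: normal_form_0)
  then obtain M p where p: "p \<noteq> 0" "E dvd [:[:ymonomial k:]:] ^ M * normal_form d q - [:p:]"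
    by (rule normal_form_clear)
  have "E dvd [:[:ymonomial k:]:] ^ M * (F - normal_form d q) +
      ([:[:ymonomial k:]:] ^ M * normal_form d q - [:p:])"
    by (intro dvd_add dvd_mult q p)
  then have "E dvd [:[:ymonomial k:]:] ^ M * F - [:p:]"
    unfolding right_diff_distrib diff_add_cancel add_diff_eq .
  then show thesis using that p by blast
qed

end

section \<open>The coordinate ring inside a Laurent polynomial ring\<close>

context structure_map
begin

lemma eval_yz_sum: "eval_yz c b w (\<Sum>i\<in>I. f i) = (\<Sum>i\<in>I. eval_yz c b w (f i))"
  by (induction I rule: infinite_finite_induct) (simp_all add: eval_yz_add)

lemma eval_xyz_sum: "eval_xyz c a b w (\<Sum>i\<in>I. f i) = (\<Sum>i\<in>I. eval_xyz c a b w (f i))"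
  by (induction I rule: infinite_finite_induct) (simp_all add: eval_xyz_add)

lemma eval_yz_monom: "eval_yz c b w (Polynomial.monom q n) = eval_y c b q * w ^ n"
  by (simp add: monom_altdef eval_yz_smult eval_yz_pow eval_yz_z)

lemma eval_yz_coeffs:
  assumes "degree p \<le> N"
  shows "eval_yz c b w p = (\<Sum>n\<le>N. eval_y c b (coeff p n) * w ^ n)"
  by (subst poly_as_sum_of_monoms'[OF assms, symmetric]) (simp add: eval_yz_sum eval_yz_monom)

end

global_interpretation laurent: structure_map "Poly_Mapping.single (0 :: 'n option \<Rightarrow>\<^sub>0 int) :: 'k \<Rightarrow> ('n, 'k :: comm_ring_1) laurent"
  by standard (simp_all add: single_add mult_single)

lemma less_exponent: "Poly_Mapping.lookup a None < Poly_Mapping.lookup b None \<Longrightarrow> a < b"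
  for a b :: "'n :: linorder option \<Rightarrow>\<^sub>0 int"
proof (transfer, unfold less_fun_def, intro exI[of _ None] conjI allI impI)
  fix x :: "'n option"
  assume "x < None"
  then show "a x = b x" for a b :: "'n option \<Rightarrow> int" by (cases x) auto
qed

definition zdeg :: "('n :: linorder, 'k :: zero) laurent \<Rightarrow> int" where
  "zdeg f = Poly_Mapping.lookup (lexp f) None"

lemma zdeg_mult: "f \<noteq> 0 \<Longrightarrow> g \<noteq> 0 \<Longrightarrow> zdeg (f * g) = zdeg f + zdeg g"
  for f g :: "('n :: linorder, 'k :: idom) laurent"
  by (simp add: zdeg_def lexp_mult lookup_add)

lemma lexp_one: "lexp (1 :: ('n :: linorder, 'k :: idom) laurent) = 0"
  using lexp_single[of "1 :: 'k" 0] by simp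

lemma lexp_power: "f \<noteq> 0 \<Longrightarrow> lexp (f ^ n) = frag_cmul (int n) (lexp f)"
  for f :: "('n :: linorder, 'k :: idom) laurent"
  by (induction n) (simp_all add: lexp_one lexp_mult frag_cmul_distrib)

lemma zdeg_power: "f \<noteq> 0 \<Longrightarrow> zdeg (f ^ n) = int n * zdeg f"
  for f :: "('n :: linorder, 'k :: idom) laurent"
  by (simp add: zdeg_def lexp_power)

text \<open>The exponent of \<open>z\<close> decides the order, so a summand of strictly largest degree in \<open>z\<close> contains
  the leading term.\<close>

lemma lexp_sum_dominant:
  fixes t :: "nat \<Rightarrow> ('n :: linorder, 'k :: idom) laurent"
  assumes N: "t N \<noteq> 0" and less: "\<And>n. n < N \<Longrightarrow> t n \<noteq> 0 \<Longrightarrow> zdeg (t n) < zdeg (t N)"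
  shows "(\<Sum>n\<le>N. t n) \<noteq> 0" and "lexp (\<Sum>n\<le>N. t n) = lexp (t N)"
proof -
  have lt: "e < lexp (t N)" if "n < N" "e \<in> Poly_Mapping.keys (t n)" for n e
  proof -
    have "t n \<noteq> 0" using that by auto
    then have "lexp (t n) < lexp (t N)" using less[OF \<open>n < N\<close>] by (simp add: zdeg_def less_exponent)
    then show ?thesis using le_lexp[OF that(2)] by (rule le_less_trans[rotated])
  qed
  have "Poly_Mapping.lookup (t n) (lexp (t N)) = 0" if "n < N" for n
    using lt[OF that, of "lexp (t N)"] by (auto simp: in_keys_iff)
  then have "Poly_Mapping.lookup (\<Sum>n\<le>N. t n) (lexp (t N)) = Poly_Mapping.lookup (t N) (lexp (t N))"
    by (simp add: lookup_sum lookup_add flip: lessThan_Suc_atMost)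
  then have nz: "Poly_Mapping.lookup (\<Sum>n\<le>N. t n) (lexp (t N)) \<noteq> 0"
    using lookup_lexp_nonzero[OF N] by simp
  then show "(\<Sum>n\<le>N. t n) \<noteq> 0" by auto
  show "lexp (\<Sum>n\<le>N. t n) = lexp (t N)"
  proof (rule lexp_eqI[OF nz])
    fix e assume "e \<in> Poly_Mapping.keys (\<Sum>n\<le>N. t n)"
    then have "e \<in> (\<Union>n\<in>{..N}. Poly_Mapping.keys (t n))" by (rule subsetD[OF keys_sum])
    then obtain n where "n \<le> N" "e \<in> Poly_Mapping.keys (t n)" by auto
    then show "e \<le> lexp (t N)" using lt[of n e] le_lexp[of e "t N"] by (cases "n = N") auto
  qed
qed

lemma single_eq_0_iff [simp]: "Poly_Mapping.single a c = 0 \<longleftrightarrow> c = 0"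
  by (metis lookup_single_eq lookup_zero single_zero)

abbreviation lmon :: "'n option \<Rightarrow> ('n, 'k :: comm_ring_1) laurent" where
  "lmon \<kappa> \<equiv> Poly_Mapping.single (Poly_Mapping.single \<kappa> 1) 1"

abbreviation lau_y :: "('n :: finite, 'k :: comm_ring_1) ypoly \<Rightarrow> ('n, 'k) laurent" where
  "lau_y \<equiv> eval_y (Poly_Mapping.single 0) (\<lambda>i. lmon (Some i))"

abbreviation lau_yz :: "('n :: finite, 'k :: comm_ring_1) yzpoly \<Rightarrow> ('n, 'k) laurent" where
  "lau_yz \<equiv> eval_yz (Poly_Mapping.single 0) (\<lambda>i. lmon (Some i)) (lmon None)"

definition yexp :: "('n :: finite \<Rightarrow> nat) \<Rightarrow> ('n option \<Rightarrow>\<^sub>0 int)" where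
  "yexp e = (\<Sum>i\<in>UNIV. Poly_Mapping.single (Some i) (int (e i)))"

lemma lookup_yexp [simp]:
  "Poly_Mapping.lookup (yexp e) None = 0" "Poly_Mapping.lookup (yexp e) (Some i) = int (e i)"
  by (simp_all add: yexp_def lookup_sum lookup_single when_def)

lemma lmon_power: "lmon \<kappa> ^ n = (Poly_Mapping.single (Poly_Mapping.single \<kappa> (int n)) 1 :: ('n, 'k :: comm_ring_1) laurent)"
  by (induction n) (simp_all add: mult_single single_add[symmetric])

lemma prod_lmon: "(\<Prod>i\<in>UNIV. lmon (Some i) ^ e i) = (Poly_Mapping.single (yexp e) 1 :: ('n :: finite, 'k :: comm_ring_1) laurent)"
proof -
  have "(\<Prod>i\<in>S. lmon (Some i) ^ e i) =
      (Poly_Mapping.single (\<Sum>i\<in>S. Poly_Mapping.single (Some i) (int (e i))) 1 :: ('n, 'k) laurent)"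
    if "finite S" for S
    using that by (induction S) (simp_all add: lmon_power mult_single)
  then show ?thesis by (simp add: yexp_def)
qed

lemma lau_y_single: "lau_y (Poly_Mapping.single e a) = Poly_Mapping.single (yexp (Poly_Mapping.lookup e)) a"
  by (simp add: laurent.eval_y_single prod_lmon mult_single)

lemma yexp_inject: "yexp (Poly_Mapping.lookup e) = yexp (Poly_Mapping.lookup e') \<longleftrightarrow> e = e'"
proof
  assume "yexp (Poly_Mapping.lookup e) = yexp (Poly_Mapping.lookup e')"
  then have "int (Poly_Mapping.lookup e i) = int (Poly_Mapping.lookup e' i)" for i
    by (metis lookup_yexp(2))
  then show "e = e'" by (intro poly_mapping_eqI) simp
qed simp

lemma lookup_lau_y: "Poly_Mapping.lookup (lau_y q) (yexp (Poly_Mapping.lookup e)) = Poly_Mapping.lookup q e"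
  by (induction q rule: const_yz.ypoly_induct)
     (simp_all add: lau_y_single lookup_single when_def yexp_inject laurent.eval_y_add lookup_add)

lemma keys_lau_y:
  assumes "g \<in> Poly_Mapping.keys (lau_y q)"
  obtains e where "g = yexp (Poly_Mapping.lookup e)"
proof -
  have "Poly_Mapping.keys (lau_y q) \<subseteq> range (\<lambda>e. yexp (Poly_Mapping.lookup e))"
  proof (induction q rule: const_yz.ypoly_induct)
    case (add p q)
    then show ?case
      using Poly_Mapping.keys_add[of "lau_y p" "lau_y q"] by (auto simp: laurent.eval_y_add)
  qed (auto simp: lau_y_single split: if_splits)
  then show thesis using assms that by auto
qed

lemma lau_y_eq_0_iff [simp]: "lau_y q = 0 \<longleftrightarrow> q = 0"
proof
  assume "lau_y q = 0"
  then have "Poly_Mapping.lookup q e = 0" for e using lookup_lau_y[of q e] by simp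
  then show "q = 0" by (intro poly_mapping_eqI) simp
qed simp

lemma lexp_lau_y:
  fixes q :: "('n :: {finite, linorder}, 'k :: comm_ring_1) ypoly"
  assumes "q \<noteq> 0"
  obtains e where "lexp (lau_y q) = yexp e"
  using lexp_in_keys[of "lau_y q"] assms by (auto elim: keys_lau_y)

lemma zdeg_lau_y: "q \<noteq> 0 \<Longrightarrow> zdeg (lau_y q) = 0"
  for q :: "('n :: {finite, linorder}, 'k :: comm_ring_1) ypoly"
  by (erule lexp_lau_y) (simp add: zdeg_def)

lemma zdeg_lmon_None: "zdeg (lmon None :: ('n :: linorder, 'k :: comm_ring_1) laurent) = 1"
  by (simp add: zdeg_def)

text \<open>The map \<open>h\<close> is the inclusion of \<open>\<bbbK>[y]\<close> or its composition with an automorphism, and \<open>w\<close> is the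
  corresponding image of \<open>z\<close>; distinct powers of \<open>w\<close> have distinct degrees, so there is no cancellation.\<close>

lemma zdeg_poly_expression:
  fixes h :: "('n, 'k) ypoly \<Rightarrow> ('n :: {finite, linorder}, 'k :: field) laurent"
  assumes h: "\<And>q. q \<noteq> 0 \<Longrightarrow> h q \<noteq> 0 \<and> zdeg (h q) = 0" and h0: "h 0 = 0"
    and w: "w \<noteq> 0" "zdeg w > 0" and "p \<noteq> 0"
  shows "(\<Sum>n\<le>degree p. h (coeff p n) * w ^ n) \<noteq> 0"
    and "lexp (\<Sum>n\<le>degree p. h (coeff p n) * w ^ n) = lexp (h (lead_coeff p) * w ^ degree p)"
    and "zdeg (\<Sum>n\<le>degree p. h (coeff p n) * w ^ n) = int (degree p) * zdeg w"
proof -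
  have t: "h (coeff p n) * w ^ n \<noteq> 0 \<longleftrightarrow> coeff p n \<noteq> 0" for n
    using h h0 w by (cases "coeff p n = 0") auto
  have z: "zdeg (h (coeff p n) * w ^ n) = int n * zdeg w" if "coeff p n \<noteq> 0" for n
    using h[OF that] w by (simp add: zdeg_mult zdeg_power)
  have lead: "lead_coeff p \<noteq> 0" using \<open>p \<noteq> 0\<close> by simp
  have *: "h (lead_coeff p) * w ^ degree p \<noteq> 0"
    "zdeg (h (coeff p n) * w ^ n) < zdeg (h (lead_coeff p) * w ^ degree p)"
    if "n < degree p" "h (coeff p n) * w ^ n \<noteq> 0" for n
    using that t[of "degree p"] t[of n] lead w by (simp_all add: z)
  have 1: "h (lead_coeff p) * w ^ degree p \<noteq> 0" using t[of "degree p"] lead by simp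
  show "(\<Sum>n\<le>degree p. h (coeff p n) * w ^ n) \<noteq> 0"
    by (rule lexp_sum_dominant[of "\<lambda>n. h (coeff p n) * w ^ n"]) (use 1 * in auto)
  show 2: "lexp (\<Sum>n\<le>degree p. h (coeff p n) * w ^ n) = lexp (h (lead_coeff p) * w ^ degree p)"
    by (rule lexp_sum_dominant[of "\<lambda>n. h (coeff p n) * w ^ n"]) (use 1 * in auto)
  show "zdeg (\<Sum>n\<le>degree p. h (coeff p n) * w ^ n) = int (degree p) * zdeg w"
    using z[of "degree p"] lead by (simp add: zdeg_def 2)
qed

lemma lau_yz_nz: "lau_yz p \<noteq> 0" and zdeg_lau_yz: "zdeg (lau_yz p) = int (degree p)"
  and lexp_lau_yz: "lexp (lau_yz p) = lexp (lau_y (lead_coeff p)) + Poly_Mapping.single None (int (degree p))"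
  if "p \<noteq> 0" for p :: "('n :: {finite, linorder}, 'k :: field) yzpoly"
proof -
  have h: "q \<noteq> 0 \<Longrightarrow> lau_y q \<noteq> 0 \<and> zdeg (lau_y q) = 0" for q :: "('n, 'k) ypoly"
    by (simp add: zdeg_lau_y)
  note * = zdeg_poly_expression[of lau_y, OF h laurent.eval_y_zero _ _ that]
  have eq: "lau_yz p = (\<Sum>n\<le>degree p. lau_y (coeff p n) * lmon None ^ n)"
    by (rule laurent.eval_yz_coeffs) simp
  show "lau_yz p \<noteq> 0" "zdeg (lau_yz p) = int (degree p)"
    unfolding eq using * by (simp_all add: zdeg_lmon_None)
  have "lexp (lau_yz p) = lexp (lau_y (lead_coeff p) * lmon None ^ degree p)"
    unfolding eq using * by (simp add: zdeg_lmon_None)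
  also have "\<dots> = lexp (lau_y (lead_coeff p)) + lexp (lmon None ^ degree p :: ('n, 'k) laurent)"
    using that by (intro lexp_mult) auto
  finally show "lexp (lau_yz p) = lexp (lau_y (lead_coeff p)) + Poly_Mapping.single None (int (degree p))"
    by (simp add: lmon_power)
qed

lemma lau_yz_eq_iff: "lau_yz p = lau_yz q \<longleftrightarrow> p = q"
  for p q :: "('n :: {finite, linorder}, 'k :: field) yzpoly"
  using lau_yz_nz[of "p - q"] by (auto simp: laurent.eval_yz_diff)

context danielewski_data
begin

abbreviation ym :: "('n, 'k) laurent" where "ym \<equiv> Poly_Mapping.single (yexp k) 1"

definition lau_x :: "('n, 'k) laurent" where
  "lau_x = lau_yz P * Poly_Mapping.single (- yexp k) 1"

definition lau :: "('n, 'k) xyzpoly \<Rightarrow> ('n, 'k) laurent" where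
  "lau = eval_xyz (Poly_Mapping.single 0) lau_x (\<lambda>i. lmon (Some i)) (lmon None)"

lemma ym_nz: "ym \<noteq> 0" by simp

lemma lau_x_ym: "lau_x * ym = lau_yz P"
  by (simp add: lau_x_def mult.assoc mult_single)

lemma lau_ymonomial: "lau_y (ymonomial k) = ym"
  by (simp add: laurent.eval_y_ymonomial prod_lmon)

lemmas lau_simps =
  laurent.eval_xyz_add[of lau_x "\<lambda>i. lmon (Some i)" "lmon None", folded lau_def]
  laurent.eval_xyz_mult[of lau_x "\<lambda>i. lmon (Some i)" "lmon None", folded lau_def]
  laurent.eval_xyz_pow[of lau_x "\<lambda>i. lmon (Some i)" "lmon None", folded lau_def]
  laurent.eval_xyz_diff[of lau_x "\<lambda>i. lmon (Some i)" "lmon None", folded lau_def]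
  laurent.eval_xyz_sum[of lau_x "\<lambda>i. lmon (Some i)" "lmon None", folded lau_def]
  laurent.eval_xyz_const[of lau_x "\<lambda>i. lmon (Some i)" "lmon None", folded lau_def]
  laurent.eval_xyz_x[of lau_x "\<lambda>i. lmon (Some i)" "lmon None", folded lau_def]
  laurent.eval_xyz_one[of lau_x "\<lambda>i. lmon (Some i)" "lmon None", folded lau_def]
  laurent.eval_xyz_zero[of lau_x "\<lambda>i. lmon (Some i)" "lmon None", folded lau_def]

lemma lau_E: "lau E = 0"
  by (simp add: lau_def laurent.eval_danielewski_eq prod_lmon lau_x_ym)

lemma lau_dvd: "E dvd F - G \<Longrightarrow> lau F = lau G"
  by (auto simp: dvd_def lau_simps lau_E dest: arg_cong[of _ _ lau])

lemma lau_eq_0_iff: "lau F = 0 \<longleftrightarrow> E dvd F"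
proof
  assume F: "lau F = 0"
  show "E dvd F"
  proof (rule ccontr)
    assume "\<not> E dvd F"
    then obtain M p where p: "p \<noteq> 0" "E dvd [:[:ymonomial k:]:] ^ M * F - [:p:]"
      by (rule clear_denominator)
    have "lau ([:[:ymonomial k:]:] ^ M * F) = lau [:p:]" using p(2) by (rule lau_dvd)
    then show False using F lau_yz_nz[OF p(1)] by (simp add: lau_simps)
  qed
qed (auto simp: dvd_def lau_simps lau_E)

lemma lexp_lau_P: "lexp (lau_yz P) = Poly_Mapping.single None (int d)"
  using lexp_lau_yz[OF P_nz] by (simp add: deg_P lead_P laurent.eval_y_one lexp_one)

lemma lau_x_nz: "lau_x \<noteq> 0" and lexp_lau_x: "lexp lau_x = Poly_Mapping.single None (int d) - yexp k"
proof -
  have nz: "(Poly_Mapping.single (- yexp k) 1 :: ('n, 'k) laurent) \<noteq> 0"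
    by simp
  show "lau_x \<noteq> 0" unfolding lau_x_def using nz lau_yz_nz[OF P_nz] by simp
  show "lexp lau_x = Poly_Mapping.single None (int d) - yexp k"
    unfolding lau_x_def using nz lau_yz_nz[OF P_nz] by (simp add: lexp_mult lexp_lau_P)
qed

lemma lau_basis_monom: "lau (basis_monom d n) = lau_x ^ (n div d) * lmon None ^ (n mod d)"
  by (simp add: basis_monom_def lau_simps laurent.eval_yz_z)

lemma lau_basis_nz: "lau (basis_monom d n) \<noteq> 0"
  unfolding lau_basis_monom using lau_x_nz by simp

lemma lookup_lexp_basis:
  "Poly_Mapping.lookup (lexp (lau (basis_monom d n))) None = int n"
  "Poly_Mapping.lookup (lexp (lau (basis_monom d n))) (Some i) = - int (k i) * int (n div d)"
proof -
  have *: "lexp (lau (basis_monom d n)) =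
      frag_cmul (int (n div d)) (Poly_Mapping.single None (int d) - yexp k) +
      Poly_Mapping.single None (int (n mod d))"
    unfolding lau_basis_monom using lau_x_nz
    by (subst lexp_mult) (simp_all add: lexp_power lexp_lau_x lmon_power)
  have "int (n div d) * int d + int (n mod d) = int n"
    by (metis div_mult_mod_eq of_nat_add of_nat_mult)
  then show "Poly_Mapping.lookup (lexp (lau (basis_monom d n))) None = int n"
    by (simp add: * lookup_add lookup_minus lookup_single)
  show "Poly_Mapping.lookup (lexp (lau (basis_monom d n))) (Some i) = - int (k i) * int (n div d)"
    by (simp add: * lookup_add lookup_minus lookup_single)
qed

lemma lau_normal_form: "lau (normal_form d q) = (\<Sum>n\<le>degree q. lau_y (coeff q n) * lau (basis_monom d n))"
  by (simp add: normal_form_def lau_simps laurent.eval_yz_const del: mult_pCons_left)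

lemma lau_normal_form_nz: "lau (normal_form d q) \<noteq> 0"
  and lexp_normal_form: "lexp (lau (normal_form d q)) =
    lexp (lau_y (lead_coeff q)) + lexp (lau (basis_monom d (degree q)))"
  if "q \<noteq> 0"
proof -
  let ?t = "\<lambda>n. lau_y (coeff q n) * lau (basis_monom d n)"
  have z: "zdeg (?t n) = int n" if "coeff q n \<noteq> 0" for n
    using that lau_basis_nz by (simp add: zdeg_mult zdeg_lau_y) (simp add: zdeg_def lookup_lexp_basis)
  have 1: "?t (degree q) \<noteq> 0" using that lau_basis_nz by simp
  have 2: "zdeg (?t n) < zdeg (?t (degree q))" if "n < degree q" "?t n \<noteq> 0" for n
    using that \<open>q \<noteq> 0\<close> by (subst (1 2) z) auto
  show "lau (normal_form d q) \<noteq> 0"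
    unfolding lau_normal_form by (rule lexp_sum_dominant[of ?t]) (use 1 2 in auto)
  have "lexp (lau (normal_form d q)) = lexp (?t (degree q))"
    unfolding lau_normal_form by (rule lexp_sum_dominant[of ?t]) (use 1 2 in auto)
  then show "lexp (lau (normal_form d q)) =
      lexp (lau_y (lead_coeff q)) + lexp (lau (basis_monom d (degree q)))"
    using that lau_basis_nz by (simp add: lexp_mult)
qed

lemma zdeg_normal_form: "q \<noteq> 0 \<Longrightarrow> zdeg (lau (normal_form d q)) = int (degree q)"
  using zdeg_lau_y[of "lead_coeff q"]
  by (simp add: zdeg_def lexp_normal_form lookup_add lookup_lexp_basis)

lemma lau_cases:
  assumes "f \<in> range lau" "f \<noteq> 0"
  obtains q where "q \<noteq> 0" "f = lau (normal_form d q)" "zdeg f = int (degree q)"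
proof -
  obtain F where F: "f = lau F" using assms by blast
  obtain q where "E dvd F - normal_form d q" using normal_form_exists by blast
  then have f: "f = lau (normal_form d q)" unfolding F by (rule lau_dvd)
  moreover have "q \<noteq> 0" using f \<open>f \<noteq> 0\<close> by (auto simp: normal_form_0 lau_simps)
  ultimately show thesis using that zdeg_normal_form by blast
qed

text \<open>The basis elements of the coordinate ring have distinct degrees in \<open>z\<close>, so the leading exponents are
  those of a monomial in \<open>y\<close> times a basis element.\<close>

lemma lexp_range_lau: "lexp ` (range lau - {0}) = lead_exps d k"
proof (intro equalityI subsetI)
  fix g assume "g \<in> lexp ` (range lau - {0})"
  then obtain f where f: "f \<in> range lau" "f \<noteq> 0" "g = lexp f" by blast
  obtain q where q: "q \<noteq> 0" "f = lau (normal_form d q)" using f(1,2) by (rule lau_cases)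
  note q = q(1) f(3)[unfolded q(2)]
  obtain e where "lexp (lau_y (lead_coeff q)) = yexp e" using q(1) lexp_lau_y[of "lead_coeff q"] by auto
  then show "g \<in> lead_exps d k"
    using q by (simp add: lexp_normal_form lead_exps_def lookup_add lookup_lexp_basis zdiv_int)
next
  fix g assume g: "g \<in> lead_exps d k"
  define n where "n = nat (Poly_Mapping.lookup g None)"
  define e where "e = (\<Sum>i\<in>UNIV. Poly_Mapping.single i (nat (Poly_Mapping.lookup g (Some i) + int (k i) * int (n div d))))"
  have n: "int n = Poly_Mapping.lookup g None" using g by (simp add: n_def lead_exps_def)
  have e: "int (Poly_Mapping.lookup e i) = Poly_Mapping.lookup g (Some i) + int (k i) * int (n div d)" for i
    using g by (auto simp: e_def lookup_sum lookup_single when_def lead_exps_def zdiv_int n dest!: spec[of _ i])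
  define q where "q = Polynomial.monom (Poly_Mapping.single e (1 :: 'k)) n"
  have q: "q \<noteq> 0" "degree q = n" "lead_coeff q = Poly_Mapping.single e 1"
    by (simp_all add: q_def degree_monom_eq)
  have "lexp (lau (normal_form d q)) = g"
  proof (rule poly_mapping_eqI)
    fix \<kappa> show "Poly_Mapping.lookup (lexp (lau (normal_form d q))) \<kappa> = Poly_Mapping.lookup g \<kappa>"
      using q by (cases \<kappa>) (simp_all add: lexp_normal_form lau_y_single lookup_add lookup_lexp_basis n e)
  qed
  then show "g \<in> lexp ` (range lau - {0})" using lau_normal_form_nz[OF q(1)] by blast
qed

text \<open>An element of degree less than \<open>d\<close> in \<open>z\<close> involves only basis elements that are powers of \<open>z\<close>; in degree \<open>d\<close>
  the basis element is \<open>x\<close>.\<close>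

lemma range_lau_low:
  assumes "f \<in> range lau" "zdeg f < int d" "f \<noteq> 0"
  obtains q where "f = lau_yz q" "q \<noteq> 0" "zdeg f = int (degree q)"
proof -
  obtain q where q: "q \<noteq> 0" "f = lau (normal_form d q)" "zdeg f = int (degree q)"
    using assms(1,3) by (rule lau_cases)
  have "f = (\<Sum>n\<le>degree q. lau_y (coeff q n) * lmon None ^ n)"
    using assms q by (auto simp: lau_normal_form lau_basis_monom intro!: sum.cong)
  also have "\<dots> = lau_yz q" by (rule laurent.eval_yz_coeffs[symmetric]) simp
  finally show thesis using that q by blast
qed

lemma range_lau_zdeg_0:
  assumes "f \<in> range lau" "zdeg f = 0 \<or> f = 0"
  shows "f \<in> range lau_y"
proof (cases "f = 0")
  case False
  then have 0: "zdeg f = 0" "zdeg f < int d" using assms d by auto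
  obtain q where q: "f = lau_yz q" "zdeg f = int (degree q)"
    using assms(1) 0(2) False by (rule range_lau_low)
  then obtain a where "q = [:a:]" using 0(1) by (auto elim: degree_eq_zeroE)
  then show ?thesis using q by (simp add: laurent.eval_yz_const)
next
  case True
  then have "f = lau_y 0" by simp
  then show ?thesis by (rule range_eqI)
qed

lemma range_lau_top:
  assumes "f \<in> range lau" "zdeg f = int d" "f \<noteq> 0"
  obtains \<gamma> r where "f = lau_y \<gamma> * lau_x + lau_yz r" "degree r < d"
proof -
  obtain q where q: "q \<noteq> 0" "f = lau (normal_form d q)" "zdeg f = int (degree q)"
    using assms(1,3) by (rule lau_cases)
  define r where "r = (\<Sum>n<d. Polynomial.monom (coeff q n) n)"
  have "degree r \<le> d - 1"
    unfolding r_def using d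
    by (intro degree_sum_le) (auto intro: order.trans[OF degree_monom_le])
  then have "degree r < d" using d by simp
  moreover have "f = (\<Sum>n\<le>d. lau_y (coeff q n) * lau (basis_monom d n))"
    using assms q by (simp add: lau_normal_form)
  then have "f = (\<Sum>n<d. lau_y (coeff q n) * lmon None ^ n) + lau_y (coeff q d) * lau_x"
    using d by (simp add: lau_basis_monom flip: lessThan_Suc_atMost)
  then have "f = lau_y (coeff q d) * lau_x + lau_yz r"
    by (simp add: r_def laurent.eval_yz_sum laurent.eval_yz_monom add.commute)
  ultimately show thesis using that by blast
qed

end

section \<open>Automorphisms preserve the subring of polynomials in y\<close>

context structure_map
begin

lemma eval_yz_induct:
  assumes const: "\<And>r. Q (c r)" and y: "\<And>i. Q (b i)" and z: "Q w"
    and add: "\<And>u v. Q u \<Longrightarrow> Q v \<Longrightarrow> Q (u + v)" and mult: "\<And>u v. Q u \<Longrightarrow> Q v \<Longrightarrow> Q (u * v)"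
  shows "Q (eval_yz c b w p)"
proof -
  have one: "Q 1" using const[of 1] by (simp add: c_one)
  have pow: "Q (u ^ n)" if "Q u" for u n
    by (induction n) (simp_all add: one mult that)
  have prod: "Q (\<Prod>i\<in>S. f i)" if "\<And>i. Q (f i)" for f and S :: "'d set"
    by (induction S rule: infinite_finite_induct) (simp_all add: one mult that)
  have q: "Q (eval_y c b q)" for q
    by (induction q rule: ypoly_induct)
       (simp_all add: eval_y_single eval_y_add mult const prod pow y add)
  show ?thesis
    by (induction p) (use const[of 0] in \<open>simp_all add: c_zero eval_yz_pCons add mult q z\<close>)
qed

lemma eval_xyz_induct:
  assumes const: "\<And>r. Q (c r)" and y: "\<And>i. Q (b i)" and z: "Q w" and x: "Q a"
    and add: "\<And>u v. Q u \<Longrightarrow> Q v \<Longrightarrow> Q (u + v)" and mult: "\<And>u v. Q u \<Longrightarrow> Q v \<Longrightarrow> Q (u * v)"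
  shows "Q (eval_xyz c a b w F)"
proof -
  have "Q (eval_yz c b w p)" for p by (rule eval_yz_induct) (fact assms)+
  then show ?thesis
    by (induction F) (use const[of 0] in \<open>simp_all add: c_zero eval_xyz_pCons add mult x\<close>)
qed

end

context danielewski_data
begin

lemma lau_range_const [intro, simp]: "Poly_Mapping.single 0 c \<in> range lau"
  by (rule range_eqI[of _ _ "[:[:yconst c:]:]"]) (simp add: lau_simps laurent.eval_yz_const laurent.eval_y_yconst)

lemma lau_range_yz [intro, simp]: "lau_yz p \<in> range lau"
  by (rule range_eqI[of _ _ "[:p:]"]) (simp add: lau_simps)

lemma lau_range_y [intro, simp]: "lau_y q \<in> range lau"
  using lau_range_yz[of "[:q:]"] by (simp add: laurent.eval_yz_const)

lemma lau_range_lmon [intro, simp]: "lmon \<kappa> \<in> range lau"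
  using lau_range_yz[of "[:0, 1:]"] lau_range_y[of "yvar (the \<kappa>)"]
  by (cases \<kappa>) (simp_all add: laurent.eval_yz_z laurent.eval_y_yvar)

lemma lau_range_x [intro, simp]: "lau_x \<in> range lau"
  by (rule range_eqI[of _ _ "[:0, 1:]"]) (simp add: lau_simps)

lemma lau_range_ym [intro, simp]: "ym \<in> range lau"
  using lau_range_y[of "ymonomial k"] by (simp add: lau_ymonomial)

lemma lau_range_add [intro]: "f \<in> range lau \<Longrightarrow> g \<in> range lau \<Longrightarrow> f + g \<in> range lau"
  by (auto simp flip: lau_simps(1))

lemma lau_range_mult [intro]: "f \<in> range lau \<Longrightarrow> g \<in> range lau \<Longrightarrow> f * g \<in> range lau"
  by (auto simp flip: lau_simps(2))

lemma range_lau_clear: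
  assumes "f \<in> range lau" "f \<noteq> 0"
  obtains M p where "p \<noteq> 0" "zdeg f = int (degree p)" "ym ^ M * f = lau_yz p"
proof -
  obtain q where q: "q \<noteq> 0" "f = lau (normal_form d q)" "zdeg f = int (degree q)"
    using assms by (rule lau_cases)
  obtain M p where p: "degree p = degree q" "p \<noteq> 0"
    "E dvd [:[:ymonomial k:]:] ^ M * normal_form d q - [:p:]"
    using q(1) by (rule normal_form_clear)
  from p(3) have "lau ([:[:ymonomial k:]:] ^ M * normal_form d q) = lau [:p:]" by (rule lau_dvd)
  then have "ym ^ M * f = lau_yz p"
    by (simp add: lau_simps q(2) laurent.eval_yz_const lau_ymonomial)
  then show thesis using that p q by auto
qed

text \<open>This is the derivation \<open>y\<^bsup>k\<^esup> \<partial>\<^sub>z\<close>; the exponentials of its multiples by polynomials in \<open>y\<close> are the shears.\<close>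

definition zder :: "('n, 'k) laurent \<Rightarrow> ('n, 'k) laurent" where
  "zder = log_deriv (\<lambda>g. of_int (Poly_Mapping.lookup g None) * Poly_Mapping.single (yexp k - Poly_Mapping.single None 1) 1)"

lemma zder_add: "zder (f + g) = zder f + zder g"
  unfolding zder_def by (rule log_deriv_add)

lemma zder_mult: "zder (f * g) = f * zder g + g * zder f"
  unfolding zder_def by (rule log_deriv_mult) (simp add: lookup_add distrib_right)

lemma zder_const: "zder (Poly_Mapping.single 0 c) = 0"
  by (simp add: zder_def log_deriv_single)

lemma zder_zero [simp]: "zder 0 = 0"
  using zder_const[of 0] by simp

lemma zder_lmon_Some: "zder (lmon (Some i)) = 0"
  by (simp add: zder_def log_deriv_single lookup_single)

lemma zder_lmon_None: "zder (lmon None) = ym"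
  by (simp add: zder_def log_deriv_single lookup_single mult_single)

lemma zder_lau_y: "zder (lau_y q) = 0"
proof -
  have "zder (eval_yz (Poly_Mapping.single 0) (\<lambda>i. lmon (Some i)) 0 [:q:]) = 0"
    by (rule laurent.eval_yz_induct)
       (simp_all add: zder_const zder_lmon_Some zder_add zder_mult)
  then show ?thesis by (simp add: laurent.eval_yz_const)
qed

lemma zder_ym: "zder ym = 0"
  using zder_lau_y[of "ymonomial k"] by (simp add: lau_ymonomial)

lemma zder_lau_yz: "zder (lau_yz p) = ym * lau_yz (pderiv p)"
  by (induction p)
     (simp_all add: laurent.eval_yz_pCons zder_add zder_mult zder_lau_y zder_lmon_None pderiv_pCons
        laurent.eval_yz_add algebra_simps)

lemma zder_lau_x: "zder lau_x = lau_yz (pderiv P)"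
proof -
  have "ym * zder lau_x = ym * lau_yz (pderiv P)"
    using arg_cong[OF lau_x_ym, of zder] by (simp add: zder_mult zder_ym zder_lau_yz)
  then show ?thesis using ym_nz mult_left_cancel by blast
qed

lemma zder_closed: "f \<in> range lau \<Longrightarrow> zder f \<in> range lau"
proof -
  assume "f \<in> range lau"
  then obtain F where F: "f = eval_xyz (Poly_Mapping.single 0) lau_x (\<lambda>i. lmon (Some i)) (lmon None) F"
    by (auto simp: lau_def)
  have zero: "0 \<in> range lau" using lau_range_const[of 0] by simp
  have "f \<in> range lau \<and> zder f \<in> range lau"
    unfolding F
    by (rule laurent.eval_xyz_induct)
       (auto simp: zder_const zder_lmon_Some zder_lmon_None zder_lau_x zder_add zder_mult zero)
  then show ?thesis ..
qed

text \<open>Powers of \<open>y\<^bsup>k\<^esup>\<close> are constants of the derivation, so after clearing denominators the claim is about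
  a polynomial in \<open>z\<close>, which is killed by differentiating often enough.\<close>

lemma zder_nilpotent:
  assumes "f \<in> range lau"
  shows "\<exists>j. (zder ^^ j) f = 0"
proof (cases "f = 0")
  case False
  with assms obtain M p where p: "p \<noteq> 0" "ym ^ M * f = lau_yz p" by (rule range_lau_clear)
  have ymM: "zder (ym ^ M) = 0"
    using zder_lau_y[of "ymonomial k ^ M"] by (simp add: laurent.eval_y_pow lau_ymonomial)
  have 1: "(zder ^^ j) (ym ^ M * g) = ym ^ M * (zder ^^ j) g" for j g
    by (induction j) (simp_all add: zder_mult ymM)
  have ymj: "zder (ym ^ j) = 0" for j
    using zder_lau_y[of "ymonomial k ^ j"] by (simp add: laurent.eval_y_pow lau_ymonomial)
  have 2: "(zder ^^ j) (lau_yz p) = ym ^ j * lau_yz ((pderiv ^^ j) p)" for j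
    by (induction j) (simp_all add: zder_mult ymj zder_lau_yz mult_ac)
  have "degree ((pderiv ^^ degree p) p) = 0" by (simp add: degree_higher_pderiv)
  then have "(pderiv ^^ Suc (degree p)) p = 0" by (simp add: pderiv_eq_0_iff)
  then have "ym ^ M * (zder ^^ Suc (degree p)) f = 0"
    unfolding 1[symmetric] p(2) 2 by simp
  then have "(zder ^^ Suc (degree p)) f = 0" using ym_nz by (simp del: funpow.simps)
  then show ?thesis by blast
qed (auto intro: exI[of _ 0])

end

text \<open>An automorphism of the coordinate ring and its inverse. The conditions are relative to the
  coordinate ring, as an automorphism need not extend to Laurent polynomials.\<close>

locale coordinate_automorphism = danielewski_data +
  fixes \<phi> \<psi> :: "('a, 'b) laurent \<Rightarrow> ('a, 'b) laurent"
  assumes phi_closed: "\<And>f. f \<in> range lau \<Longrightarrow> \<phi> f \<in> range lau"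
    and phi_add: "\<And>f g. f \<in> range lau \<Longrightarrow> g \<in> range lau \<Longrightarrow> \<phi> (f + g) = \<phi> f + \<phi> g"
    and phi_mult: "\<And>f g. f \<in> range lau \<Longrightarrow> g \<in> range lau \<Longrightarrow> \<phi> (f * g) = \<phi> f * \<phi> g"
    and phi_const: "\<And>c. \<phi> (Poly_Mapping.single 0 c) = Poly_Mapping.single 0 c"
    and psi_closed: "\<And>f. f \<in> range lau \<Longrightarrow> \<psi> f \<in> range lau"
    and psi_add: "\<And>f g. f \<in> range lau \<Longrightarrow> g \<in> range lau \<Longrightarrow> \<psi> (f + g) = \<psi> f + \<psi> g"
    and psi_mult: "\<And>f g. f \<in> range lau \<Longrightarrow> g \<in> range lau \<Longrightarrow> \<psi> (f * g) = \<psi> f * \<psi> g"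
    and psi_const: "\<And>c. \<psi> (Poly_Mapping.single 0 c) = Poly_Mapping.single 0 c"
    and psi_phi: "\<And>f. f \<in> range lau \<Longrightarrow> \<psi> (\<phi> f) = f"
    and phi_psi: "\<And>f. f \<in> range lau \<Longrightarrow> \<phi> (\<psi> f) = f"
begin

lemma inverse: "coordinate_automorphism k d P \<psi> \<phi>"
  by unfold_locales (simp_all add: phi_closed phi_add phi_mult phi_const psi_closed psi_add psi_mult psi_const psi_phi phi_psi)

lemma phi_0 [simp]: "\<phi> 0 = 0" using phi_const[of 0] by simp

lemma phi_eq_0: "f \<in> range lau \<Longrightarrow> \<phi> f = 0 \<longleftrightarrow> f = 0"
  using psi_phi[of f] psi_const[of 0] by auto

definition conj_der :: "('a, 'b) laurent \<Rightarrow> ('a, 'b) laurent" where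
  "conj_der f = \<phi> (zder (\<psi> f))"

text \<open>The conjugated derivation makes sense on the coordinate ring only. Its logarithmic derivatives at
  the variables define a derivation of all Laurent polynomials that extends it, and to which the
  leading term argument applies.\<close>

definition conj_log :: "'a option \<Rightarrow> ('a, 'b) laurent" where
  "conj_log \<kappa> = conj_der (lmon \<kappa>) * Poly_Mapping.single (- Poly_Mapping.single \<kappa> 1) 1"

definition ext_der :: "('a, 'b) laurent \<Rightarrow> ('a, 'b) laurent" where
  "ext_der = log_deriv (\<lambda>g. \<Sum>\<kappa>\<in>UNIV. of_int (Poly_Mapping.lookup g \<kappa>) * conj_log \<kappa>)"

lemma ext_der_add: "ext_der (f + g) = ext_der f + ext_der g"
  unfolding ext_der_def by (rule log_deriv_add)

lemma ext_der_mult: "ext_der (f * g) = f * ext_der g + g * ext_der f"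
  unfolding ext_der_def
  by (rule log_deriv_mult) (simp add: lookup_add distrib_right sum.distrib)

lemma ext_der_lmon: "ext_der (lmon \<kappa>) = conj_der (lmon \<kappa>)"
proof -
  have "(\<Sum>\<kappa>'\<in>UNIV. of_int (Poly_Mapping.lookup (Poly_Mapping.single \<kappa> 1) \<kappa>') * conj_log \<kappa>') =
      (\<Sum>\<kappa>'\<in>UNIV. if \<kappa>' = \<kappa> then conj_log \<kappa>' else 0)"
    by (intro sum.cong) (auto simp: lookup_single when_def)
  then have "ext_der (lmon \<kappa>) = lmon \<kappa> * conj_log \<kappa>"
    by (simp add: ext_der_def log_deriv_single)
  then show ?thesis by (simp add: conj_log_def mult.left_commute[of "lmon \<kappa>"] mult_single)
qed

lemma conj_der_closed: "f \<in> range lau \<Longrightarrow> conj_der f \<in> range lau"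
  by (simp add: conj_der_def phi_closed psi_closed zder_closed)

lemma conj_der_add: "f \<in> range lau \<Longrightarrow> g \<in> range lau \<Longrightarrow> conj_der (f + g) = conj_der f + conj_der g"
  by (simp add: conj_der_def psi_add zder_add phi_add zder_closed psi_closed)

lemma conj_der_mult:
  "f \<in> range lau \<Longrightarrow> g \<in> range lau \<Longrightarrow> conj_der (f * g) = f * conj_der g + g * conj_der f"
  by (simp add: conj_der_def psi_mult zder_mult phi_add phi_mult zder_closed psi_closed
        lau_range_mult phi_psi)

text \<open>Two derivations that agree on the \<open>y\<^sub>i\<close> and \<open>z\<close> also agree on \<open>x\<close>, because \<open>x y\<^bsup>k\<^esup> = P\<close> and \<open>y\<^bsup>k\<^esup>\<close> is not
  a zero divisor.\<close>

lemma ext_der_eq: "f \<in> range lau \<Longrightarrow> ext_der f = conj_der f"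
proof -
  assume "f \<in> range lau"
  then obtain F where F: "f = eval_xyz (Poly_Mapping.single 0) lau_x (\<lambda>i. lmon (Some i)) (lmon None) F"
    by (auto simp: lau_def)
  let ?Q = "\<lambda>f. f \<in> range lau \<and> ext_der f = conj_der f"
  have const: "?Q (Poly_Mapping.single 0 c)" for c
    by (simp add: ext_der_def log_deriv_single conj_der_def psi_const zder_const)
  have lmon: "?Q (lmon \<kappa>)" for \<kappa> by (simp add: ext_der_lmon)
  have add: "?Q u \<Longrightarrow> ?Q v \<Longrightarrow> ?Q (u + v)" for u v
    by (auto simp: ext_der_add conj_der_add)
  have mult: "?Q u \<Longrightarrow> ?Q v \<Longrightarrow> ?Q (u * v)" for u v
    by (auto simp: ext_der_mult conj_der_mult)
  have yz: "?Q (lau_yz p)" for p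
    by (rule laurent.eval_yz_induct) (fact const lmon add mult)+
  have ym: "?Q ym"
    using yz[of "[:ymonomial k:]"] by (simp add: laurent.eval_yz_const lau_ymonomial)
  have "ext_der (lau_x * ym) = conj_der (lau_x * ym)"
    unfolding lau_x_ym using yz by blast
  then have "ym * ext_der lau_x = ym * conj_der lau_x"
    using ym by (simp add: ext_der_mult conj_der_mult)
  then have x: "?Q lau_x" using ym_nz by simp
  have "?Q f"
    unfolding F by (rule laurent.eval_xyz_induct) (fact const lmon x add mult)+
  then show ?thesis ..
qed

lemma ext_der_iterate: "f \<in> range lau \<Longrightarrow> (ext_der ^^ j) f = \<phi> ((zder ^^ j) (\<psi> f))"
proof (induction j)
  case (Suc j)
  have "(zder ^^ j) (\<psi> f) \<in> range lau"
    by (induction j) (simp_all add: Suc.prems psi_closed zder_closed)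
  then show ?case
    using Suc by (simp add: ext_der_eq phi_closed conj_der_def psi_phi)
qed (simp add: phi_psi)

lemma ext_der_kernel:
  assumes "f \<in> range lau" "f \<noteq> 0" "ext_der f = 0"
  shows "zdeg f = 0"
proof -
  have "\<exists>\<kappa>. conj_log \<kappa> \<noteq> 0"
  proof (rule ccontr)
    assume "\<nexists>\<kappa>. conj_log \<kappa> \<noteq> 0"
    then have "ext_der (\<phi> (lmon None)) = 0" by (simp add: ext_der_def log_deriv_def)
    then have "\<phi> ym = 0"
      by (simp add: ext_der_eq phi_closed conj_der_def psi_phi zder_lmon_None)
    then show False using phi_eq_0[of ym] ym_nz by simp
  qed
  then obtain \<kappa>0 where \<kappa>0: "conj_log \<kappa>0 \<noteq> 0" ..
  show ?thesis
    unfolding zdeg_def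
  proof (rule kernel_lead_exp[where k = k and d = d and A = "range lau" and L = conj_log and f = f,
        folded ext_der_def])
    show "ext_der f \<in> range lau" if "f \<in> range lau" for f
      using that by (simp add: ext_der_eq conj_der_closed)
    show "\<exists>j. (ext_der ^^ j) f = 0" if f: "f \<in> range lau" for f
    proof -
      obtain j where "(zder ^^ j) (\<psi> f) = 0" using zder_nilpotent[OF psi_closed[OF f]] by blast
      then show ?thesis using f by (auto simp: ext_der_iterate intro!: exI[of _ j])
    qed
  qed (fact d k lexp_range_lau \<kappa>0 assms)+
qed

text \<open>Polynomials in \<open>y\<close> are killed by \<open>y\<^bsup>k\<^esup> \<partial>\<^sub>z\<close>, so their images are killed by the conjugated derivation.\<close>

lemma phi_lau_y: "\<phi> (lau_y q) \<in> range lau_y"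
proof (cases "q = 0")
  case False
  have "ext_der (\<phi> (lau_y q)) = 0"
    by (simp add: ext_der_eq phi_closed conj_der_def psi_phi zder_lau_y)
  then have "zdeg (\<phi> (lau_y q)) = 0"
    using False by (intro ext_der_kernel) (auto simp: phi_closed phi_eq_0)
  then show ?thesis by (intro range_lau_zdeg_0) (simp_all add: phi_closed)
qed (auto intro: range_eqI[of _ _ 0])

end

section \<open>The shape of an automorphism\<close>

global_interpretation const_y: structure_map "yconst :: 'k :: comm_ring_1 \<Rightarrow> ('n, 'k) ypoly"
  by standard (simp_all add: yconst_add yconst_mult yconst_one)

lemma const_poly_prod: "[:\<Prod>i\<in>I. f i:] = (\<Prod>i\<in>I. [:f i:])"
proof (induction I rule: infinite_finite_induct)
  case (insert i I)
  have "[:f i * prod f I:] = [:f i:] * [:prod f I:]" by (rule yzpoly_const_prod[symmetric])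
  then show ?case using insert by (simp del: mult_pCons_left mult_pCons_right)
qed (simp_all add: one_pCons)

lemma eval_y_const_yz:
  "eval_y (\<lambda>a. [:yconst a:]) (\<lambda>i. [:Y i:]) q = [:eval_y yconst Y q:]"
proof (induction q rule: const_yz.ypoly_induct)
  case (single e a)
  show ?case
    by (simp only: const_yz.eval_y_single const_y.eval_y_single poly_const_pow
          const_poly_prod[symmetric] yzpoly_const_prod)
qed (simp add: const_yz.eval_y_add const_y.eval_y_add)

lemma (in structure_map) eval_y_compose:
  "eval_y c b (eval_y yconst Y q) = eval_y c (\<lambda>i. eval_y c b (Y i)) q"
  by (induction q rule: const_yz.ypoly_induct)
     (simp_all add: eval_y_single const_y.eval_y_single eval_y_add const_y.eval_y_add eval_y_mult
        eval_y_prod eval_y_pow eval_y_yconst)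

lemma coeff_linear_power_top:
  "coeff ([:b, a:] ^ n) n = a ^ n" "coeff ([:b, a:] ^ Suc n) n = of_nat (Suc n) * a ^ n * (b :: 'a :: comm_ring_1)"
proof -
  have deg: "degree ([:b, a:] ^ n) \<le> n" for n
    using degree_power_le[of "[:b, a:]" n] by (simp split: if_splits)
  show top: "coeff ([:b, a:] ^ n) n = a ^ n" for n
  proof (induction n)
    case (Suc n)
    have "coeff ([:b, a:] ^ n) (Suc n) = 0" using deg[of n] by (intro coeff_eq_0) simp
    then show ?case using Suc by simp
  qed simp
  show "coeff ([:b, a:] ^ Suc n) n = of_nat (Suc n) * a ^ n * b"
  proof (induction n)
    case (Suc n)
    have "coeff ([:b, a:] ^ Suc (Suc n)) (Suc n) = b * coeff ([:b, a:] ^ Suc n) (Suc n) + a * coeff ([:b, a:] ^ Suc n) n"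
      by (simp only: power_Suc[of _ "Suc n"]) simp
    then show ?case unfolding Suc top by (simp add: algebra_simps)
  qed simp
qed

lemma poly_diff_dvd: "h dvd poly p (a + h) - poly p a" for h :: "'a :: comm_ring_1"
proof (induction p)
  case (pCons c p)
  have "poly (pCons c p) (a + h) - poly (pCons c p) a = a * (poly p (a + h) - poly p a) + h * poly p (a + h)"
    by (simp add: algebra_simps)
  then show ?case using pCons by simp
qed simp

lemma single_nat_power: "Poly_Mapping.single e t ^ n = Poly_Mapping.single (Poly_Mapping.map ((*) n) e) (t ^ n)"
  for e :: "'n \<Rightarrow>\<^sub>0 nat" and t :: "'k :: comm_ring_1"
proof (induction n)
  case (Suc n)
  have "e + Poly_Mapping.map ((*) n) e = Poly_Mapping.map ((*) (Suc n)) e"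
    by (intro poly_mapping_eqI) (simp add: lookup_add map.rep_eq when_def)
  then show ?case unfolding power_Suc Suc mult_single by (simp only:)
next
  case 0
  have "Poly_Mapping.map ((*) 0) e = 0"
    by (intro poly_mapping_eqI) (simp add: map.rep_eq when_def)
  then show ?case by (simp only: power_0 single_one)
qed

lemma prod_single_power:
  fixes e :: "'n \<Rightarrow> 'm \<Rightarrow>\<^sub>0 nat" and t :: "'n \<Rightarrow> 'k :: comm_ring_1"
  shows "(\<Prod>i\<in>S. Poly_Mapping.single (e i) (t i) ^ n i) =
    Poly_Mapping.single (\<Sum>i\<in>S. Poly_Mapping.map ((*) (n i)) (e i)) (\<Prod>i\<in>S. t i ^ n i)"
  by (induction S rule: infinite_finite_induct) (simp_all add: single_nat_power mult_single)

lemma single_eq_single_iff: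
  "Poly_Mapping.single a c = Poly_Mapping.single a' c' \<longleftrightarrow> a = a' \<and> c = c' \<or> c = 0 \<and> c' = 0"
  by (metis lookup_single_eq lookup_single_not_eq single_zero)

text \<open>Sums of natural numbers do not cancel: a unit vector that is a combination of rows of natural
  numbers with natural coefficients has to be one of the rows.\<close>

lemma unit_row:
  fixes a :: "'n :: finite \<Rightarrow> nat" and e :: "'n \<Rightarrow> 'n \<Rightarrow> nat"
  assumes "\<And>l. (\<Sum>i\<in>UNIV. a i * e i l) = (if l = j then 1 else 0)"
  shows "\<exists>i. \<forall>l. e i l = (if l = j then 1 else 0)"
proof -
  have "(\<Sum>i\<in>UNIV. a i * e i j) \<noteq> 0" using assms[of j] by simp
  then obtain i where i: "a i * e i j \<noteq> 0"
    by (auto elim: sum.not_neutral_contains_not_neutral)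
  have "a i * e i l \<le> (if l = j then 1 else 0)" for l
    unfolding assms[of l, symmetric] by (rule member_le_sum) auto
  note le = this
  have "e i l = (if l = j then 1 else 0)" for l
  proof (cases "l = j")
    case True
    have "a i * e i j \<le> 1" using le[of j] by simp
    then have "a i * e i j = 1" using i by linarith
    then show ?thesis using True by simp
  next
    case False
    then show ?thesis using le[of l] i by simp
  qed
  then show ?thesis by blast
qed

context coordinate_automorphism
begin

lemma phi_lau_yz: "\<phi> (lau_yz p) =
    eval_yz (Poly_Mapping.single 0) (\<lambda>i. \<phi> (lmon (Some i))) (\<phi> (lmon None)) p"
  by (rule yzpoly_hom_eqI)
     (simp_all add: laurent.eval_yz_add laurent.eval_yz_mult phi_add phi_mult
        laurent.eval_yz_const laurent.eval_y_yconst phi_const laurent.eval_y_yvar laurent.eval_yz_z)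

lemma phi_z_nz: "\<phi> (lmon None) \<noteq> 0" by (simp add: phi_eq_0)

text \<open>Otherwise the image of \<open>z\<close> would lie in \<open>\<bbbK>[y]\<close>, and so would \<open>z\<close>, since the inverse preserves \<open>\<bbbK>[y]\<close>.\<close>

lemma zdeg_phi_z_pos: "zdeg (\<phi> (lmon None)) > 0"
proof (rule ccontr)
  assume "\<not> zdeg (\<phi> (lmon None)) > 0"
  moreover obtain q :: "('a, 'b) yzpoly" where "zdeg (\<phi> (lmon None)) = int (degree q)"
    using phi_closed[of "lmon None"] phi_z_nz by (rule lau_cases) simp
  ultimately have "\<phi> (lmon None) \<in> range lau_y"
    by (intro range_lau_zdeg_0) (simp_all add: phi_closed)
  then obtain q where "\<phi> (lmon None) = lau_y q" by blast
  then have "lmon None = \<psi> (lau_y q)" using psi_phi[of "lmon None"] by simp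
  also have "\<psi> (lau_y q) \<in> range lau_y"
    using coordinate_automorphism.phi_lau_y[OF inverse] .
  finally obtain q' :: "('a, 'b) ypoly" where q': "lmon None = lau_y q'" by blast
  then have "lau_y q' \<noteq> 0" by (metis single_eq_0_iff one_neq_zero)
  then have "zdeg (lau_y q') = 0" by (simp add: zdeg_lau_y)
  then show False unfolding q'[symmetric] by (simp add: zdeg_lmon_None)
qed

text \<open>After clearing denominators \<open>f\<close> is a polynomial in \<open>z\<close> over \<open>\<bbbK>[y]\<close>. Its image is a polynomial of the same
  degree in \<open>\<phi>(z)\<close> over \<open>\<phi>(\<bbbK>[y])\<close>, whose nonzero elements have degree \<open>0\<close>.\<close>

lemma zdeg_phi:
  assumes "f \<in> range lau" "f \<noteq> 0"
  shows "zdeg (\<phi> f) = zdeg f * zdeg (\<phi> (lmon None))"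
proof -
  obtain M p where p: "p \<noteq> 0" "zdeg f = int (degree p)" "ym ^ M * f = lau_yz p"
    using assms by (rule range_lau_clear)
  have h: "\<phi> (lau_y q) \<noteq> 0 \<and> zdeg (\<phi> (lau_y q)) = 0" if "q \<noteq> 0" for q
  proof -
    obtain q' where q': "\<phi> (lau_y q) = lau_y q'" using phi_lau_y[of q] by blast
    have "\<phi> (lau_y q) \<noteq> 0" using that by (simp add: phi_eq_0)
    then show ?thesis unfolding q' by (simp add: zdeg_lau_y)
  qed
  have coeff: "eval_y (Poly_Mapping.single 0) (\<lambda>i. \<phi> (lmon (Some i))) q = \<phi> (lau_y q)" for q
    using phi_lau_yz[of "[:q:]"] by (simp add: laurent.eval_yz_const)
  have "\<phi> (lau_yz p) = (\<Sum>n\<le>degree p. \<phi> (lau_y (coeff p n)) * \<phi> (lmon None) ^ n)"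
    unfolding phi_lau_yz coeff[symmetric] by (rule laurent.eval_yz_coeffs) simp
  then have "zdeg (\<phi> (lau_yz p)) = int (degree p) * zdeg (\<phi> (lmon None))"
    using zdeg_poly_expression(3)[of "\<lambda>q. \<phi> (lau_y q)", OF h _ phi_z_nz zdeg_phi_z_pos p(1)] by simp
  moreover have "ym ^ M = lau_y (ymonomial k ^ M)" "ymonomial k ^ M \<noteq> (0 :: ('a, 'b) ypoly)"
    by (simp_all add: laurent.eval_y_pow lau_ymonomial flip: lau_y_eq_0_iff)
  then have "\<phi> (lau_yz p) = \<phi> (lau_y (ymonomial k ^ M)) * \<phi> f" "\<phi> (lau_y (ymonomial k ^ M)) \<noteq> 0"
    "zdeg (\<phi> (lau_y (ymonomial k ^ M))) = 0"
    using h[of "ymonomial k ^ M"] assms(1) by (simp_all add: p(3)[symmetric] phi_mult)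
  moreover have "\<phi> f \<noteq> 0" using assms by (simp add: phi_eq_0)
  ultimately show ?thesis using p(2) by (simp add: zdeg_mult)
qed

lemma zdeg_phi_z: "zdeg (\<phi> (lmon None)) = 1"
proof -
  have "\<psi> (lmon None) \<noteq> 0" using coordinate_automorphism.phi_z_nz[OF inverse] .
  then have "zdeg (\<psi> (lmon None)) * zdeg (\<phi> (lmon None)) = 1"
    using zdeg_phi[of "\<psi> (lmon None)"] by (simp add: psi_closed phi_psi zdeg_lmon_None)
  then show ?thesis using zdeg_phi_z_pos by (auto simp: zmult_eq_1_iff)
qed

lemma phi_z: obtains \<beta> \<alpha> where "\<phi> (lmon None) = lau_yz [:\<beta>, \<alpha>:]"
proof -
  obtain q where q: "\<phi> (lmon None) = lau_yz q" "zdeg (\<phi> (lmon None)) = int (degree q)"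
    using phi_closed[of "lmon None"] _ phi_z_nz by (rule range_lau_low) (use d in \<open>simp_all add: zdeg_phi_z\<close>)
  have "degree q \<le> 1" using q(2) zdeg_phi_z by linarith
  then have "q = [:coeff q 0, coeff q 1:]"
    by (intro poly_eqI) (auto simp: coeff_pCons coeff_eq_0 split: nat.splits)
  then show thesis using that q by metis
qed

lemma phi_y: "\<exists>Y. \<forall>i. \<phi> (lmon (Some i)) = lau_y (Y i)"
proof -
  have "\<exists>q. \<phi> (lmon (Some i)) = lau_y q" for i
    using phi_lau_y[of "yvar i"] by (auto simp: laurent.eval_y_yvar)
  then show ?thesis by metis
qed

text \<open>The image of \<open>z\<close> is linear in \<open>z\<close>; its leading coefficient divides \<open>1\<close>, as one sees by applying \<open>\<phi>\<close> to
  the linear polynomial \<open>\<psi>(z)\<close>. The image of \<open>x\<close> has degree \<open>d\<close> like \<open>x\<close>, hence is \<open>\<gamma> x + r\<close>. The last equation is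
  the image of \<open>x y\<^bsup>k\<^esup> = P\<close> multiplied by \<open>y\<^bsup>k\<^esup>\<close>, which makes it an equation in \<open>\<bbbK>[y, z]\<close>.\<close>

lemma automorphism_equations:
  obtains Y \<beta> u \<gamma> r where
    "\<And>i. \<phi> (lmon (Some i)) = lau_y (Y i)" "\<phi> (lmon None) = lau_yz [:\<beta>, yconst u:]" "u \<noteq> 0"
    "degree r < d"
    "smult (\<Prod>i\<in>UNIV. Y i ^ k i) (smult \<gamma> P + smult (ymonomial k) r) =
      smult (ymonomial k) (eval_yz (\<lambda>a. [:yconst a:]) (\<lambda>i. [:Y i:]) [:\<beta>, yconst u:] P)"
proof -
  obtain Y where Y: "\<And>i. \<phi> (lmon (Some i)) = lau_y (Y i)" using phi_y by blast
  obtain \<beta> \<alpha> where \<alpha>: "\<phi> (lmon None) = lau_yz [:\<beta>, \<alpha>:]" by (rule phi_z)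
  obtain \<beta>' \<alpha>' where \<alpha>': "\<psi> (lmon None) = lau_yz [:\<beta>', \<alpha>':]"
    by (rule coordinate_automorphism.phi_z[OF inverse])
  have phi_yz: "\<phi> (lau_yz p) = lau_yz (eval_yz (\<lambda>a. [:yconst a:]) (\<lambda>i. [:Y i:]) [:\<beta>, \<alpha>:] p)" for p
    unfolding phi_lau_yz laurent.eval_yz_compose Y \<alpha> laurent.eval_yz_const ..
  have "lau_yz [:0, 1:] = \<phi> (\<psi> (lmon None))" by (simp add: phi_psi laurent.eval_yz_z)
  also have "\<dots> = lau_yz ([:eval_y yconst Y \<beta>':] + [:\<beta>, \<alpha>:] * [:eval_y yconst Y \<alpha>':])"
    unfolding \<alpha>' phi_yz by (simp add: const_yz.eval_yz_pCons eval_y_const_yz)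
  finally have "[:0, 1:] = [:eval_y yconst Y \<beta>':] + [:\<beta>, \<alpha>:] * [:eval_y yconst Y \<alpha>':]"
    unfolding lau_yz_eq_iff .
  then have "\<alpha> * eval_y yconst Y \<alpha>' = 1" by (simp add: mult.commute)
  then have unit: "\<alpha> * eval_y yconst Y \<alpha>' = Poly_Mapping.single 0 1" "eval_y yconst Y \<alpha>' * \<alpha> = Poly_Mapping.single 0 1"
    by (simp_all add: mult.commute)
  obtain a u where u: "\<alpha> = Poly_Mapping.single a u" "u \<noteq> 0"
    using mult_eq_single_imp_single[OF unit(1)] by auto
  obtain a' u' where u': "eval_y yconst Y \<alpha>' = Poly_Mapping.single a' u'" "u' \<noteq> 0"
    using mult_eq_single_imp_single[OF unit(2)] by auto
  have "a + a' = 0" using unit(1) u u' by (simp add: mult_single single_eq_single_iff del: single_one)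
  then have "a = 0" by (intro poly_mapping_eqI) (metis add_is_0 lookup_add lookup_zero)
  then have \<alpha>u: "\<alpha> = yconst u" using u by (simp add: yconst_def)
  have x: "\<phi> lau_x \<in> range lau" "\<phi> lau_x \<noteq> 0" using lau_x_nz by (simp_all add: phi_closed phi_eq_0)
  have "zdeg lau_x = int d" by (simp add: zdeg_def lexp_lau_x lookup_minus)
  then have "zdeg (\<phi> lau_x) = int d" using zdeg_phi[of lau_x] lau_x_nz by (simp add: zdeg_phi_z)
  then obtain \<gamma> r where r: "\<phi> lau_x = lau_y \<gamma> * lau_x + lau_yz r" "degree r < d"
    using x by (metis range_lau_top)
  have "\<phi> ym = lau_y (\<Prod>i\<in>UNIV. Y i ^ k i)"
    using phi_yz[of "[:ymonomial k:]"]
    by (simp add: laurent.eval_yz_const lau_ymonomial const_yz.eval_yz_const eval_y_const_yz const_y.eval_y_ymonomial)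
  then have "(lau_y \<gamma> * lau_x + lau_yz r) * lau_y (\<Prod>i\<in>UNIV. Y i ^ k i) =
      lau_yz (eval_yz (\<lambda>a. [:yconst a:]) (\<lambda>i. [:Y i:]) [:\<beta>, yconst u:] P)"
    using arg_cong[OF lau_x_ym, of \<phi>] by (simp add: phi_mult phi_yz r \<alpha>u)
  then have "ym * ((lau_y \<gamma> * lau_x + lau_yz r) * lau_y (\<Prod>i\<in>UNIV. Y i ^ k i)) =
      ym * lau_yz (eval_yz (\<lambda>a. [:yconst a:]) (\<lambda>i. [:Y i:]) [:\<beta>, yconst u:] P)"
    by simp
  also have "ym * ((lau_y \<gamma> * lau_x + lau_yz r) * lau_y (\<Prod>i\<in>UNIV. Y i ^ k i)) =
      lau_y (\<Prod>i\<in>UNIV. Y i ^ k i) * (lau_y \<gamma> * (lau_x * ym) + ym * lau_yz r)"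
    by (simp add: algebra_simps)
  finally have "lau_yz (smult (\<Prod>i\<in>UNIV. Y i ^ k i) (smult \<gamma> P + smult (ymonomial k) r)) =
      lau_yz (smult (ymonomial k) (eval_yz (\<lambda>a. [:yconst a:]) (\<lambda>i. [:Y i:]) [:\<beta>, yconst u:] P))"
    by (simp add: lau_x_ym laurent.eval_yz_smult laurent.eval_yz_add lau_ymonomial)
  then show thesis
    using that[OF Y \<alpha>[unfolded \<alpha>u] u(2) r(2)] unfolding lau_yz_eq_iff by blast
qed

end

lemma lau_y_eq_iff: "lau_y p = lau_y q \<longleftrightarrow> p = q"
  by (metis lookup_lau_y poly_mapping_eqI)

lemma single_eq_yconst_yvar: "Poly_Mapping.single (Poly_Mapping.single j 1) t = yconst t * yvar j"
  by (simp add: yconst_def yvar_def mult_single)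

lemma yconst_power: "yconst t ^ n = yconst (t ^ n)" for t :: "'k :: comm_ring_1"
  by (induction n) (simp_all add: yconst_one yconst_mult)

lemma of_nat_yconst: "of_nat n = yconst (of_nat n :: 'k :: comm_ring_1)"
  by (simp add: yconst_def)

lemma prod_yconst: "(\<Prod>i\<in>I. yconst (f i)) = yconst (\<Prod>i\<in>I. f i :: 'k :: comm_ring_1)"
  by (induction I rule: infinite_finite_induct) (simp_all add: yconst_one yconst_mult)

lemma prod_yvar:
  fixes \<sigma> :: "'n :: finite \<Rightarrow> 'n" and t :: "'n \<Rightarrow> 'k :: comm_ring_1"
  shows "(\<Prod>i\<in>UNIV. Poly_Mapping.single (Poly_Mapping.single (\<sigma> i) 1) (t i) ^ n i) =
    yconst (\<Prod>i\<in>UNIV. t i ^ n i) * (\<Prod>i\<in>UNIV. yvar (\<sigma> i) ^ n i)"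
  unfolding single_eq_yconst_yvar power_mult_distrib prod.distrib yconst_power
  by (simp add: prod_yconst)

context danielewski_data
begin

text \<open>The term \<open>z\<^bsup>d - 1\<^esup>\<close> is absent from \<open>P\<close>, so the two top coefficients after the substitution come from
  the power \<open>(u z + \<beta>)\<^bsup>d\<^esup>\<close> alone.\<close>

lemma coeff_substituted:
  fixes Y :: "'n \<Rightarrow> ('n, 'k) ypoly" and \<beta> :: "('n, 'k) ypoly" and u :: 'k
  defines "Q \<equiv> eval_yz (\<lambda>a. [:yconst a:]) (\<lambda>i. [:Y i:]) [:\<beta>, yconst u:] P"
  shows "coeff Q d = yconst (u ^ d)" and "coeff Q (d - 1) = yconst (of_nat d * u ^ (d - 1)) * \<beta>"
proof -
  let ?L = "[:\<beta>, yconst u:]"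
  let ?t = "\<lambda>n. smult (eval_y yconst Y (coeff P n)) (?L ^ n)"
  have Q: "Q = (\<Sum>n\<le>d. ?t n)"
    unfolding Q_def by (subst const_yz.eval_yz_coeffs[of _ d]) (simp_all add: deg_P eval_y_const_yz)
  have small: "coeff (?t n) m = 0" if "n < m" for n m
  proof -
    have "degree (?L ^ n) \<le> n"
      using degree_power_le[of ?L n] by (simp split: if_splits)
    then have "coeff (?L ^ n) m = 0" using that by (intro coeff_eq_0) simp
    then show ?thesis by simp
  qed
  have td: "?t d = ?L ^ d" by (simp add: lead_P const_y.eval_y_one)
  have "coeff Q d = (\<Sum>n<d. coeff (?t n) d) + coeff (?t d) d"
    unfolding Q by (simp add: coeff_sum flip: lessThan_Suc_atMost)
  also have "(\<Sum>n<d. coeff (?t n) d) = 0" by (rule sum.neutral) (use small in auto)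
  finally show "coeff Q d = yconst (u ^ d)"
    unfolding td by (simp add: coeff_linear_power_top yconst_power)
  obtain m where m: "d = Suc m" using d by (cases d) auto
  have tm: "?t m = 0" using sub_P by (simp add: m)
  have "coeff Q m = (\<Sum>n<m. coeff (?t n) m) + coeff (?t m) m + coeff (?t (Suc m)) m"
    unfolding Q m by (simp add: coeff_sum flip: lessThan_Suc_atMost)
  also have "(\<Sum>n<m. coeff (?t n) m) = 0" by (rule sum.neutral) (use small in auto)
  finally have "coeff Q m = coeff (?L ^ Suc m) m"
    unfolding tm td[unfolded m] by (simp only: coeff_0 add_0)
  then show "coeff Q (d - 1) = yconst (of_nat d * u ^ (d - 1)) * \<beta>"
    by (simp only: m diff_Suc_1 coeff_linear_power_top(2) of_nat_yconst yconst_power yconst_mult)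
qed

end

context coordinate_automorphism
begin

text \<open>Comparing coefficients of \<open>z\<^bsup>d\<^esup>\<close>, the product of the powers of the images of the \<open>y\<^sub>i\<close> divides
  \<open>u\<^bsup>d\<^esup> y\<^bsup>k\<^esup>\<close>, and a divisor of a single term is a single term.\<close>

lemma phi_y_monomial:
  "\<exists>e t. \<forall>i. \<phi> (lmon (Some i)) = lau_y (Poly_Mapping.single (e i) (t i)) \<and> t i \<noteq> 0"
proof -
  obtain Y \<beta> u \<gamma> r where Y: "\<And>i. \<phi> (lmon (Some i)) = lau_y (Y i)" and "u \<noteq> 0" "degree r < d"
    and eq: "smult (\<Prod>i\<in>UNIV. Y i ^ k i) (smult \<gamma> P + smult (ymonomial k) r) =
      smult (ymonomial k) (eval_yz (\<lambda>a. [:yconst a:]) (\<lambda>i. [:Y i:]) [:\<beta>, yconst u:] P)"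
    by (rule automorphism_equations) blast
  have prod: "(\<Prod>i\<in>UNIV. Y i ^ k i) * \<gamma> = ymonomial k * yconst (u ^ d)"
    using arg_cong[OF eq, of "\<lambda>p. coeff p d"] \<open>degree r < d\<close>
    by (simp add: lead_P coeff_eq_0 coeff_substituted)
  define e0 where "e0 = (\<Sum>i\<in>UNIV. Poly_Mapping.map ((*) (k i)) (Poly_Mapping.single i 1))"
  have "ymonomial k = (Poly_Mapping.single e0 1 :: ('a, 'b) ypoly)"
    unfolding ymonomial_def yvar_def prod_single_power e0_def by simp
  then have mon: "ymonomial k * yconst (u ^ d) = Poly_Mapping.single e0 (u ^ d)"
    by (simp add: yconst_def mult_single)
  have "\<exists>a c. Y i = Poly_Mapping.single a c \<and> c \<noteq> 0" for i
  proof (rule mult_eq_single_imp_single)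
    have "Y i ^ k i = Y i * Y i ^ (k i - 1)" using k[of i] by (cases "k i") auto
    then have "(\<Prod>i\<in>UNIV. Y i ^ k i) = Y i * Y i ^ (k i - 1) * (\<Prod>j\<in>UNIV - {i}. Y j ^ k j)"
      by (simp add: prod.remove[of UNIV i])
    then show "Y i * (Y i ^ (k i - 1) * (\<Prod>j\<in>UNIV - {i}. Y j ^ k j) * \<gamma>) = Poly_Mapping.single e0 (u ^ d)"
      using prod mon by (simp add: mult.assoc)
    show "u ^ d \<noteq> 0" using \<open>u \<noteq> 0\<close> by simp
  qed
  then obtain e t where "\<And>i. Y i = Poly_Mapping.single (e i) (t i) \<and> t i \<noteq> 0" by metis
  then show ?thesis using Y by auto
qed

text \<open>The inverse also sends each \<open>y\<^sub>j\<close> to a monomial, so \<open>y\<^sub>j\<close> is a product of the monomials \<open>\<phi>(y\<^sub>i)\<close>; by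
  \<open>unit_row\<close> it is one of them up to a scalar.\<close>

lemma phi_y_permutes:
  obtains \<sigma> t where "bij \<sigma>" "\<And>i. t i \<noteq> 0"
    "\<And>i. \<phi> (lmon (Some i)) = lau_y (Poly_Mapping.single (Poly_Mapping.single (\<sigma> i) 1) (t i))"
proof -
  obtain e t where e: "\<And>i. \<phi> (lmon (Some i)) = lau_y (Poly_Mapping.single (e i) (t i))" and t: "\<And>i. t i \<noteq> 0"
    using phi_y_monomial by blast
  obtain e' t' where e': "\<And>i. \<psi> (lmon (Some i)) = lau_y (Poly_Mapping.single (e' i) (t' i))" and t': "\<And>i. t' i \<noteq> 0"
    using coordinate_automorphism.phi_y_monomial[OF inverse] by blast
  have phi_lau: "\<phi> (lau_y q) = lau_y (eval_y yconst (\<lambda>i. Poly_Mapping.single (e i) (t i)) q)" for q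
    using phi_lau_yz[of "[:q:]"] by (simp add: laurent.eval_yz_const e laurent.eval_y_compose)
  have "\<exists>i. \<forall>l. Poly_Mapping.lookup (e i) l = (if l = j then 1 else 0)" for j
  proof (rule unit_row)
    fix l
    have "lau_y (yvar j) = \<phi> (\<psi> (lmon (Some j)))" by (simp add: phi_psi laurent.eval_y_yvar)
    also have "\<dots> = lau_y (eval_y yconst (\<lambda>i. Poly_Mapping.single (e i) (t i)) (Poly_Mapping.single (e' j) (t' j)))"
      unfolding e' phi_lau ..
    finally have "yvar j = yconst (t' j) *
        (\<Prod>i\<in>UNIV. Poly_Mapping.single (e i) (t i) ^ Poly_Mapping.lookup (e' j) i)"
      unfolding lau_y_eq_iff const_y.eval_y_single .
    then have "Poly_Mapping.single j 1 = (\<Sum>i\<in>UNIV. Poly_Mapping.map ((*) (Poly_Mapping.lookup (e' j) i)) (e i))"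
      unfolding prod_single_power yconst_def yvar_def mult_single by (simp add: single_eq_single_iff)
    then have "Poly_Mapping.lookup (Poly_Mapping.single j 1) l =
        (\<Sum>i\<in>UNIV. Poly_Mapping.lookup (e' j) i * Poly_Mapping.lookup (e i) l)"
      by (auto simp: lookup_sum map.rep_eq when_def intro!: sum.cong)
    then show "(\<Sum>i\<in>UNIV. Poly_Mapping.lookup (e' j) i * Poly_Mapping.lookup (e i) l) = (if l = j then 1 else 0)"
      unfolding lookup_single when_def by (metis (full_types))
  qed
  note row = this
  have "\<exists>i. e i = Poly_Mapping.single j 1" for j
  proof -
    obtain i where "\<forall>l. Poly_Mapping.lookup (e i) l = (if l = j then 1 else 0)" using row by blast
    then have "e i = Poly_Mapping.single j 1"
      by (intro poly_mapping_eqI) (simp add: lookup_single when_def)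
    then show ?thesis ..
  qed
  then obtain \<rho> where \<rho>: "\<And>j. e (\<rho> j) = Poly_Mapping.single j 1" by metis
  have "inj \<rho>"
    by (rule injI) (metis \<rho> lookup_single_eq lookup_single_not_eq one_neq_zero)
  then have bij: "bij \<rho>" by (simp add: bij_def finite_UNIV_inj_surj)
  then have "e i = Poly_Mapping.single (inv_into UNIV \<rho> i) 1" for i
    using \<rho>[of "inv_into UNIV \<rho> i"] by (simp add: bij_is_surj surj_f_inv_f)
  then show thesis using that[of "inv_into UNIV \<rho>" t] bij_imp_bij_inv[OF bij] t e by simp
qed

text \<open>In the equation between the coefficients of \<open>z\<^bsup>d\<^esup>\<close> both \<open>y\<^bsup>k\<^esup>\<close> and its permuted version have the same
  total degree, so the factor \<open>\<gamma>\<close> is constant and the permutation fixes \<open>y\<^bsup>k\<^esup>\<close>. Then the coefficients of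
  \<open>z\<^bsup>d - 1\<^esup>\<close> give, up to nonzero scalars, \<open>y\<^bsup>k\<^esup> r\<^sub>d\<^sub>-\<^sub>1\<close> on one side and \<open>\<beta>\<close> on the other. Finally, replacing
  \<open>u z + \<beta>\<close> by \<open>u z\<close> changes the substituted \<open>P\<close> by a multiple of \<open>\<beta>\<close>, hence of \<open>y\<^bsup>k\<^esup>\<close>.\<close>

theorem automorphism_form:
  obtains \<sigma> t u \<beta> c r where
    "\<sigma> \<in> monomial_stabilizer TYPE('b) k" "\<And>i. t i \<noteq> 0" "u \<noteq> 0" "c \<noteq> 0"
    "\<And>i. \<phi> (lmon (Some i)) = lau_y (yconst (t i) * yvar (\<sigma> i))"
    "\<phi> (lmon None) = lau_yz [:ymonomial k * \<beta>, yconst u:]"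
    "act_poly (\<sigma>, t, u) P = smult (yconst c) P + smult (ymonomial k) r"
proof -
  obtain \<sigma> t where \<sigma>: "bij \<sigma>" and t: "\<And>i. t i \<noteq> 0"
    and phi_y: "\<And>i. \<phi> (lmon (Some i)) = lau_y (Poly_Mapping.single (Poly_Mapping.single (\<sigma> i) 1) (t i))"
    by (rule phi_y_permutes) blast
  obtain Y \<beta> u \<gamma> r where Y: "\<And>i. \<phi> (lmon (Some i)) = lau_y (Y i)"
    and phi_z: "\<phi> (lmon None) = lau_yz [:\<beta>, yconst u:]" and u: "u \<noteq> 0" and r: "degree r < d"
    and eq: "smult (\<Prod>i\<in>UNIV. Y i ^ k i) (smult \<gamma> P + smult (ymonomial k) r) =
      smult (ymonomial k) (eval_yz (\<lambda>a. [:yconst a:]) (\<lambda>i. [:Y i:]) [:\<beta>, yconst u:] P)"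
    by (rule automorphism_equations) blast
  define \<tau> where "\<tau> = (\<Prod>i\<in>UNIV. t i ^ k i)"
  have \<tau>: "\<tau> \<noteq> 0" using t by (simp add: \<tau>_def)
  have Y_eq: "Y i = Poly_Mapping.single (Poly_Mapping.single (\<sigma> i) 1) (t i)" for i
    using Y[of i] phi_y[of i] lau_y_eq_iff by metis
  \<comment> \<open>The exponent of the permuted monomial.\<close>
  define ex where "ex \<rho> = (\<Sum>i\<in>UNIV. Poly_Mapping.map ((*) (k i)) (Poly_Mapping.single (\<rho> i) 1))" for \<rho> :: "'a \<Rightarrow> 'a"
  have mon: "(\<Prod>i\<in>UNIV. yvar (\<rho> i) ^ k i) = (Poly_Mapping.single (ex \<rho>) 1 :: ('a, 'b) ypoly)" for \<rho>
    unfolding yvar_def prod_single_power ex_def by simp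
  have size_ex: "(\<Sum>l\<in>UNIV. Poly_Mapping.lookup (ex \<rho>) l) = (\<Sum>i\<in>UNIV. k i)" for \<rho>
  proof -
    have "Poly_Mapping.lookup (ex \<rho>) l = (\<Sum>i\<in>UNIV. if l = \<rho> i then k i else 0)" for l
      unfolding ex_def lookup_sum by (intro sum.cong) (auto simp: map.rep_eq lookup_single when_def)
    then show ?thesis by (simp add: sum.swap[of _ UNIV UNIV])
  qed
  have W: "(\<Prod>i\<in>UNIV. Y i ^ k i) = yconst \<tau> * (\<Prod>i\<in>UNIV. yvar (\<sigma> i) ^ k i)"
    unfolding Y_eq prod_yvar \<tau>_def ..
  have W': "(\<Prod>i\<in>UNIV. Y i ^ k i) = Poly_Mapping.single (ex \<sigma>) \<tau>"
    unfolding W mon by (simp add: yconst_def mult_single)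
  have ym: "ymonomial k = (Poly_Mapping.single (ex id) 1 :: ('a, 'b) ypoly)"
    using mon[of id] by (simp add: ymonomial_def)
  have "(\<Prod>i\<in>UNIV. Y i ^ k i) * \<gamma> = ymonomial k * yconst (u ^ d)"
    using arg_cong[OF eq, of "\<lambda>p. coeff p d"] r
    by (simp add: lead_P coeff_eq_0 coeff_substituted)
  then have prod: "\<gamma> * Poly_Mapping.single (ex \<sigma>) \<tau> = Poly_Mapping.single (ex id) (u ^ d)"
    unfolding W' unfolding ym by (simp add: yconst_def mult_single mult.commute)
  then obtain a c where \<gamma>: "\<gamma> = Poly_Mapping.single a c" "c \<noteq> 0"
    using mult_eq_single_imp_single u by (metis power_not_zero)
  have ex: "a + ex \<sigma> = ex id"
    using prod u unfolding \<gamma> by (simp add: mult_single single_eq_single_iff)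
  then have "(\<Sum>l\<in>UNIV. Poly_Mapping.lookup a l) + (\<Sum>l\<in>UNIV. Poly_Mapping.lookup (ex \<sigma>) l) =
      (\<Sum>l\<in>UNIV. Poly_Mapping.lookup (ex id) l)"
    by (metis (no_types, lifting) lookup_add sum.distrib sum.cong)
  then have "(\<Sum>l\<in>UNIV. Poly_Mapping.lookup a l) = 0" unfolding size_ex by simp
  then have "a = 0" by (intro poly_mapping_eqI) simp
  have stab: "\<sigma> \<in> monomial_stabilizer TYPE('b) k"
    unfolding monomial_stabilizer_def using \<sigma> ex \<open>a = 0\<close> by (simp add: mon ym)
  have \<gamma>c: "\<gamma> = yconst c" using \<gamma> \<open>a = 0\<close> by (simp add: yconst_def)
  have W'': "(\<Prod>i\<in>UNIV. Y i ^ k i) = yconst \<tau> * ymonomial k"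
    using W' ex \<open>a = 0\<close> by (simp add: ym yconst_def mult_single)
  let ?Q = "eval_yz (\<lambda>a. [:yconst a:]) (\<lambda>i. [:Y i:]) [:\<beta>, yconst u:] P"
  have ym_nz: "ymonomial k \<noteq> (0 :: ('a, 'b) ypoly)" unfolding ym by simp
  have "smult (ymonomial k) (smult (yconst \<tau>) (smult \<gamma> P + smult (ymonomial k) r)) = smult (ymonomial k) ?Q"
    using eq unfolding W'' by (simp add: mult.commute)
  then have Q: "?Q = smult (yconst (\<tau> * c)) P + smult (ymonomial k) (smult (yconst \<tau>) r)"
    using ym_nz by (simp add: \<gamma>c smult_add_right yconst_mult mult.commute smult_cancel)
  define v where "v = of_nat d * u ^ (d - 1)"
  have v: "v \<noteq> 0" using d u by (simp add: v_def)
  have "yconst v * \<beta> = ymonomial k * (yconst \<tau> * coeff r (d - 1))"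
    using arg_cong[OF Q, of "\<lambda>p. coeff p (d - 1)"] sub_P
    by (simp add: coeff_substituted(2)[unfolded One_nat_def] v_def mult.assoc)
  then have "yconst (inverse v) * (yconst v * \<beta>) = ymonomial k * (yconst (inverse v) * (yconst \<tau> * coeff r (d - 1)))"
    by (simp add: mult.left_commute)
  moreover have "yconst (inverse v) * (yconst v * \<beta>) = \<beta>"
    using v by (simp add: yconst_one flip: mult.assoc yconst_mult)
  ultimately obtain \<beta>' where \<beta>': "\<beta> = ymonomial k * \<beta>'" by metis
  let ?h = "map_poly (eval_y (\<lambda>a. [:yconst a:]) (\<lambda>i. [:Y i:])) P"
  have act: "act_poly (\<sigma>, t, u) P = poly ?h [:0, yconst u:]"
    by (simp only: act_poly_def eval_yz_def Y_eq single_eq_yconst_yvar prod.case)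
  have "[:\<beta>:] dvd poly ?h ([:0, yconst u:] + [:\<beta>:]) - poly ?h [:0, yconst u:]"
    by (rule poly_diff_dvd)
  then have "[:\<beta>:] dvd ?Q - act_poly (\<sigma>, t, u) P"
    unfolding act by (simp add: eval_yz_def)
  then obtain r' where "?Q - act_poly (\<sigma>, t, u) P = [:\<beta>:] * r'" by (elim dvdE)
  then have "act_poly (\<sigma>, t, u) P = ?Q - [:\<beta>:] * r'" by (simp only: algebra_simps)
  then have act_eq: "act_poly (\<sigma>, t, u) P =
      smult (yconst (\<tau> * c)) P + smult (ymonomial k) (smult (yconst \<tau>) r - smult \<beta>' r')"
    unfolding Q by (simp add: smult_diff_right \<beta>')
  have "\<tau> * c \<noteq> 0" using \<tau> \<gamma>(2) by simp
  then show thesis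
    using stab t u phi_y[unfolded single_eq_yconst_yvar] phi_z[unfolded \<beta>'] act_eq by (intro that)
qed

end

section \<open>Polynomial functions on the variety\<close>

text \<open>Dedekind's independence of characters, for the monomials as characters of the torus: translating
  by a point at which two of them differ and subtracting removes one term from a linear relation.\<close>

lemma monomials_independent:
  fixes a :: "('n :: finite \<Rightarrow>\<^sub>0 nat) \<Rightarrow> 'k :: field_char_0"
  assumes "finite S" "\<And>b. (\<And>i. b i \<noteq> 0) \<Longrightarrow> (\<Sum>e\<in>S. a e * (\<Prod>i\<in>UNIV. b i ^ Poly_Mapping.lookup e i)) = 0"
  shows "e \<in> S \<Longrightarrow> a e = 0"
  using assms
proof (induction S arbitrary: a e rule: finite_induct)
  case (insert e0 S)
  define \<chi> where "\<chi> e b = (\<Prod>i\<in>UNIV. b i ^ Poly_Mapping.lookup e i)" for e and b :: "'n \<Rightarrow> 'k"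
  have vanish: "a e0 * \<chi> e0 b + (\<Sum>e\<in>S. a e * \<chi> e b) = 0" if "\<And>i. b i \<noteq> 0" for b
    using insert.prems(2)[OF that] insert.hyps by (simp add: \<chi>_def)
  have S: "a e = 0" if e: "e \<in> S" for e
  proof -
    have "e \<noteq> e0" using e insert.hyps by auto
    then obtain j where j: "Poly_Mapping.lookup e j \<noteq> Poly_Mapping.lookup e0 j"
      by (meson poly_mapping_eqI)
    define c :: "'n \<Rightarrow> 'k" where "c i = (if i = j then 2 else 1)" for i
    have \<chi>_c: "\<chi> f c = 2 ^ Poly_Mapping.lookup f j" for f
    proof -
      have "\<chi> f c = (\<Prod>i\<in>UNIV. if i = j then 2 ^ Poly_Mapping.lookup f j else 1)"
        unfolding \<chi>_def by (intro prod.cong) (auto simp: c_def)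
      then show ?thesis by simp
    qed
    have "a e * (\<chi> e c - \<chi> e0 c) = 0"
    proof (rule insert.IH[OF e])
      fix b :: "'n \<Rightarrow> 'k" assume b: "\<And>i. b i \<noteq> 0"
      have mult: "\<chi> f (\<lambda>i. c i * b i) = \<chi> f c * \<chi> f b" for f
        by (simp add: \<chi>_def power_mult_distrib prod.distrib)
      have "a e0 * (\<chi> e0 c * \<chi> e0 b) + (\<Sum>e\<in>S. a e * (\<chi> e c * \<chi> e b)) = 0"
      proof -
        have "c i * b i \<noteq> 0" for i using b[of i] by (simp add: c_def)
        from vanish[of "\<lambda>i. c i * b i", OF this] show ?thesis by (simp only: mult)
      qed
      moreover have "a e0 * (\<chi> e0 c * \<chi> e0 b) + (\<Sum>e\<in>S. a e * (\<chi> e0 c * \<chi> e b)) = 0"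
        using arg_cong[OF vanish[of b, OF b], of "(*) (\<chi> e0 c)"]
        by (simp add: distrib_left sum_distrib_left mult_ac)
      ultimately have "(\<Sum>e\<in>S. a e * (\<chi> e c * \<chi> e b)) - (\<Sum>e\<in>S. a e * (\<chi> e0 c * \<chi> e b)) = 0"
        by (simp only: add_eq_0_iff diff_self)
      then show "(\<Sum>e\<in>S. a e * (\<chi> e c - \<chi> e0 c) * (\<Prod>i\<in>UNIV. b i ^ Poly_Mapping.lookup e i)) = 0"
        by (simp add: \<chi>_def[symmetric] sum_subtractf[symmetric] algebra_simps)
    qed
    moreover have "(of_nat (2 ^ Poly_Mapping.lookup e j) :: 'k) \<noteq> of_nat (2 ^ Poly_Mapping.lookup e0 j)"
      unfolding of_nat_eq_iff using j by simp
    ultimately show ?thesis by (simp add: \<chi>_c)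
  qed
  have "a e0 = 0" using vanish[of "\<lambda>_. 1"] S by (simp add: \<chi>_def)
  then show ?case using S insert.prems(1) by auto
qed simp

lemma yzpoly_zero_on_torus:
  fixes p :: "('n :: finite, 'k :: field_char_0) yzpoly"
  assumes "\<And>b w. (\<And>i. b i \<noteq> 0) \<Longrightarrow> eval_yz id b w p = 0"
  shows "p = 0"
proof (rule poly_eqI)
  fix n
  have "eval_y id b (coeff p n) = 0" if "\<And>i. b i \<noteq> 0" for b
  proof -
    have "poly (map_poly (eval_y id b) p) w = 0" for w
      using assms[OF that] by (simp add: eval_yz_def)
    then have "map_poly (eval_y id b) p = 0" by (simp add: poly_all_0_iff_0[symmetric])
    then show ?thesis by (metis coeff_map_poly coeff_0 point.eval_y_zero)
  qed
  then have vanish: "(\<Sum>e\<in>Poly_Mapping.keys (coeff p n). Poly_Mapping.lookup (coeff p n) e *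
      (\<Prod>i\<in>UNIV. b i ^ Poly_Mapping.lookup e i)) = 0" if "\<And>i. b i \<noteq> 0" for b
    using that by (simp add: eval_y_def)
  have "Poly_Mapping.lookup (coeff p n) e = 0" if "e \<in> Poly_Mapping.keys (coeff p n)" for e
    by (rule monomials_independent[where a = "Poly_Mapping.lookup (coeff p n)", OF finite_keys vanish that])
  then show "coeff p n = coeff 0 n"
    by (intro poly_mapping_eqI) (metis coeff_0 in_keys_iff lookup_zero)
qed

lemma eval_point_simps:
  "eval_point (F + G) p = eval_point F p + eval_point G p"
  "eval_point (F - G) p = eval_point F p - eval_point G p"
  "eval_point (F * G) p = eval_point F p * eval_point G p"
  "eval_point (F ^ n) p = eval_point F p ^ n"
  "eval_point [:q:] p = eval_yz id (fst (snd p)) (snd (snd p)) q"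
  "eval_point [:0, 1:] p = fst p"
  by (cases p; simp add: eval_point_def point.eval_xyz_add point.eval_xyz_diff point.eval_xyz_mult
      point.eval_xyz_pow point.eval_xyz_const point.eval_xyz_x)+

definition poly_map ::
  "('n :: finite, 'k :: comm_ring_1) xyzpoly \<Rightarrow> ('n \<Rightarrow> ('n, 'k) xyzpoly) \<Rightarrow> ('n, 'k) xyzpoly \<Rightarrow>
     ('n, 'k) point \<Rightarrow> ('n, 'k) point" where
  "poly_map A B C p = (eval_point A p, \<lambda>i. eval_point (B i) p, eval_point C p)"

definition pullback ::
  "('n :: finite, 'k :: comm_ring_1) xyzpoly \<Rightarrow> ('n \<Rightarrow> ('n, 'k) xyzpoly) \<Rightarrow> ('n, 'k) xyzpoly \<Rightarrow>
     ('n, 'k) xyzpoly \<Rightarrow> ('n, 'k) xyzpoly" where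
  "pullback A B C = eval_xyz (\<lambda>a. [:[:yconst a:]:]) A B C"

lemma eval_pullback: "eval_point (pullback A B C F) p = eval_point F (poly_map A B C p)"
  by (cases p) (simp add: eval_point_def pullback_def poly_map_def point.eval_xyz_compose[unfolded id_def] id_def)

lemma regular_map_iff:
  "regular_map V f \<longleftrightarrow> (\<exists>A B C. \<forall>p\<in>V. f p = poly_map A B C p)"
  by (simp add: regular_map_def poly_map_def)

lemma poly_map_compose:
  "poly_map A B C (poly_map A' B' C' p) =
     poly_map (pullback A' B' C' A) (\<lambda>i. pullback A' B' C' (B i)) (pullback A' B' C' C) p"
  by (simp add: poly_map_def[of _ _ _ p] poly_map_def[of A B C] eval_pullback)

lemma regular_map_compose:
  assumes "regular_map V f" "regular_map V g" "\<And>p. p \<in> V \<Longrightarrow> g p \<in> V"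
  shows "regular_map V (\<lambda>p. f (g p))"
proof -
  obtain A B C where f: "\<And>p. p \<in> V \<Longrightarrow> f p = poly_map A B C p"
    using assms(1) unfolding regular_map_iff by blast
  obtain A' B' C' where g: "\<And>p. p \<in> V \<Longrightarrow> g p = poly_map A' B' C' p"
    using assms(2) unfolding regular_map_iff by blast
  have "f (g p) = poly_map (pullback A' B' C' A) (\<lambda>i. pullback A' B' C' (B i)) (pullback A' B' C' C) p"
    if "p \<in> V" for p
    using f[OF assms(3)[OF that]] g[OF that] by (simp add: poly_map_compose)
  then show ?thesis unfolding regular_map_iff by blast
qed

lemma regular_map_cong: "(\<And>p. p \<in> V \<Longrightarrow> f p = g p) \<Longrightarrow> regular_map V f \<Longrightarrow> regular_map V g"
  unfolding regular_map_def by metis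

lemma poly_map_id: "poly_map [:0, 1:] (\<lambda>i. [:[:yvar i:]:]) [:[:0, 1:]:] p = p"
  by (simp add: poly_map_def eval_point_simps point.eval_yz_const point.eval_y_yvar point.eval_yz_z)

lemma regular_map_id: "regular_map V (\<lambda>p. p)"
  unfolding regular_map_iff using poly_map_id by metis

text \<open>Any regular left inverse witnesses that the inverse of a regular bijection is regular.\<close>

lemma Aut_variety_mem_iff:
  "f \<in> carrier (Aut_variety V) \<longleftrightarrow>
     f \<in> Bij V \<and> regular_map V f \<and> (\<exists>h. regular_map V h \<and> (\<forall>p\<in>V. h (f p) = p))"
proof -
  have "regular_map V (inv_into V f)"
    if f: "f \<in> Bij V" and h: "regular_map V h" "\<And>p. p \<in> V \<Longrightarrow> h (f p) = p" for h
  proof (rule regular_map_cong[OF _ h(1)])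
    fix p assume "p \<in> V"
    then have "inv_into V f p \<in> V" "f (inv_into V f p) = p"
      using f by (auto simp: Bij_def bij_betw_def intro: inv_into_into f_inv_into_f)
    then show "h p = inv_into V f p" using h(2) by metis
  qed
  moreover have "inv_into V f (f p) = p" if "f \<in> Bij V" "p \<in> V" for p
    using that by (auto simp: Bij_def bij_betw_def)
  ultimately show ?thesis unfolding Aut_variety_def by auto
qed

lemma mult_Aut_variety:
  "f \<in> Bij V \<Longrightarrow> g \<in> Bij V \<Longrightarrow> mult (Aut_variety V) f g = compose V f g"
  by (simp add: Aut_variety_def BijGroup_def)

lemma Bij_closed: "f \<in> Bij V \<Longrightarrow> p \<in> V \<Longrightarrow> f p \<in> V"
  using Bij_imp_funcset by blast

lemma group_Aut_variety: "group (Aut_variety V)"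
proof -
  let ?H = "carrier (Aut_variety V)"
  have "subgroup ?H (BijGroup V)"
  proof (rule group.subgroupI[OF group_BijGroup])
    show "?H \<subseteq> carrier (BijGroup V)" by (auto simp: Aut_variety_mem_iff BijGroup_def)
    have "(\<lambda>p\<in>V. p) \<in> ?H"
      unfolding Aut_variety_mem_iff
      by (auto intro!: id_Bij regular_map_cong[OF _ regular_map_id] exI[of _ "\<lambda>p. p"] regular_map_id)
    then show "?H \<noteq> {}" by blast
    show "inv\<^bsub>BijGroup V\<^esub> f \<in> ?H" if f: "f \<in> ?H" for f
    proof -
      have bij: "f \<in> Bij V" using f by (simp add: Aut_variety_mem_iff)
      have "regular_map V (inv_into V f)" "regular_map V f" using f by (auto simp: Aut_variety_def)
      moreover have "f (inv_into V f p) = p" if "p \<in> V" for p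
        using bij that by (auto simp: Bij_def bij_betw_def intro: f_inv_into_f)
      ultimately have "(\<lambda>p\<in>V. inv_into V f p) \<in> ?H"
        unfolding Aut_variety_mem_iff
        by (auto intro!: restrict_inv_into_Bij bij exI[of _ f] elim: regular_map_cong[rotated])
      then show ?thesis by (simp add: inv_BijGroup[OF bij])
    qed
    show "f \<otimes>\<^bsub>BijGroup V\<^esub> g \<in> ?H" if fg: "f \<in> ?H" "g \<in> ?H" for f g
    proof -
      obtain h h' where f: "f \<in> Bij V" "regular_map V f" "regular_map V h" "\<And>p. p \<in> V \<Longrightarrow> h (f p) = p"
        and g: "g \<in> Bij V" "regular_map V g" "regular_map V h'" "\<And>p. p \<in> V \<Longrightarrow> h' (g p) = p"
        using fg unfolding Aut_variety_mem_iff by blast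
      have h_closed: "h p \<in> V" if "p \<in> V" for p
      proof -
        have "p \<in> f ` V" using f(1) that by (simp add: Bij_def bij_betw_def)
        then show ?thesis using f(4) by auto
      qed
      have "regular_map V (\<lambda>p. f (g p))" 
        by (rule regular_map_compose[OF f(2) g(2) Bij_closed[OF g(1)]])
      then have "regular_map V (compose V f g)" by (rule regular_map_cong[rotated]) (simp add: compose_eq)
      moreover have "regular_map V (\<lambda>p. h' (h p))" 
        by (rule regular_map_compose[OF g(3) f(3) h_closed])
      moreover have "h' (h (compose V f g p)) = p" if "p \<in> V" for p
        using that f g Bij_closed[OF g(1)] by (simp add: compose_eq)
      ultimately have "compose V f g \<in> ?H"
        unfolding Aut_variety_mem_iff using compose_Bij[OF f(1) g(1)] by blast
      then show ?thesis using f(1) g(1) by (simp add: BijGroup_def)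
    qed
  qed
  then have "group ((BijGroup V)\<lparr>carrier := ?H\<rparr>)"
    by (rule group.subgroup_imp_group[OF group_BijGroup])
  then show ?thesis by (simp add: Aut_variety_def)
qed

context danielewski_data
begin

abbreviation "X \<equiv> danielewski k P"

text \<open>Here \<open>x\<close> is determined by the other coordinates. By \<open>vanish_dvd\<close> this part is dense, so identities
  between polynomial maps only need to be checked on it.\<close>

definition torus_part :: "('n, 'k) point set" where
  "torus_part = {p \<in> X. \<forall>i. fst (snd p) i \<noteq> 0}"

lemma X_iff: "(a, b, w) \<in> X \<longleftrightarrow> a * (\<Prod>i\<in>UNIV. b i ^ k i) = eval_yz id b w P"
  by (simp add: danielewski_def)

lemma eval_E: "eval_point E p = 0 \<longleftrightarrow> p \<in> X"
  by (cases p) (simp add: eval_point_def point.eval_danielewski_eq X_iff)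

lemma torus_part_subset: "torus_part \<subseteq> X" by (auto simp: torus_part_def)

lemma torus_part_iff: "(a, b, w) \<in> torus_part \<longleftrightarrow>
    (\<forall>i. b i \<noteq> 0) \<and> a = eval_yz id b w P / (\<Prod>i\<in>UNIV. b i ^ k i)"
  by (auto simp: torus_part_def X_iff field_simps)

lemma dvd_vanish: "E dvd F \<Longrightarrow> p \<in> X \<Longrightarrow> eval_point F p = 0"
  by (auto simp: dvd_def eval_point_simps eval_E)

text \<open>A polynomial outside the ideal of the variety becomes, after clearing denominators, a nonzero
  polynomial in \<open>y\<close> and \<open>z\<close>, and these coordinates are arbitrary on the torus part.\<close>

lemma vanish_dvd:
  assumes "\<And>p. p \<in> torus_part \<Longrightarrow> eval_point F p = 0"
  shows "E dvd F"
proof (rule ccontr)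
  assume "\<not> E dvd F"
  then obtain M p where p: "p \<noteq> 0" "E dvd [:[:ymonomial k:]:] ^ M * F - [:p:]"
    by (rule clear_denominator)
  have "p = 0"
  proof (rule yzpoly_zero_on_torus)
    fix b :: "'n \<Rightarrow> 'k" and w assume b: "\<And>i. b i \<noteq> 0"
    define q where "q = (eval_yz id b w P / (\<Prod>i\<in>UNIV. b i ^ k i), b, w)"
    have q: "q \<in> torus_part" using b by (simp add: q_def torus_part_iff)
    then have "eval_point ([:[:ymonomial k:]:] ^ M * F - [:p:]) q = 0"
      using dvd_vanish[OF p(2)] torus_part_subset by blast
    then show "eval_yz id b w p = 0"
      using assms[OF q] by (simp add: eval_point_simps q_def)
  qed
  then show False using p(1) by contradiction
qed

lemma lau_eq_iff: "lau F = lau G \<longleftrightarrow> (\<forall>p\<in>X. eval_point F p = eval_point G p)"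
proof
  assume "lau F = lau G"
  then have "E dvd F - G" using lau_eq_0_iff[of "F - G"] by (simp add: lau_simps)
  then show "\<forall>p\<in>X. eval_point F p = eval_point G p"
    using dvd_vanish[of "F - G"] by (simp add: eval_point_simps)
next
  assume "\<forall>p\<in>X. eval_point F p = eval_point G p"
  then have "E dvd F - G" using torus_part_subset by (intro vanish_dvd) (auto simp: eval_point_simps)
  then show "lau F = lau G" by (rule lau_dvd)
qed

lemma eval_point_eqI:
  assumes "\<And>p. p \<in> torus_part \<Longrightarrow> eval_point F p = eval_point G p" "p \<in> X"
  shows "eval_point F p = eval_point G p"
  using dvd_vanish[OF vanish_dvd assms(2), of "F - G"] assms(1) by (simp add: eval_point_simps)

lemma poly_map_eqI:
  assumes "\<And>p. p \<in> torus_part \<Longrightarrow> poly_map A B C p = poly_map A' B' C' p" "p \<in> X"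
  shows "poly_map A B C p = poly_map A' B' C' p"
proof -
  have *: "eval_point A p = eval_point A' p" "eval_point (B i) p = eval_point (B' i) p"
    "eval_point C p = eval_point C' p" if "p \<in> torus_part" for p i
    using assms(1)[OF that] by (auto simp: poly_map_def dest: fun_cong)
  show ?thesis
    unfolding poly_map_def
    using eval_point_eqI[OF *(1) assms(2)] eval_point_eqI[OF *(2) assms(2)] eval_point_eqI[OF *(3) assms(2)]
    by simp
qed

lemma poly_map_closed:
  assumes "\<And>p. p \<in> torus_part \<Longrightarrow> poly_map A B C p \<in> X" "p \<in> X"
  shows "poly_map A B C p \<in> X"
proof -
  have "eval_point (pullback A B C E) p = 0"
    by (rule dvd_vanish[OF vanish_dvd assms(2)]) (use assms(1) in \<open>simp add: eval_pullback eval_E\<close>)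
  then show ?thesis by (simp add: eval_pullback eval_E)
qed

text \<open>Two polynomial maps that preserve the torus part need to be inverse to each other only there, and
  only in the coordinates \<open>y\<close> and \<open>z\<close>; the rest follows by density.\<close>

lemma generic_automorphism:
  assumes f: "\<And>p. p \<in> torus_part \<Longrightarrow> poly_map A B C p \<in> torus_part"
    and f': "\<And>p. p \<in> torus_part \<Longrightarrow> poly_map A' B' C' p \<in> torus_part"
    and inv: "\<And>p. p \<in> torus_part \<Longrightarrow> snd (poly_map A' B' C' (poly_map A B C p)) = snd p"
      "\<And>p. p \<in> torus_part \<Longrightarrow> snd (poly_map A B C (poly_map A' B' C' p)) = snd p"
  shows "restrict (poly_map A B C) X \<in> carrier (Aut_variety X)"
proof -
  let ?f = "poly_map A B C" and ?f' = "poly_map A' B' C'"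
  have closed: "?f p \<in> X" "?f' p \<in> X" if "p \<in> X" for p
    using poly_map_closed[OF subsetD[OF torus_part_subset f] that]
      poly_map_closed[OF subsetD[OF torus_part_subset f'] that] by blast+
  have snd_eq: "p = q" if "snd p = snd q" "p \<in> torus_part" "q \<in> torus_part" for p q
    using that by (cases p; cases q) (simp add: torus_part_iff)
  have "?f' (?f p) = poly_map [:0, 1:] (\<lambda>i. [:[:yvar i:]:]) [:[:0, 1:]:] p" if "p \<in> X" for p
    unfolding poly_map_compose
    by (rule poly_map_eqI[OF _ that]) (simp add: poly_map_id poly_map_compose[symmetric] snd_eq inv f f')
  then have 1: "?f' (?f p) = p" if "p \<in> X" for p using that by (simp add: poly_map_id)
  have "?f (?f' p) = poly_map [:0, 1:] (\<lambda>i. [:[:yvar i:]:]) [:[:0, 1:]:] p" if "p \<in> X" for p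
    unfolding poly_map_compose
    by (rule poly_map_eqI[OF _ that]) (simp add: poly_map_id poly_map_compose[symmetric] snd_eq inv f f')
  then have 2: "?f (?f' p) = p" if "p \<in> X" for p using that by (simp add: poly_map_id)
  have "bij_betw ?f X X" by (rule bij_betwI[of _ _ _ ?f']) (auto simp: 1 2 closed)
  then have "restrict ?f X \<in> Bij X" by (simp add: Bij_def bij_betw_restrict_eq)
  moreover have "regular_map X ?f'" "regular_map X (restrict ?f X)"
    unfolding regular_map_iff by auto
  ultimately show ?thesis unfolding Aut_variety_mem_iff using 1 by auto
qed

end

context danielewski_data
begin

text \<open>The geometric form of \<open>automorphism_form\<close>: pulling back polynomials along \<open>f\<close> and its inverse
  gives an automorphism of the coordinate ring, because polynomials with the same Laurent expansion are
  those with the same values on the variety.\<close>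

lemma automorphism_on_points:
  assumes f: "f \<in> carrier (Aut_variety X)"
  obtains \<sigma> t u \<beta> c r where
    "\<sigma> \<in> monomial_stabilizer TYPE('k) k" "\<And>i. t i \<noteq> 0" "u \<noteq> 0" "c \<noteq> 0"
    "act_poly (\<sigma>, t, u) P = smult (yconst c) P + smult (ymonomial k) r"
    "\<And>a b w. (a, b, w) \<in> X \<Longrightarrow>
       snd (f (a, b, w)) = (\<lambda>i. t i * b (\<sigma> i), (\<Prod>i\<in>UNIV. b i ^ k i) * eval_y id b \<beta> + u * w)"
proof -
  obtain h where Bij: "f \<in> Bij X" and "regular_map X f" "regular_map X h" and hf: "\<And>p. p \<in> X \<Longrightarrow> h (f p) = p"
    using f unfolding Aut_variety_mem_iff by blast
  then obtain A B C A' B' C' where f_eq: "\<And>p. p \<in> X \<Longrightarrow> f p = poly_map A B C p"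
    and h_eq: "\<And>p. p \<in> X \<Longrightarrow> h p = poly_map A' B' C' p"
    unfolding regular_map_iff by blast
  have f_X: "f p \<in> X" if "p \<in> X" for p using Bij_closed[OF Bij that] .
  have ex: "\<exists>q\<in>X. p = f q" if "p \<in> X" for p
  proof -
    have "p \<in> f ` X" using Bij that by (simp add: Bij_def bij_betw_def)
    then show ?thesis by blast
  qed
  have h_X: "h p \<in> X" and fh: "f (h p) = p" if "p \<in> X" for p
    using ex[OF that] hf by auto
  have comp1: "poly_map A B C p \<in> X" "poly_map A' B' C' (poly_map A B C p) = p" if "p \<in> X" for p
    using f_X[OF that] hf[OF that] h_eq[OF f_X[OF that]] f_eq[OF that] by simp_all
  have comp2: "poly_map A' B' C' p \<in> X" "poly_map A B C (poly_map A' B' C' p) = p" if "p \<in> X" for p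
    using h_X[OF that] fh[OF that] f_eq[OF h_X[OF that]] h_eq[OF that] by simp_all
  \<comment> \<open>Any polynomial \<open>F\<close> representing \<open>v\<close> gives the same value.\<close>
  define \<phi> where "\<phi> v = lau (pullback A B C (SOME F. lau F = v))" for v
  define \<psi> where "\<psi> v = lau (pullback A' B' C' (SOME F. lau F = v))" for v
  have some: "lau (SOME F. lau F = lau G) = lau G" for G
    by (rule someI) simp
  have \<phi>: "\<phi> (lau F) = lau (pullback A B C F)" for F
    using some[of F] comp1(1) unfolding \<phi>_def lau_eq_iff eval_pullback by blast
  have \<psi>: "\<psi> (lau F) = lau (pullback A' B' C' F)" for F
    using some[of F] comp2(1) unfolding \<psi>_def lau_eq_iff eval_pullback by blast
  have \<psi>\<phi>: "\<psi> (\<phi> (lau F)) = lau F" and \<phi>\<psi>: "\<phi> (\<psi> (lau F)) = lau F" for F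
    using comp1 comp2 unfolding \<phi> \<psi> lau_eq_iff eval_pullback by auto
  have const: "Poly_Mapping.single 0 c = lau [:[:yconst c:]:]" for c
    by (simp add: lau_simps laurent.eval_yz_const laurent.eval_y_yconst)
  have "coordinate_automorphism k d P \<phi> \<psi>"
  proof unfold_locales
    show "\<phi> (Poly_Mapping.single 0 c) = Poly_Mapping.single 0 c"
      "\<psi> (Poly_Mapping.single 0 c) = Poly_Mapping.single 0 c" for c
      unfolding const \<phi> \<psi>
      by (simp_all add: pullback_def const_xyz.eval_xyz_const const_xyz.eval_yz_const const_xyz.eval_y_yconst)
    fix v assume "v \<in> range lau"
    then obtain F where F: "v = lau F" by blast
    show "\<phi> v \<in> range lau" "\<psi> v \<in> range lau" "\<psi> (\<phi> v) = v" "\<phi> (\<psi> v) = v"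
      unfolding F using \<psi>\<phi> \<phi>\<psi> by (simp_all add: \<phi> \<psi>)
    fix w assume "w \<in> range lau"
    then obtain G where G: "w = lau G" by blast
    show "\<phi> (v + w) = \<phi> v + \<phi> w" "\<psi> (v + w) = \<psi> v + \<psi> w"
      unfolding F G lau_simps(1)[symmetric] \<phi> \<psi> by (simp_all add: pullback_def const_xyz.eval_xyz_add)
    show "\<phi> (v * w) = \<phi> v * \<phi> w" "\<psi> (v * w) = \<psi> v * \<psi> w"
      unfolding F G lau_simps(2)[symmetric] \<phi> \<psi> by (simp_all add: pullback_def const_xyz.eval_xyz_mult)
  qed
  then obtain \<sigma> t u \<beta> c r where form: "\<sigma> \<in> monomial_stabilizer TYPE('k) k" "\<And>i. t i \<noteq> 0" "u \<noteq> 0" "c \<noteq> 0"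
    "\<And>i. \<phi> (lmon (Some i)) = lau_y (yconst (t i) * yvar (\<sigma> i))"
    "\<phi> (lmon None) = lau_yz [:ymonomial k * \<beta>, yconst u:]"
    "act_poly (\<sigma>, t, u) P = smult (yconst c) P + smult (ymonomial k) r"
    by (rule coordinate_automorphism.automorphism_form) blast
  have "lau (B i) = lau [:[:yconst (t i) * yvar (\<sigma> i):]:]" for i
  proof -
    have "pullback A B C [:[:yvar i:]:] = B i"
      by (simp add: pullback_def const_xyz.eval_xyz_const const_xyz.eval_yz_const const_xyz.eval_y_yvar)
    then have "lau (B i) = \<phi> (lau [:[:yvar i:]:])" by (simp only: \<phi>)
    also have "lau [:[:yvar i:]:] = lmon (Some i)"
      by (simp add: lau_simps laurent.eval_yz_const laurent.eval_y_yvar)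
    also have "\<phi> (lmon (Some i)) = lau [:[:yconst (t i) * yvar (\<sigma> i):]:]"
      unfolding form(5) by (simp add: lau_simps laurent.eval_yz_const)
    finally show ?thesis .
  qed
  then have B: "eval_point (B i) (a, b, w) = t i * b (\<sigma> i)" if "(a, b, w) \<in> X" for i a b w
    using that unfolding lau_eq_iff
    by (simp add: eval_point_simps point.eval_yz_const point.eval_y_mult point.eval_y_yconst point.eval_y_yvar)
  have "lau C = lau [:[:ymonomial k * \<beta>, yconst u:]:]"
  proof -
    have "pullback A B C [:[:0, 1:]:] = C"
      by (simp add: pullback_def const_xyz.eval_xyz_const const_xyz.eval_yz_z)
    then have "lau C = \<phi> (lau [:[:0, 1:]:])" by (simp only: \<phi>)
    also have "lau [:[:0, 1:]:] = lmon None"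
      by (simp add: lau_simps laurent.eval_yz_z)
    also have "\<phi> (lmon None) = lau [:[:ymonomial k * \<beta>, yconst u:]:]"
      unfolding form(6) by (simp add: lau_simps)
    finally show ?thesis .
  qed
  then have C: "eval_point C (a, b, w) = (\<Prod>i\<in>UNIV. b i ^ k i) * eval_y id b \<beta> + u * w" if "(a, b, w) \<in> X" for a b w
    using that unfolding lau_eq_iff
    by (simp add: eval_point_simps point.eval_yz_pCons point.eval_y_mult point.eval_y_yconst
        point.eval_y_ymonomial mult.commute)
  have "snd (f (a, b, w)) = (\<lambda>i. t i * b (\<sigma> i), (\<Prod>i\<in>UNIV. b i ^ k i) * eval_y id b \<beta> + u * w)"
    if "(a, b, w) \<in> X" for a b w
    using that by (simp add: f_eq poly_map_def B C)
  then show thesis using form(1-4) form(7) by (intro that)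
qed

end

section \<open>The canonical group acts on the variety\<close>

global_interpretation frac: structure_map
  "\<lambda>a. to_fract [:yconst a:] :: ('n :: {finite, linorder}, 'k :: field) yzfrac"
  by standard (simp_all add: yconst_add yconst_mult yconst_one mult.commute flip: to_fract_add to_fract_mult one_pCons)

lemma to_fract_power: "to_fract (p ^ n) = to_fract p ^ n"
  by (induction n) simp_all

lemma eval_yz_to_fract:
  "eval_yz (\<lambda>a. to_fract [:yconst a:]) (\<lambda>i. to_fract [:yvar i:]) (to_fract [:0, 1:]) p = to_fract p"
  for p :: "('n :: {finite, linorder}, 'k :: field) yzpoly"
  by (rule yzpoly_hom_eqI)
     (simp_all add: frac.eval_yz_add frac.eval_yz_mult frac.eval_yz_const frac.eval_y_yconst
        frac.eval_y_yvar frac.eval_yz_z)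

lemma act_poly_one: "act_poly g 1 = 1"
  using act_poly_const[of g 1] by (simp add: yconst_one one_pCons)

lemma eval_yz_generators:
  "eval_yz (\<lambda>a. [:yconst a:]) (\<lambda>i. [:yvar i:]) [:0, 1:] p = p"
  by (rule yzpoly_hom_eqI)
     (simp_all add: const_yz.eval_yz_add const_yz.eval_yz_mult const_yz.eval_yz_const
        const_yz.eval_y_yconst const_yz.eval_y_yvar const_yz.eval_yz_z)

lemma act_poly_surj:
  fixes p :: "('n :: finite, 'k :: field) yzpoly"
  assumes "bij \<sigma>" "\<And>i. t i \<noteq> 0" "u \<noteq> 0"
  shows "p \<in> range (act_poly (\<sigma>, t, u))"
proof -
  let ?R = "range (act_poly (\<sigma>, t, u)) :: ('n, 'k) yzpoly set"
  have const: "[:yconst a:] \<in> ?R" for a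
    using act_poly_const[of "(\<sigma>, t, u)" a] by (metis rangeI)
  have add: "v + w \<in> ?R" if "v \<in> ?R" "w \<in> ?R" for v w
    using that by (auto simp flip: act_poly_add)
  have mult: "v * w \<in> ?R" if "v \<in> ?R" "w \<in> ?R" for v w
    using that by (auto simp flip: act_poly_mult)
  have y: "[:yvar i:] \<in> ?R" for i
  proof -
    define j where "j = inv_into UNIV \<sigma> i"
    have j: "\<sigma> j = i" using assms(1) by (simp add: j_def bij_is_surj surj_f_inv_f)
    have "[:yconst (inverse (t j)):] * [:yconst (t j) * yvar (\<sigma> j):] \<in> ?R"
      by (rule mult[OF const]) (metis act_poly_y rangeI)
    also have "[:yconst (inverse (t j)):] * [:yconst (t j) * yvar (\<sigma> j):] = [:yvar i:]"
    proof -
      have "yconst (inverse (t j)) * yconst (t j) = (1 :: ('n, 'k) ypoly)"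
        using assms(2)[of j] by (simp add: yconst_one flip: yconst_mult)
      then have "yconst (inverse (t j)) * (yconst (t j) * yvar (\<sigma> j)) = (yvar i :: ('n, 'k) ypoly)"
        by (simp only: mult.assoc[symmetric] mult_1_left j)
      then show ?thesis by (simp only: yzpoly_const_prod)
    qed
    finally show ?thesis .
  qed
  have z: "[:0, 1:] \<in> ?R"
  proof -
    have "[:yconst (inverse u):] * [:0, yconst u:] \<in> ?R"
      by (rule mult[OF const]) (metis act_poly_z rangeI)
    also have "[:yconst (inverse u):] * [:0, yconst u:] = [:0, 1:]"
      using assms(3) by (simp add: yconst_one mult.commute flip: yconst_mult)
    finally show ?thesis .
  qed
  have "eval_yz (\<lambda>a. [:yconst a:]) (\<lambda>i. [:yvar i:]) [:0, 1:] p \<in> ?R"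
    by (rule const_yz.eval_yz_induct) (fact const y z add mult)+
  then show ?thesis unfolding eval_yz_generators .
qed

lemma act_to_fract: "g \<in> carrier (big_group k) \<Longrightarrow> act g (to_fract p) = to_fract (act_poly g p)"
  unfolding to_fract_def by (simp add: act_Fract act_poly_one)

lemma big_group_nz:
  assumes "g \<in> carrier (big_group k)"
  shows "act_poly g r = 0 \<longleftrightarrow> r = 0"
  using assms by (cases g) (auto simp: big_group_def monomial_stabilizer_def act_poly_eq_0_iff)

lemma act_add: "g \<in> carrier (big_group k) \<Longrightarrow> act g (r + s) = act g r + act g s"
  by (cases r; cases s) (simp add: act_Fract big_group_nz act_poly_add act_poly_mult)

lemma act_mult: "g \<in> carrier (big_group k) \<Longrightarrow> act g (r * s) = act g r * act g s"
  by (cases r; cases s) (simp add: act_Fract big_group_nz act_poly_mult)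

lemma point_act_poly:
  "eval_yz id b w (act_poly (\<sigma>, t, u) p) = eval_yz id (\<lambda>i. t i * b (\<sigma> i)) (u * w) p"
  by (simp add: act_poly_def point.eval_yz_compose point.eval_yz_pCons point.eval_y_mult
      point.eval_y_yconst point.eval_y_yvar mult.commute)

lemma stabilizer_prod:
  assumes "\<sigma> \<in> monomial_stabilizer TYPE('k :: field) k"
  shows "(\<Prod>i\<in>UNIV. b (\<sigma> i) ^ k i) = (\<Prod>i\<in>UNIV. b i ^ k i :: 'k)"
proof -
  have "eval_y id b (\<Prod>i\<in>UNIV. yvar (\<sigma> i) ^ k i) = eval_y id b (ymonomial k)"
    using assms by (simp add: monomial_stabilizer_def)
  then show ?thesis
    by (simp add: point.eval_y_prod point.eval_y_pow point.eval_y_yvar point.eval_y_ymonomial)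
qed

lemma act_poly_ymonomial:
  fixes k :: "'n :: finite \<Rightarrow> nat" and u :: "'k :: field"
  assumes "\<sigma> \<in> monomial_stabilizer TYPE('k) k"
  shows "act_poly (\<sigma>, t, u) [:ymonomial k:] = [:yconst (\<Prod>i\<in>UNIV. t i ^ k i) * ymonomial k:]"
proof -
  have "act_poly (\<sigma>, t, u) [:ymonomial k:] = [:\<Prod>i\<in>UNIV. (yconst (t i) * yvar (\<sigma> i)) ^ k i:]"
    by (simp add: act_poly_def const_yz.eval_yz_const eval_y_const_yz const_y.eval_y_ymonomial)
  also have "(\<Prod>i\<in>UNIV. (yconst (t i) * yvar (\<sigma> i)) ^ k i) =
      yconst (\<Prod>i\<in>UNIV. t i ^ k i) * (\<Prod>i\<in>UNIV. yvar (\<sigma> i) ^ k i)"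
    by (simp add: power_mult_distrib prod.distrib yconst_power prod_yconst)
  also have "(\<Prod>i\<in>UNIV. yvar (\<sigma> i) ^ k i) = (ymonomial k :: ('n, 'k) ypoly)"
    using assms by (simp add: monomial_stabilizer_def)
  finally show ?thesis .
qed

context danielewski_data
begin

text \<open>The images of \<open>x\<close> and of an arbitrary polynomial under the embedding \<open>\<phi>\<close> of the coordinate ring into
  the rational functions.\<close>

definition frac_x :: "('n, 'k) yzfrac" where
  "frac_x = to_fract P / to_fract [:ymonomial k:]"

definition frac_val :: "('n, 'k) xyzpoly \<Rightarrow> ('n, 'k) yzfrac" where
  "frac_val = eval_xyz (\<lambda>a. to_fract [:yconst a:]) frac_x (\<lambda>i. to_fract [:yvar i:]) (to_fract [:0, 1:])"

lemma phi_image_eq: "phi_image k P = range frac_val"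
  by (simp add: phi_image_def frac_val_def frac_x_def)

lemma ymonomial_nz: "ymonomial k \<noteq> (0 :: ('n, 'k) ypoly)"
  using ym_nz lau_ymonomial by (metis lau_y_eq_0_iff)

lemma frac_x_times: "frac_x * to_fract [:ymonomial k:] = to_fract P"
  using ymonomial_nz by (simp add: frac_x_def)

lemma frac_val_const: "frac_val [:p:] = to_fract p"
  by (simp add: frac_val_def frac.eval_xyz_const eval_yz_to_fract)

lemma frac_val_x: "frac_val [:0, 1:] = frac_x"
  by (simp add: frac_val_def frac.eval_xyz_x)

lemma frac_val_add: "frac_val (F + G) = frac_val F + frac_val G"
  by (simp add: frac_val_def frac.eval_xyz_add)

lemma frac_val_mult: "frac_val (F * G) = frac_val F * frac_val G"
  by (simp add: frac_val_def frac.eval_xyz_mult)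

lemma frac_val_pow: "frac_val (F ^ n) = frac_val F ^ n"
  by (simp add: frac_val_def frac.eval_xyz_pow)

lemma frac_val_diff: "frac_val (F - G) = frac_val F - frac_val G"
  by (simp add: frac_val_def frac.eval_xyz_diff)

lemma frac_val_E: "frac_val E = 0"
proof -
  have "frac_val E = frac_val [:[:ymonomial k:]:] * frac_val [:0, 1:] - frac_val [:P:]"
    unfolding danielewski_eq_alt frac_val_diff frac_val_mult ..
  then show ?thesis
    by (simp only: frac_val_const frac_val_x) (simp add: frac_x_times mult.commute)
qed

lemma phi_image_poly: "to_fract p \<in> phi_image k P"
  unfolding phi_image_eq using frac_val_const by (metis rangeI)

lemma phi_image_x: "frac_x \<in> phi_image k P"
  unfolding phi_image_eq using frac_val_x by (metis rangeI)

lemma phi_image_add: "v \<in> phi_image k P \<Longrightarrow> w \<in> phi_image k P \<Longrightarrow> v + w \<in> phi_image k P"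
  unfolding phi_image_eq by (auto simp flip: frac_val_add)

lemma phi_image_mult: "v \<in> phi_image k P \<Longrightarrow> w \<in> phi_image k P \<Longrightarrow> v * w \<in> phi_image k P"
  unfolding phi_image_eq by (auto simp flip: frac_val_mult)

lemma phi_image_induct:
  assumes v: "v \<in> phi_image k P" and poly: "\<And>p. Q (to_fract p)" and x: "Q frac_x"
    and add: "\<And>u v. Q u \<Longrightarrow> Q v \<Longrightarrow> Q (u + v)" and mult: "\<And>u v. Q u \<Longrightarrow> Q v \<Longrightarrow> Q (u * v)"
  shows "Q v"
proof -
  obtain F where "v = frac_val F" using v unfolding phi_image_eq by blast
  moreover have "Q (frac_val F)"
    unfolding frac_val_def by (rule frac.eval_xyz_induct) (fact poly x add mult)+
  ultimately show ?thesis by simp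
qed

text \<open>The condition on \<open>P\<close> says that the group element sends \<open>x = P / y\<^bsup>k\<^esup>\<close> to \<open>(c / \<tau>) x + r / \<tau>\<close>, where \<open>\<tau> y\<^bsup>k\<^esup>\<close> is the
  image of \<open>y\<^bsup>k\<^esup>\<close>. So the generators go to the coordinate ring, and solving for \<open>x\<close> shows that they are
  images as well.\<close>

lemma canonical_group_mem:
  assumes \<sigma>: "\<sigma> \<in> monomial_stabilizer TYPE('k) k" and t: "\<And>i. t i \<noteq> 0" and u: "u \<noteq> 0" and c: "c \<noteq> 0"
    and act: "act_poly (\<sigma>, t, u) P = smult (yconst c) P + smult (ymonomial k) r"
  shows "(\<sigma>, t, u) \<in> carrier (canonical_group k P)"
proof -
  let ?g = "(\<sigma>, t, u)" and ?Y = "to_fract [:ymonomial k:] :: ('n, 'k) yzfrac"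
  define \<tau> where "\<tau> = (\<Prod>i\<in>UNIV. t i ^ k i)"
  have \<tau>: "\<tau> \<noteq> 0" using t by (simp add: \<tau>_def)
  have g: "?g \<in> carrier (big_group k)" using \<sigma> t u by (simp add: big_group_def)
  define T :: "'k \<Rightarrow> ('n, 'k) yzfrac" where "T a = to_fract [:yconst a:]" for a
  have T_mult: "T a * T b = T (a * b)" and T_1: "T 1 = 1" for a b
    unfolding T_def by (simp_all add: yconst_mult yconst_one mult.commute flip: to_fract_mult one_pCons)
  have T_nz: "T \<tau> \<noteq> 0" "?Y \<noteq> 0"
    using \<tau> ymonomial_nz by (simp_all add: T_def yconst_def)
  have "act ?g frac_x * (T \<tau> * ?Y) = act ?g (frac_x * ?Y)"
    unfolding act_mult[OF g] act_to_fract[OF g] act_poly_ymonomial[OF \<sigma>] T_def \<tau>_def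
    by (simp add: mult.commute flip: to_fract_mult)
  also have "\<dots> = to_fract ([:yconst c:] * P + [:ymonomial k:] * r)"
    unfolding frac_x_times act_to_fract[OF g] act by simp
  also have "\<dots> = T c * (frac_x * ?Y) + ?Y * to_fract r"
    unfolding frac_x_times to_fract_add to_fract_mult T_def ..
  also have "\<dots> = (T (c / \<tau>) * frac_x + T (1 / \<tau>) * to_fract r) * (T \<tau> * ?Y)"
  proof -
    have "T c = T (c / \<tau>) * T \<tau>" "T (1 / \<tau>) * T \<tau> = 1" using \<tau> by (simp_all add: T_mult T_1)
    then show ?thesis by (simp add: algebra_simps)
  qed
  finally have act_x: "act ?g frac_x = T (c / \<tau>) * frac_x + T (1 / \<tau>) * to_fract r"
    using T_nz by simp
  have "act ?g v \<in> phi_image k P" if "v \<in> phi_image k P" for v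
  proof (rule phi_image_induct[where Q = "\<lambda>v. act ?g v \<in> phi_image k P", OF that])
    show "act ?g (to_fract p) \<in> phi_image k P" for p
      by (simp add: act_to_fract[OF g] phi_image_poly)
    show "act ?g frac_x \<in> phi_image k P"
      unfolding act_x T_def by (intro phi_image_add phi_image_mult phi_image_poly phi_image_x)
  qed (simp_all add: act_add[OF g] act_mult[OF g] phi_image_add phi_image_mult)
  moreover have "v \<in> act ?g ` phi_image k P" if "v \<in> phi_image k P" for v
  proof (rule phi_image_induct[where Q = "\<lambda>v. v \<in> act ?g ` phi_image k P", OF that])
    show poly: "to_fract p \<in> act ?g ` phi_image k P" for p
    proof -
      have "p \<in> range (act_poly ?g)" using \<sigma> t u by (intro act_poly_surj) (auto simp: monomial_stabilizer_def)
      then obtain p' where "p = act_poly ?g p'" by blast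
      then have "to_fract p = act ?g (to_fract p')" by (simp add: act_to_fract[OF g])
      then show ?thesis using phi_image_poly by blast
    qed
    show add: "v + w \<in> act ?g ` phi_image k P"
      if "v \<in> act ?g ` phi_image k P" "w \<in> act ?g ` phi_image k P" for v w
      using that by (auto simp: act_add[OF g, symmetric] phi_image_add)
    show mult: "v * w \<in> act ?g ` phi_image k P"
      if "v \<in> act ?g ` phi_image k P" "w \<in> act ?g ` phi_image k P" for v w
      using that by (auto simp: act_mult[OF g, symmetric] phi_image_mult)
    have "T (\<tau> / c) * act ?g frac_x + T (- (1 / c)) * to_fract r =
        T (\<tau> / c) * T (c / \<tau>) * frac_x + (T (\<tau> / c) * T (1 / \<tau>) + T (- (1 / c))) * to_fract r"
      unfolding act_x by (simp add: algebra_simps)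
    also have "T (\<tau> / c) * T (c / \<tau>) = 1" using \<tau> c by (simp add: T_mult T_1)
    also have "T (\<tau> / c) * T (1 / \<tau>) + T (- (1 / c)) = 0"
      using \<tau> c unfolding T_mult by (simp add: T_def yconst_def single_uminus flip: to_fract_add single_add)
    finally have "frac_x = T (\<tau> / c) * act ?g frac_x + T (- (1 / c)) * to_fract r" by simp
    also have "\<dots> \<in> act ?g ` phi_image k P"
      unfolding T_def by (intro add mult poly imageI phi_image_x)
    finally show "frac_x \<in> act ?g ` phi_image k P" .
  qed
  ultimately show ?thesis using g by (auto simp: canonical_group_def)
qed

lemma clear_denominator_any:
  obtains M p where "E dvd [:[:ymonomial k:]:] ^ M * F - [:p:]"
proof (cases "E dvd F")
  case True
  then show thesis using that[of 0 0] by simp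
next
  case False
  then show thesis using that by (rule clear_denominator)
qed

lemma frac_val_dvd: "E dvd F - G \<Longrightarrow> frac_val F = frac_val G"
proof -
  assume "E dvd F - G"
  then have "frac_val (F - G) = 0" by (auto simp: dvd_def frac_val_mult frac_val_E)
  then show ?thesis by (simp add: frac_val_diff)
qed

lemma eval_point_cleared:
  assumes "E dvd [:[:ymonomial k:]:] ^ M * F - [:p:]" "(a, b, w) \<in> X"
  shows "(\<Prod>i\<in>UNIV. b i ^ k i) ^ M * eval_point F (a, b, w) = eval_yz id b w p"
  using dvd_vanish[OF assms]
  by (simp add: eval_point_simps point.eval_yz_const point.eval_y_ymonomial)

text \<open>The \<open>x\<close>-coordinate of the automorphism is given by a polynomial \<open>F\<close> that represents the image of \<open>x\<close>, and
  that of its inverse by a polynomial \<open>F'\<close> whose image is \<open>x\<close>; both exist since the group element maps the coordinate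
  ring onto itself. Their values on the torus part are found by clearing denominators and comparing
  polynomials in \<open>y\<close> and \<open>z\<close>.\<close>

lemma canonical_automorphism:
  assumes "(\<sigma>, t, u) \<in> carrier (canonical_group k P)"
  obtains f where "f \<in> carrier (Aut_variety X)"
    "\<And>a b w. (a, b, w) \<in> X \<Longrightarrow> snd (f (a, b, w)) = (\<lambda>i. t i * b (\<sigma> i), u * w)"
proof -
  let ?g = "(\<sigma>, t, u)"
  have g: "?g \<in> carrier (big_group k)" and stable: "act ?g ` phi_image k P = phi_image k P"
    using assms by (auto simp: canonical_group_def)
  have \<sigma>: "\<sigma> \<in> monomial_stabilizer TYPE('k) k" and t: "\<And>i. t i \<noteq> 0" and u: "u \<noteq> 0"
    using g by (auto simp: big_group_def)
  have bij: "bij \<sigma>" using \<sigma> by (simp add: monomial_stabilizer_def)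
  define \<sigma>' where "\<sigma>' = inv_into UNIV \<sigma>"
  have \<sigma>': "\<sigma> (\<sigma>' i) = i" "\<sigma>' (\<sigma> i) = i" for i
    using bij by (simp_all add: \<sigma>'_def bij_is_surj surj_f_inv_f bij_is_inj)
  define b' where "b' b i = t i * b (\<sigma> i)" for b i
  have b': "b' b i \<noteq> 0" if "\<And>i. b i \<noteq> 0" for b i using that t by (simp add: b'_def)
  have "act ?g frac_x \<in> phi_image k P" using stable phi_image_x by blast
  then obtain F where F: "act ?g frac_x = frac_val F" unfolding phi_image_eq by blast
  have "frac_x \<in> act ?g ` phi_image k P" using stable phi_image_x by simp
  then obtain F' where F': "frac_x = act ?g (frac_val F')" unfolding phi_image_eq by blast
  have F_val: "eval_point F (a, b, w) * (\<Prod>i\<in>UNIV. b' b i ^ k i) = eval_yz id (b' b) (u * w) P"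
    if "(a, b, w) \<in> torus_part" for a b w
  proof -
    have p: "(a, b, w) \<in> X" "\<And>i. b i \<noteq> 0" using that by (auto simp: torus_part_def)
    obtain M p where M: "E dvd [:[:ymonomial k:]:] ^ M * F - [:p:]" by (rule clear_denominator_any)
    have 1: "to_fract [:ymonomial k:] ^ M * act ?g frac_x = to_fract p"
      using frac_val_dvd[OF M] unfolding F frac_val_mult frac_val_pow frac_val_const .
    have "act ?g frac_x * to_fract (act_poly ?g [:ymonomial k:]) = to_fract (act_poly ?g P)"
      unfolding act_to_fract[OF g, symmetric] act_mult[OF g, symmetric] frac_x_times ..
    then have "to_fract [:ymonomial k:] ^ M * to_fract (act_poly ?g P) =
        to_fract [:ymonomial k:] ^ M * act ?g frac_x * to_fract (act_poly ?g [:ymonomial k:])"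
      by (simp only: mult.assoc)
    then have "to_fract ([:ymonomial k:] ^ M * act_poly ?g P) = to_fract (p * act_poly ?g [:ymonomial k:])"
      unfolding 1 to_fract_mult to_fract_power .
    then have "[:ymonomial k:] ^ M * act_poly ?g P = p * act_poly ?g [:ymonomial k:]"
      unfolding to_fract_eq_iff .
    then have "eval_yz id b w ([:ymonomial k:] ^ M * act_poly ?g P) = eval_yz id b w (p * act_poly ?g [:ymonomial k:])"
      by (simp only:)
    then have "(\<Prod>i\<in>UNIV. b i ^ k i) ^ M * eval_yz id (b' b) (u * w) P =
        eval_yz id b w p * (\<Prod>i\<in>UNIV. b' b i ^ k i)"
      by (simp add: point.eval_yz_mult point.eval_yz_pow point_act_poly point.eval_yz_const
          point.eval_y_ymonomial b'_def[abs_def])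
    also have "eval_yz id b w p = (\<Prod>i\<in>UNIV. b i ^ k i) ^ M * eval_point F (a, b, w)"
      using eval_point_cleared[OF M p(1)] by simp
    finally have eq: "(\<Prod>i\<in>UNIV. b i ^ k i) ^ M * eval_yz id (b' b) (u * w) P =
        (\<Prod>i\<in>UNIV. b i ^ k i) ^ M * (eval_point F (a, b, w) * (\<Prod>i\<in>UNIV. b' b i ^ k i))"
      by (simp only: mult.assoc)
    have "(\<Prod>i\<in>UNIV. b i ^ k i) ^ M \<noteq> 0" using p(2) by simp
    from mult_left_cancel[THEN iffD1, OF this eq] show ?thesis by (rule sym)
  qed
  have F'_val: "eval_point F' (eval_point F (a, b, w), b' b, u * w) = a"
    if "(a, b, w) \<in> torus_part" for a b w
  proof -
    have p: "(a, b, w) \<in> X" "\<And>i. b i \<noteq> 0" using that by (auto simp: torus_part_def)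
    have q: "(eval_point F (a, b, w), b' b, u * w) \<in> X" using F_val[OF that] by (simp add: X_iff)
    obtain M p where M: "E dvd [:[:ymonomial k:]:] ^ M * F' - [:p:]" by (rule clear_denominator_any)
    have pow: "act ?g (v ^ n) = act ?g v ^ n" for v n
      using act_to_fract[OF g, of 1] by (induction n) (simp_all add: act_mult[OF g] act_poly_one)
    have "to_fract [:ymonomial k:] ^ M * frac_val F' = to_fract p"
      using frac_val_dvd[OF M] unfolding frac_val_mult frac_val_pow frac_val_const .
    then have "to_fract (act_poly ?g [:ymonomial k:]) ^ M * frac_x = to_fract (act_poly ?g p)"
      unfolding F' act_to_fract[OF g, symmetric] pow[symmetric] act_mult[OF g, symmetric] by (simp only:)
    then have "to_fract (act_poly ?g [:ymonomial k:]) ^ M * (frac_x * to_fract [:ymonomial k:]) =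
        to_fract (act_poly ?g p) * to_fract [:ymonomial k:]"
      by (simp only: mult.assoc[symmetric])
    then have "to_fract (act_poly ?g [:ymonomial k:] ^ M * P) = to_fract (act_poly ?g p * [:ymonomial k:])"
      unfolding frac_x_times to_fract_mult to_fract_power .
    then have "eval_yz id b w (act_poly ?g [:ymonomial k:] ^ M * P) = eval_yz id b w (act_poly ?g p * [:ymonomial k:])"
      unfolding to_fract_eq_iff by (simp only:)
    then have "(\<Prod>i\<in>UNIV. b' b i ^ k i) ^ M * eval_yz id b w P =
        eval_yz id (b' b) (u * w) p * (\<Prod>i\<in>UNIV. b i ^ k i)"
      by (simp add: point.eval_yz_mult point.eval_yz_pow point_act_poly point.eval_yz_const
          point.eval_y_ymonomial b'_def[abs_def] point.eval_yz_smult mult.commute)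
    also have "eval_yz id b w P = a * (\<Prod>i\<in>UNIV. b i ^ k i)" using p(1) by (simp add: X_iff)
    also have "eval_yz id (b' b) (u * w) p =
        (\<Prod>i\<in>UNIV. b' b i ^ k i) ^ M * eval_point F' (eval_point F (a, b, w), b' b, u * w)"
      using eval_point_cleared[OF M q] by simp
    finally have eq: "(\<Prod>i\<in>UNIV. b' b i ^ k i) ^ M * (\<Prod>i\<in>UNIV. b i ^ k i) * a =
        (\<Prod>i\<in>UNIV. b' b i ^ k i) ^ M * (\<Prod>i\<in>UNIV. b i ^ k i) *
          eval_point F' (eval_point F (a, b, w), b' b, u * w)"
      by (simp only: ac_simps)
    have "(\<Prod>i\<in>UNIV. b' b i ^ k i) ^ M * (\<Prod>i\<in>UNIV. b i ^ k i) \<noteq> 0"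
      using p(2) b'[of b] by simp
    from mult_left_cancel[THEN iffD1, OF this eq] show ?thesis by (rule sym)
  qed
  define B where "B i = ([:[:yconst (t i) * yvar (\<sigma> i):]:] :: ('n, 'k) xyzpoly)" for i
  define C where "C = ([:[:0, yconst u:]:] :: ('n, 'k) xyzpoly)"
  define B' where "B' i = ([:[:yconst (inverse (t (\<sigma>' i))) * yvar (\<sigma>' i):]:] :: ('n, 'k) xyzpoly)" for i
  define C' where "C' = ([:[:0, yconst (inverse u):]:] :: ('n, 'k) xyzpoly)"
  have f: "poly_map F B C (a, b, w) = (eval_point F (a, b, w), b' b, u * w)" for a b w
    by (simp add: poly_map_def B_def C_def b'_def[abs_def] eval_point_simps point.eval_yz_pCons point.eval_y_mult
        point.eval_y_yconst point.eval_y_yvar fun_eq_iff mult.commute)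
  have f': "poly_map F' B' C' (a, b, w) =
      (eval_point F' (a, b, w), \<lambda>i. inverse (t (\<sigma>' i)) * b (\<sigma>' i), inverse u * w)" for a b w
    by (simp add: poly_map_def B'_def C'_def eval_point_simps point.eval_yz_pCons point.eval_y_mult
        point.eval_y_yconst point.eval_y_yvar fun_eq_iff mult.commute)
  have f_torus: "poly_map F B C p \<in> torus_part" if "p \<in> torus_part" for p
  proof (cases p)
    case (fields a b w)
    have b: "\<And>i. b i \<noteq> 0" using that by (auto simp: torus_part_def fields)
    then show ?thesis
      using F_val[of a b w] that b'[OF b] by (simp add: fields f torus_part_iff field_simps)
  qed
  have f'_f: "poly_map F' B' C' (poly_map F B C p) = p" if "p \<in> torus_part" for p
    using that t u by (cases p) (simp add: f f' F'_val b'_def[of _ "\<sigma>' _"] \<sigma>' flip: mult.assoc)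
  have preimage: "\<exists>q\<in>torus_part. poly_map F B C q = p" if "p \<in> torus_part" for p
  proof (cases p)
    case (fields a b w)
    have b: "\<And>i. b i \<noteq> 0" using that by (auto simp: torus_part_def fields)
    define b0 w0 where "b0 i = inverse (t (\<sigma>' i)) * b (\<sigma>' i)" and "w0 = inverse u * w" for i
    define q where "q = (eval_yz id b0 w0 P / (\<Prod>i\<in>UNIV. b0 i ^ k i), b0, w0)"
    have q: "q \<in> torus_part" using b t by (simp add: q_def torus_part_iff b0_def)
    have "b' b0 = b" using t by (simp add: fun_eq_iff b'_def b0_def \<sigma>' flip: mult.assoc)
    moreover have "u * w0 = w" using u by (simp add: w0_def flip: mult.assoc)
    ultimately have "poly_map F B C q = p"
      using f_torus[OF q] that by (simp add: q_def f fields torus_part_iff)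
    then show ?thesis using q by blast
  qed
  have "restrict (poly_map F B C) X \<in> carrier (Aut_variety X)"
  proof (rule generic_automorphism[where A' = F' and B' = B' and C' = C'])
    fix p assume "p \<in> torus_part"
    then show "poly_map F B C p \<in> torus_part" "snd (poly_map F' B' C' (poly_map F B C p)) = snd p"
      by (simp_all add: f_torus f'_f)
    obtain q where q: "q \<in> torus_part" "poly_map F B C q = p" using preimage \<open>p \<in> torus_part\<close> by blast
    then have "poly_map F' B' C' p = q" using f'_f by blast
    then show "poly_map F' B' C' p \<in> torus_part" "snd (poly_map F B C (poly_map F' B' C' p)) = snd p"
      using q by simp_all
  qed
  then show thesis by (rule that) (simp add: f b'_def fun_eq_iff)
qed

text \<open>Substituting \<open>z + y\<^bsup>k\<^esup> q\<close> for \<open>z\<close> changes \<open>P\<close> by a multiple of \<open>y\<^bsup>k\<^esup> q\<close>, so dividing by \<open>y\<^bsup>k\<^esup>\<close> leaves a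
  polynomial \<open>x\<close>-coordinate.\<close>

lemma shear_automorphism:
  obtains f where "f \<in> carrier (Aut_variety X)"
    "\<And>a b w. (a, b, w) \<in> X \<Longrightarrow> snd (f (a, b, w)) = (b, w + (\<Prod>i\<in>UNIV. b i ^ k i) * eval_y id b q)"
proof -
  define B where "B i = ([:[:yvar i:]:] :: ('n, 'k) xyzpoly)" for i
  define C where "C q = ([:[:ymonomial k * q, 1:]:] :: ('n, 'k) xyzpoly)" for q
  have BC: "snd (poly_map A B (C q) (a, b, w)) = (b, w + (\<Prod>i\<in>UNIV. b i ^ k i) * eval_y id b q)" for A q a b w
    by (simp add: poly_map_def B_def C_def eval_point_simps point.eval_yz_pCons point.eval_y_mult
        point.eval_y_ymonomial point.eval_y_one point.eval_y_yvar add.commute)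
  have "\<exists>A. \<forall>p\<in>torus_part. poly_map A B (C q) p \<in> torus_part" for q
  proof -
    let ?h = "map_poly (eval_y (\<lambda>a. [:yconst a:]) (\<lambda>i. [:yvar i:])) P :: ('n, 'k) yzpoly poly"
    have "[:ymonomial k * q:] dvd poly ?h ([:0, 1:] + [:ymonomial k * q:]) - poly ?h [:0, 1:]"
      by (rule poly_diff_dvd)
    then obtain R where R: "eval_yz (\<lambda>a. [:yconst a:]) (\<lambda>i. [:yvar i:]) [:ymonomial k * q, 1:] P - P = [:ymonomial k * q:] * R"
      using eval_yz_generators[of P] by (auto simp: eval_yz_def elim!: dvdE)
    define A where "A = [:0, 1:] + [:[:q:] * R:]"
    have "poly_map A B (C q) p \<in> torus_part" if "p \<in> torus_part" for p
    proof (cases p)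
      case (fields a b w)
      let ?m = "\<Prod>i\<in>UNIV. b i ^ k i"
      have p: "(a, b, w) \<in> X" "\<And>i. b i \<noteq> 0" using that by (auto simp: torus_part_def fields)
      have "eval_yz id b (w + ?m * eval_y id b q) P - eval_yz id b w P = ?m * eval_y id b q * eval_yz id b w R"
        using arg_cong[OF R, of "eval_yz id b w"]
        by (simp add: point.eval_yz_diff point.eval_yz_compose point.eval_yz_mult point.eval_yz_smult point.eval_yz_const
            point.eval_yz_pCons point.eval_y_mult point.eval_y_one point.eval_y_yvar point.eval_y_ymonomial add.commute)
      moreover have "eval_point A (a, b, w) = a + eval_y id b q * eval_yz id b w R"
        unfolding A_def eval_point_simps by (simp add: point.eval_yz_smult)
      ultimately have "(eval_point A (a, b, w), b, w + ?m * eval_y id b q) \<in> X"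
        using p(1) by (simp add: X_iff algebra_simps)
      moreover have "poly_map A B (C q) p = (eval_point A (a, b, w), b, w + ?m * eval_y id b q)"
        using BC[of A q a b w] by (simp add: fields poly_map_def)
      ultimately show ?thesis using p(2) by (simp add: torus_part_def)
    qed
    then show ?thesis by blast
  qed
  then obtain A where A: "\<And>q p. p \<in> torus_part \<Longrightarrow> poly_map (A q) B (C q) p \<in> torus_part" by metis
  have cancel: "snd (poly_map (A q') B (C q') (poly_map (A q) B (C q) p)) = snd p" if "q + q' = 0" for q q' p
  proof (cases p)
    case (fields a b w)
    obtain a' where a': "poly_map (A q) B (C q) (a, b, w) = (a', b, w + (\<Prod>i\<in>UNIV. b i ^ k i) * eval_y id b q)"
      using BC[of "A q" q a b w] by (metis prod.collapse)
    have "eval_y id b q + eval_y id b q' = 0"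
      using that by (simp flip: point.eval_y_add)
    then have "m * eval_y id b q + m * eval_y id b q' = 0" for m
      by (simp flip: distrib_left)
    then show ?thesis by (simp add: fields a' BC add.assoc)
  qed
  have "restrict (poly_map (A q) B (C q)) X \<in> carrier (Aut_variety X)"
    by (rule generic_automorphism[where A' = "A (- q)" and B' = B and C' = "C (- q)"])
       (simp_all add: A cancel)
  then show thesis by (rule that) (simp add: BC)
qed

end

section \<open>Commutativity of the automorphism group\<close>

lemma id_in_stabilizer: "id \<in> monomial_stabilizer TYPE('k :: comm_ring_1) k"
  by (simp add: monomial_stabilizer_def ymonomial_def)

lemma act_poly_id: "act_poly (id, \<lambda>_. 1, 1) p = p"
  by (rule yzpoly_hom_eqI)
     (simp_all add: act_poly_add act_poly_mult act_poly_const act_poly_y act_poly_z yconst_one)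

context danielewski_data
begin

text \<open>By \<open>automorphism_on_points\<close> and \<open>canonical_group_mem\<close> the part of an automorphism that is not a
  shear belongs to the canonical group, which is trivial here. Two shears
  commute in the coordinates \<open>y\<close> and \<open>z\<close>, hence on the torus part, hence everywhere.\<close>

lemma Aut_commutative:
  assumes trivial: "carrier (canonical_group k P) = {(id, \<lambda>_. 1, 1)}"
    and f: "f \<in> carrier (Aut_variety X)" and g: "g \<in> carrier (Aut_variety X)" and "p \<in> X"
  shows "f (g p) = g (f p)"
proof -
  have shear: "\<exists>\<beta>. \<forall>a b w. (a, b, w) \<in> X \<longrightarrow>
      snd (h (a, b, w)) = (b, (\<Prod>i\<in>UNIV. b i ^ k i) * eval_y id b \<beta> + w)"
    if h: "h \<in> carrier (Aut_variety X)" for h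
  proof -
    obtain \<sigma> t u \<beta> c r where \<sigma>: "\<sigma> \<in> monomial_stabilizer TYPE('k) k" "\<And>i. t i \<noteq> 0" "u \<noteq> 0" "c \<noteq> 0"
      "act_poly (\<sigma>, t, u) P = smult (yconst c) P + smult (ymonomial k) r"
      and snd_h: "\<And>a b w. (a, b, w) \<in> X \<Longrightarrow>
        snd (h (a, b, w)) = (\<lambda>i. t i * b (\<sigma> i), (\<Prod>i\<in>UNIV. b i ^ k i) * eval_y id b \<beta> + u * w)"
      using h by (rule automorphism_on_points) blast
    have "(\<sigma>, t, u) = (id, \<lambda>_. 1, 1)"
      using canonical_group_mem[OF \<sigma>] unfolding trivial by simp
    then show ?thesis using snd_h by auto
  qed
  have Bij: "f \<in> Bij X" "g \<in> Bij X" and reg: "regular_map X f" "regular_map X g"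
    using f g by (auto simp: Aut_variety_mem_iff)
  have closed: "f p \<in> X" "g p \<in> X" if "p \<in> X" for p
    using Bij_closed[OF Bij(1) that] Bij_closed[OF Bij(2) that] .
  have torus: "f (g p) = g (f p)" if "p \<in> torus_part" for p
  proof (cases p)
    case (fields a b w)
    have p: "(a, b, w) \<in> X" and b: "\<And>i. b i \<noteq> 0" using that by (auto simp: torus_part_def fields)
    obtain \<beta> where \<beta>: "\<And>a b w. (a, b, w) \<in> X \<Longrightarrow>
        snd (f (a, b, w)) = (b, (\<Prod>i\<in>UNIV. b i ^ k i) * eval_y id b \<beta> + w)"
      using shear[OF f] by blast
    obtain \<gamma> where \<gamma>: "\<And>a b w. (a, b, w) \<in> X \<Longrightarrow>
        snd (g (a, b, w)) = (b, (\<Prod>i\<in>UNIV. b i ^ k i) * eval_y id b \<gamma> + w)"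
      using shear[OF g] by blast
    obtain a1 where fp: "f (a, b, w) = (a1, b, (\<Prod>i\<in>UNIV. b i ^ k i) * eval_y id b \<beta> + w)"
      using \<beta>[OF p] by (metis prod.collapse)
    obtain a2 where gp: "g (a, b, w) = (a2, b, (\<Prod>i\<in>UNIV. b i ^ k i) * eval_y id b \<gamma> + w)"
      using \<gamma>[OF p] by (metis prod.collapse)
    have "snd (f (g p)) = snd (g (f p))" "fst (snd (f (g p))) = b"
      using \<beta> \<gamma> closed[OF p] unfolding fields fp gp by (simp_all add: algebra_simps)
    moreover have "f (g p) \<in> X" "g (f p) \<in> X" using p closed fields by auto
    ultimately obtain a3 a4 c where 3: "f (g p) = (a3, b, c)" "(a3, b, c) \<in> X"
      and 4: "g (f p) = (a4, b, c)" "(a4, b, c) \<in> X"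
      by (metis prod.collapse)
    have "a3 * (\<Prod>i\<in>UNIV. b i ^ k i) = a4 * (\<Prod>i\<in>UNIV. b i ^ k i)"
      using 3(2) 4(2) by (simp only: X_iff)
    moreover have "(\<Prod>i\<in>UNIV. b i ^ k i) \<noteq> 0" using b by simp
    ultimately have "a3 = a4" using mult_right_cancel by blast
    then show ?thesis by (simp only: 3 4)
  qed
  obtain A B C A' B' C' where *: "\<And>p. p \<in> X \<Longrightarrow> f p = poly_map A B C p" "\<And>p. p \<in> X \<Longrightarrow> g p = poly_map A' B' C' p"
    using reg unfolding regular_map_iff by blast
  have fg: "f (g q) = poly_map (pullback A' B' C' A) (\<lambda>i. pullback A' B' C' (B i)) (pullback A' B' C' C) q"
    and gf: "g (f q) = poly_map (pullback A B C A') (\<lambda>i. pullback A B C (B' i)) (pullback A B C C') q"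
    if "q \<in> X" for q
    using *(1)[OF closed(2)[OF that]] *(2)[OF closed(1)[OF that]] *[OF that] by (simp_all add: poly_map_compose)
  show ?thesis
    unfolding fg[OF \<open>p \<in> X\<close>] gf[OF \<open>p \<in> X\<close>]
  proof (rule poly_map_eqI[OF _ \<open>p \<in> X\<close>])
    fix q assume q: "q \<in> torus_part"
    then have "q \<in> X" using torus_part_subset by blast
    then show "poly_map (pullback A' B' C' A) (\<lambda>i. pullback A' B' C' (B i)) (pullback A' B' C' C) q =
        poly_map (pullback A B C A') (\<lambda>i. pullback A B C (B' i)) (pullback A B C C') q"
      using torus[OF q] by (simp only: fg gf)
  qed
qed

text \<open>Commuting with the shear for \<open>q\<close> amounts to \<open>u q(b) = \<tau> q(t b\<^sub>\<sigma>)\<close> on the torus, where \<open>\<tau>\<close> is the product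
  of the powers \<open>t\<^sub>i\<^bsup>k i\<^esup>\<close>. The polynomial \<open>q = 1\<close> gives \<open>u = \<tau>\<close>, and then \<open>q = y\<^sub>i\<close> gives \<open>b\<^sub>i = t\<^sub>i b\<^bsub>\<sigma> i\<^esub>\<close>.\<close>

lemma canonical_group_trivial:
  assumes comm: "\<And>f g p. f \<in> carrier (Aut_variety X) \<Longrightarrow> g \<in> carrier (Aut_variety X) \<Longrightarrow> p \<in> X \<Longrightarrow> f (g p) = g (f p)"
    and g: "(\<sigma>, t, u) \<in> carrier (canonical_group k P)"
  shows "(\<sigma>, t, u) = (id, \<lambda>_. 1, 1)"
proof -
  have \<sigma>: "\<sigma> \<in> monomial_stabilizer TYPE('k) k"
    using g by (auto simp: canonical_group_def big_group_def)
  obtain f where f: "f \<in> carrier (Aut_variety X)"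
    and snd_f: "\<And>a b w. (a, b, w) \<in> X \<Longrightarrow> snd (f (a, b, w)) = (\<lambda>i. t i * b (\<sigma> i), u * w)"
    using g by (rule canonical_automorphism) blast
  define \<tau> where "\<tau> = (\<Prod>i\<in>UNIV. t i ^ k i)"
  have key: "u * eval_y id b q = \<tau> * eval_y id (\<lambda>i. t i * b (\<sigma> i)) q" if b: "\<And>i. b i \<noteq> 0" for b q
  proof -
    let ?m = "\<Prod>i\<in>UNIV. b i ^ k i"
    obtain e where e: "e \<in> carrier (Aut_variety X)"
      and snd_e: "\<And>a b w. (a, b, w) \<in> X \<Longrightarrow> snd (e (a, b, w)) = (b, w + (\<Prod>i\<in>UNIV. b i ^ k i) * eval_y id b q)"
      by (rule shear_automorphism[of q]) blast
    define a where "a = eval_yz id b 0 P / ?m"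
    have p: "(a, b, 0) \<in> X" using b by (simp add: X_iff a_def)
    have Bij: "e \<in> Bij X" "f \<in> Bij X" using e f by (auto simp: Aut_variety_mem_iff)
    obtain a1 where ep: "e (a, b, 0) = (a1, b, ?m * eval_y id b q)"
      using snd_e[OF p] by (metis prod.collapse add_0)
    obtain a2 where fp: "f (a, b, 0) = (a2, \<lambda>i. t i * b (\<sigma> i), 0)"
      using snd_f[OF p] by (metis prod.collapse mult_zero_right)
    have "(a1, b, ?m * eval_y id b q) \<in> X" "(a2, \<lambda>i. t i * b (\<sigma> i), 0) \<in> X"
      using Bij_closed[OF Bij(1) p] Bij_closed[OF Bij(2) p] unfolding ep fp .
    from snd_f[OF this(1)] snd_e[OF this(2)]
    have "u * (?m * eval_y id b q) =
        (\<Prod>i\<in>UNIV. (t i * b (\<sigma> i)) ^ k i) * eval_y id (\<lambda>i. t i * b (\<sigma> i)) q"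
      using comm[OF f e p] by (simp add: ep fp)
    also have "(\<Prod>i\<in>UNIV. (t i * b (\<sigma> i)) ^ k i) = \<tau> * ?m"
      using stabilizer_prod[OF \<sigma>, of b] by (simp add: \<tau>_def power_mult_distrib prod.distrib)
    finally have "?m * (u * eval_y id b q) = ?m * (\<tau> * eval_y id (\<lambda>i. t i * b (\<sigma> i)) q)"
      by (simp only: ac_simps)
    moreover have "?m \<noteq> 0" using b by simp
    ultimately show ?thesis using mult_left_cancel by blast
  qed
  have u: "u = \<tau>" using key[of "\<lambda>_. 1" 1] by (simp add: point.eval_y_one)
  have "u \<noteq> 0" using g by (auto simp: canonical_group_def big_group_def)
  have y: "b i = t i * b (\<sigma> i)" if "\<And>i. b i \<noteq> 0" for b i
    using key[where b = b and q = "yvar i", OF that] \<open>u \<noteq> 0\<close> by (simp add: u point.eval_y_yvar)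
  have t: "t i = 1" for i using y[of "\<lambda>_. 1" i] by simp
  have "\<sigma> i = i" for i
  proof (rule ccontr)
    assume "\<sigma> i \<noteq> i"
    moreover have "(if j = i then 2 else 1 :: 'k) \<noteq> 0" for j by simp
    from y[of "\<lambda>j. if j = i then 2 else 1", OF this, of i]
    have "2 = (if \<sigma> i = i then 2 else 1 :: 'k)" by (simp add: t)
    ultimately show False by simp
  qed
  moreover have "u = 1" by (simp add: u \<tau>_def t)
  ultimately show ?thesis by (auto simp: t fun_eq_iff)
qed

lemma one_in_canonical_group: "(id, \<lambda>_. 1, 1) \<in> carrier (canonical_group k P)"
  by (rule canonical_group_mem[where c = 1 and r = 0])
     (simp_all add: id_in_stabilizer act_poly_id yconst_one)

theorem Aut_commutative_iff:
  "comm_group (Aut_variety X) \<longleftrightarrow> trivial_group (canonical_group k P)"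
proof
  assume comm: "comm_group (Aut_variety X)"
  have "f (g p) = g (f p)" if fg: "f \<in> carrier (Aut_variety X)" "g \<in> carrier (Aut_variety X)" and p: "p \<in> X" for f g p
  proof -
    have Bij: "f \<in> Bij X" "g \<in> Bij X" using fg by (auto simp: Aut_variety_mem_iff)
    have "f \<otimes>\<^bsub>Aut_variety X\<^esub> g = g \<otimes>\<^bsub>Aut_variety X\<^esub> f"
      using comm fg by (rule comm_groupE(4))
    then have "compose X f g p = compose X g f p" by (simp add: mult_Aut_variety Bij)
    then show ?thesis using p by (simp add: compose_eq)
  qed
  then have "carrier (canonical_group k P) \<subseteq> {(id, \<lambda>_. 1, 1)}"
    using canonical_group_trivial by auto
  then have carrier: "carrier (canonical_group k P) = {(id, \<lambda>_. 1, 1)}"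
    using one_in_canonical_group by blast
  have one: "\<one>\<^bsub>canonical_group k P\<^esub> = (id, \<lambda>_. 1, 1)"
    by (simp add: canonical_group_def big_group_def)
  have mult: "(id, \<lambda>_. 1, 1) \<otimes>\<^bsub>canonical_group k P\<^esub> (id, \<lambda>_. 1, 1) = (id, \<lambda>_. 1, 1)"
    by (simp add: canonical_group_def big_group_def)
  have "group (canonical_group k P)"
    by (rule groupI) (simp_all add: carrier one mult)
  then show "trivial_group (canonical_group k P)"
    by (simp add: trivial_group_def carrier one)
next
  assume "trivial_group (canonical_group k P)"
  then have trivial: "carrier (canonical_group k P) = {(id, \<lambda>_. 1, 1)}"
    by (simp add: trivial_group_def canonical_group_def big_group_def)
  show "comm_group (Aut_variety X)"
  proof (rule group.group_comm_groupI[OF group_Aut_variety])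
    fix f g assume fg: "f \<in> carrier (Aut_variety X)" "g \<in> carrier (Aut_variety X)"
    then have Bij: "f \<in> Bij X" "g \<in> Bij X" by (auto simp: Aut_variety_mem_iff)
    show "f \<otimes>\<^bsub>Aut_variety X\<^esub> g = g \<otimes>\<^bsub>Aut_variety X\<^esub> f"
      unfolding mult_Aut_variety[OF Bij] mult_Aut_variety[OF Bij(2,1)]
      using Aut_commutative[OF trivial fg] by (auto simp: compose_def fun_eq_iff)
  qed
qed

end

theorem corollary7p16:
  fixes k :: "'n :: {finite, linorder} \<Rightarrow> nat"
    and d :: nat
    and s :: "nat \<Rightarrow> ('n, 'k :: {alg_closed_field, field_char_0}) ypoly"
    and P :: "('n, 'k) yzpoly"
  assumes "d \<ge> 2"
    and "\<And>i. k i \<ge> 2"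
    and "P = Polynomial.monom 1 d + (\<Sum>j<d. Polynomial.monom (s j) j)"
    and "s (d - 1) = 0"
  shows "comm_group (Aut_variety (danielewski k P)) \<longleftrightarrow> trivial_group (canonical_group k P)"
proof -
  have coeff: "coeff P n = (if n = d then 1 else if n < d then s n else 0)" for n
    using assms(3) by (simp add: coeff_sum)
  have "degree P = d"
    by (rule antisym) (auto intro!: degree_le le_degree simp: coeff)
  then have "danielewski_data k d P"
    using assms(1,2,4) by unfold_locales (simp_all add: coeff)
  then show ?thesis by (rule danielewski_data.Aut_commutative_iff)
qed

end
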